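(* Let $(X^\delta,Y^\delta)_{\delta\in\Delta}$ be a family of pairs of closed, non-zero subspaces $X^\delta\subset X$, $Y^\delta\subset Y$ such that (1) $X^\delta\subseteq Y^\delta$ for all $\delta\in\Delta$; (2) $\gamma_\Delta^{\partial_t}:=\inf_{\delta\in\Delta}\ \inf_{\{w\in X^\delta:\ \partial_t w\neq 0\}}\dfrac{\|(\partial_t w)|_{Y^\delta}\|_{(Y^\delta)'}}{\|\partial_t w\|_{Y'}}>0$; (3) for each $\delta\in\Delta$ there is given a symmetric boundedly invertible linear map $K_Y^\delta:(Y^\delta)'\to Y^\delta$, and there are constants $0<r_\Delta\le R_\Delta<\infty$ with $r_\Delta\,(A_sv)(v)\le ((K_Y^\delta)^{-1}v)(v)\le R_\Delta\,(A_sv)(v)$ for all $\delta\in\Delta$, $v\in Y^\delta$. Let $\beta\ge 1$, $g\in Y'$, $u_0\in H$, and let $u\in X$ be the solution of $Bu=g$, $\gamma_0u=u_0$. Then for each $\delta\in\Delta$ there exists a unique $u^\delta\in X^\delta$ such that $$(Bw)\big(K_Y^\delta((Bu^\delta)|_{Y^\delta})\big)+\beta\langle\gamma_0u^\delta,\gamma_0w\rangle=(Bw)\big(K_Y^\delta(g|_{Y^\delta})\big)+\beta\langle u_0,\gamma_0w\rangle\qquad(w\in X^\delta),$$ and, with $\alpha:=\|A_a\|_{\mathcal L(Y,Y')}$ and $\gamma:=\gamma_\Delta^{\partial_t}$, $$\|u-u^\delta\|_X\le\sqrt{\frac{\max(R_\Delta,1)\Big(1+\tfrac12\big(\alpha^2+\alpha\sqrt{\alpha^2+4}\big)\Big)}{\min(r_\Delta,1)\,\tfrac12\Big(\gamma^2+\alpha^2+1-\sqrt{(\gamma^2+\alpha^2+1)^2-4\gamma^2}\Big)}}\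 \inf_{w\in X^\delta}\|u-w\|_X .$$
   Context: All spaces are over $\mathbb R$. $V,H$ are separable Hilbert spaces with $V\hookrightarrow H$ continuously and densely; $H$ is identified with its dual, giving the Gelfand triple $V\hookrightarrow H\simeq H'\hookrightarrow V'$. $\langle\cdot,\cdot\rangle$ denotes the scalar product on $H$ and its extension to the duality pairing on $V'\times V$ (or $V\times V'$); $\|\cdot\|$ is the norm of $H$. $I=(0,T)$. For a.e. $t\in I$, $a(t;\cdot,\cdot)$ is a bilinear form on $V\times V$, measurable in $t$ for each fixed pair of arguments, and, with constants independent of $t$, bounded, $|a(t;\eta,\zeta)|\lesssim\|\eta\|_V\|\zeta\|_V$, and coercive, $a(t;\eta,\eta)\gtrsim\|\eta\|_V^2$, for $\eta,\zeta\in V$. $X:=L_2(I;V)\cap H^1(I;V')$, $Y:=L_2(I;V)$. $\gamma_t:X\to H$, $u\mapsto u(t,\cdot)$, $t\in\bar I$, is the trace map. Operators: $A:Y\to Y'$, $(Aw)(v):=\int_I a(t;w(t),v(t))\,dt$; $A_s:=\frac12(A+A')$; $A_a:=\frac12(A-A')$; $\partial_t:X\to Y'$, $(\partial_tw)(v):=\int_I\langle\frac{dw}{dt}(t),v(t)\rangle\,dt$; $B:=\partial_t+A:X\to Y'$. Under these assumptions $(B,\gamma_0):X\to Y'\times H$ is boundedly invertible (known), so $Bu=g$, $\gamma_0u=u_0$ has a unique solution $u\in X$. Norms: $Y$ is equipped with $\|v\|_Y:=\sqrt{(A_sv)(v)}$ (equivalent to the standard norm), $Y'$ with the resulting dual norm,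 $Y^\delta$ with $\|\cdot\|_Y$ and $(Y^\delta)'$ with the resulting dual norm. For the constant $\beta\ge1$, $X$ is equipped with $\|w\|_X:=\sqrt{\|w\|_Y^2+\|\partial_tw\|_{Y'}^2+\|\gamma_Tw\|^2+(\beta-1)\|\gamma_0w\|^2}$. $\|A_a\|_{\mathcal L(Y,Y')}$ is the operator norm with respect to these norms. For $f\in Y'$, $f|_{Y^\delta}\in(Y^\delta)'$ is its restriction. Symmetry of $K_Y^\delta$ means $f(K_Y^\delta h)=h(K_Y^\delta f)$ for $f,h\in(Y^\delta)'$. The displayed equation for $u^\delta$ is the Euler–Lagrange equation of minimizing $\|(Bw-g)|_{Y^\delta}\|_{K_Y^\delta}^2+\beta\|\gamma_0w-u_0\|^2$ over $w\in X^\delta$, where $\|f\|_{K_Y^\delta}^2:=f(K_Y^\delta f)$. *)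

theory Defs
  imports "HOL-Analysis.Analysis"
begin

text \<open>
  Throughout, \<open>T\<close> is the end time, \<open>\<iota> :: 'v \<Rightarrow>\<^sub>L 'h\<close> is the embedding of \<open>V\<close> into \<open>H\<close>, the dual \<open>V'\<close> is
  the type \<open>'v \<Rightarrow>\<^sub>L real\<close>, and \<open>a\<close> is the time-dependent bilinear form.

  Elements of Lebesgue--Bochner spaces are represented by functions, and equality of elements is
  equality almost everywhere on \<open>(0,T)\<close>.  The norms below are therefore seminorms on functions, and
  a set of functions closed in such a seminorm is automatically saturated for a.e. equality.
\<close>

abbreviation leb_on :: "real \<Rightarrow> real measure" where
  "leb_on T \<equiv> lebesgue_on {0<..<T}"

definition ae_eq :: "real \<Rightarrow> (real \<Rightarrow> 'b) \<Rightarrow> (real \<Rightarrow> 'b) \<Rightarrow> bool" where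
  "ae_eq T u v \<longleftrightarrow> (AE t in leb_on T. u t = v t)"

text \<open>Borel measurability is strong measurability here, since \<open>V\<close> and (hence) \<open>V'\<close> are separable.\<close>

definition L2 :: "real \<Rightarrow> (real \<Rightarrow> 'b::real_normed_vector) set" where
  "L2 T = {f. f \<in> borel_measurable (leb_on T) \<and> integrable (leb_on T) (\<lambda>t. (norm (f t))\<^sup>2)}"

definition H_to_dual :: "('v::real_inner \<Rightarrow>\<^sub>L 'h::real_inner) \<Rightarrow> 'h \<Rightarrow> ('v \<Rightarrow>\<^sub>L real)" where
  "H_to_dual \<iota> h = blinfun_inner_right h o\<^sub>L \<iota>"

definition test_function :: "real \<Rightarrow> (real \<Rightarrow> real) \<Rightarrow> bool" where
  "test_function T \<phi> \<longleftrightarrow>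
     (\<forall>n t. ((deriv ^^ n) \<phi>) differentiable (at t)) \<and>
     (\<exists>c d. 0 < c \<and> d < T \<and> (\<forall>t. t \<notin> {c..d} \<longrightarrow> \<phi> t = 0))"

text \<open>The identity \<open>\<integral> \<phi>' w = - \<integral> \<phi> w'\<close> in \<open>V'\<close>, tested with each element of \<open>V\<close>.\<close>

definition weak_deriv ::
  "real \<Rightarrow> (real \<Rightarrow> ('v::real_normed_vector \<Rightarrow>\<^sub>L real)) \<Rightarrow> (real \<Rightarrow> ('v \<Rightarrow>\<^sub>L real)) \<Rightarrow> bool" where
  "weak_deriv T w w' \<longleftrightarrow>
     (\<forall>\<phi> \<eta>. test_function T \<phi> \<longrightarrow>
        (LINT t|leb_on T. deriv \<phi> t * blinfun_apply (w t) \<eta>)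
          = - (LINT t|leb_on T. \<phi> t * blinfun_apply (w' t) \<eta>))"

definition H1_dual :: "real \<Rightarrow> (real \<Rightarrow> ('v::real_normed_vector \<Rightarrow>\<^sub>L real)) set" where
  "H1_dual T = {w \<in> L2 T. \<exists>w'\<in>L2 T. weak_deriv T w w'}"

definition Yspace :: "real \<Rightarrow> (real \<Rightarrow> 'v::real_inner) set" where
  "Yspace T = L2 T"

definition Xspace :: "('v::real_inner \<Rightarrow>\<^sub>L 'h::real_inner) \<Rightarrow> real \<Rightarrow> (real \<Rightarrow> 'v) set" where
  "Xspace \<iota> T = {u \<in> L2 T. (\<lambda>t. H_to_dual \<iota> (\<iota> (u t))) \<in> H1_dual T}"

text \<open>The representative \<open>du/dt\<close> in \<open>L\<^sub>2(I;V')\<close>; it is unique up to a.e. equality for \<open>u \<in> X\<close>.\<close>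

definition time_deriv ::
  "('v::real_inner \<Rightarrow>\<^sub>L 'h::real_inner) \<Rightarrow> real \<Rightarrow> (real \<Rightarrow> 'v) \<Rightarrow> real \<Rightarrow> ('v \<Rightarrow>\<^sub>L real)" where
  "time_deriv \<iota> T u = (SOME u'. u' \<in> L2 T \<and> weak_deriv T (\<lambda>t. H_to_dual \<iota> (\<iota> (u t))) u')"

text \<open>
  The value at \<open>t \<in> [0,T]\<close> of the continuous \<open>H\<close>-valued representative of \<open>u\<close>.  For \<open>u \<in> X\<close> such a
  representative exists, and it is unique on \<open>[0,T]\<close>.
\<close>

definition trace_at :: "('v::real_inner \<Rightarrow>\<^sub>L 'h::real_inner) \<Rightarrow> real \<Rightarrow> real \<Rightarrow> (real \<Rightarrow> 'v) \<Rightarrow> 'h" where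
  "trace_at \<iota> T t u = (SOME c. continuous_on {0..T} c \<and> ae_eq T c (\<lambda>s. \<iota> (u s))) t"

definition A_op ::
  "real \<Rightarrow> (real \<Rightarrow> 'v \<Rightarrow> 'v \<Rightarrow> real) \<Rightarrow> (real \<Rightarrow> 'v) \<Rightarrow> (real \<Rightarrow> 'v) \<Rightarrow> real" where
  "A_op T a w v = (LINT t|leb_on T. a t (w t) (v t))"

text \<open>The adjoint \<open>A'\<close> is a map from \<open>Y'' = Y\<close> to \<open>Y'\<close>, namely \<open>(A' w)(v) = (A v)(w)\<close>.\<close>

definition As_op ::
  "real \<Rightarrow> (real \<Rightarrow> 'v \<Rightarrow> 'v \<Rightarrow> real) \<Rightarrow> (real \<Rightarrow> 'v) \<Rightarrow> (real \<Rightarrow> 'v) \<Rightarrow> real" where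
  "As_op T a w v = (A_op T a w v + A_op T a v w) / 2"

definition Aa_op ::
  "real \<Rightarrow> (real \<Rightarrow> 'v \<Rightarrow> 'v \<Rightarrow> real) \<Rightarrow> (real \<Rightarrow> 'v) \<Rightarrow> (real \<Rightarrow> 'v) \<Rightarrow> real" where
  "Aa_op T a w v = (A_op T a w v - A_op T a v w) / 2"

definition dt_op ::
  "('v::real_inner \<Rightarrow>\<^sub>L 'h::real_inner) \<Rightarrow> real \<Rightarrow> (real \<Rightarrow> 'v) \<Rightarrow> (real \<Rightarrow> 'v) \<Rightarrow> real" where
  "dt_op \<iota> T w v = (LINT t|leb_on T. blinfun_apply (time_deriv \<iota> T w t) (v t))"

definition B_op ::
  "('v::real_inner \<Rightarrow>\<^sub>L 'h::real_inner) \<Rightarrow> real \<Rightarrow> (real \<Rightarrow> 'v \<Rightarrow> 'v \<Rightarrow> real)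
    \<Rightarrow> (real \<Rightarrow> 'v) \<Rightarrow> (real \<Rightarrow> 'v) \<Rightarrow> real" where
  "B_op \<iota> T a w v = dt_op \<iota> T w v + A_op T a w v"

definition Ynorm :: "real \<Rightarrow> (real \<Rightarrow> 'v \<Rightarrow> 'v \<Rightarrow> real) \<Rightarrow> (real \<Rightarrow> 'v) \<Rightarrow> real" where
  "Ynorm T a v = sqrt (As_op T a v v)"

text \<open>
  For a subspace \<open>S\<close> of \<open>Y\<close>, an element of \<open>S'\<close> is represented by any functional that is linear and
  bounded on \<open>S\<close>; only its values on \<open>S\<close> matter.  In particular \<open>f \<in> Y'\<close> itself represents its
  restriction to \<open>S\<close>, and \<open>dual_norm T a S f\<close> is the norm of this restriction in \<open>S'\<close>.
\<close>

definition dual_space ::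
  "real \<Rightarrow> (real \<Rightarrow> 'v \<Rightarrow> 'v \<Rightarrow> real) \<Rightarrow> (real \<Rightarrow> 'v::real_vector) set \<Rightarrow> ((real \<Rightarrow> 'v) \<Rightarrow> real) set" where
  "dual_space T a S =
     {f. (\<forall>v\<in>S. \<forall>w\<in>S. f (\<lambda>t. v t + w t) = f v + f w) \<and>
         (\<forall>c. \<forall>v\<in>S. f (\<lambda>t. c *\<^sub>R v t) = c * f v) \<and>
         (\<exists>C. \<forall>v\<in>S. \<bar>f v\<bar> \<le> C * Ynorm T a v)}"

definition dual_norm ::
  "real \<Rightarrow> (real \<Rightarrow> 'v \<Rightarrow> 'v \<Rightarrow> real) \<Rightarrow> (real \<Rightarrow> 'v) set \<Rightarrow> ((real \<Rightarrow> 'v) \<Rightarrow> real) \<Rightarrow> real" where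
  "dual_norm T a S f = (SUP v\<in>{v\<in>S. Ynorm T a v \<le> 1}. \<bar>f v\<bar>)"

definition Aa_norm :: "real \<Rightarrow> (real \<Rightarrow> 'v::real_inner \<Rightarrow> 'v \<Rightarrow> real) \<Rightarrow> real" where
  "Aa_norm T a = (SUP w\<in>{w\<in>Yspace T. Ynorm T a w \<le> 1}. dual_norm T a (Yspace T) (Aa_op T a w))"

definition Xnorm ::
  "('v::real_inner \<Rightarrow>\<^sub>L 'h::real_inner) \<Rightarrow> real \<Rightarrow> (real \<Rightarrow> 'v \<Rightarrow> 'v \<Rightarrow> real) \<Rightarrow> real
    \<Rightarrow> (real \<Rightarrow> 'v) \<Rightarrow> real" where
  "Xnorm \<iota> T a \<beta> w =
     sqrt ((Ynorm T a w)\<^sup>2 + (dual_norm T a (Yspace T) (dt_op \<iota> T w))\<^sup>2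
           + (norm (trace_at \<iota> T T w))\<^sup>2 + (\<beta> - 1) * (norm (trace_at \<iota> T 0 w))\<^sup>2)"

definition closed_subspace_in ::
  "((real \<Rightarrow> 'v) \<Rightarrow> real) \<Rightarrow> (real \<Rightarrow> 'v::real_vector) set \<Rightarrow> (real \<Rightarrow> 'v) set \<Rightarrow> bool" where
  "closed_subspace_in nrm Z S \<longleftrightarrow>
     S \<subseteq> Z \<and> (\<lambda>t. 0) \<in> S \<and>
     (\<forall>v\<in>S. \<forall>w\<in>S. (\<lambda>t. v t + w t) \<in> S) \<and>
     (\<forall>c. \<forall>v\<in>S. (\<lambda>t. c *\<^sub>R v t) \<in> S) \<and>
     (\<forall>s w. (\<forall>k. s k \<in> S) \<and> w \<in> Z \<and> (\<lambda>k::nat. nrm (\<lambda>t. s k t - w t)) \<longlonglongrightarrow> 0 \<longrightarrow> w \<in> S)"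

text \<open>
  A boundedly invertible linear map \<open>S' \<rightarrow> S\<close>.  The last inequality gives injectivity and the
  boundedness of the inverse.  That \<open>K f\<close> only depends on \<open>f\<close> as an element of \<open>S'\<close> follows from
  linearity and boundedness.
\<close>

definition boundedly_invertible_map ::
  "real \<Rightarrow> (real \<Rightarrow> 'v \<Rightarrow> 'v \<Rightarrow> real) \<Rightarrow> (real \<Rightarrow> 'v::real_vector) set
    \<Rightarrow> (((real \<Rightarrow> 'v) \<Rightarrow> real) \<Rightarrow> (real \<Rightarrow> 'v)) \<Rightarrow> bool" where
  "boundedly_invertible_map T a S K \<longleftrightarrow>
     (\<forall>f\<in>dual_space T a S. K f \<in> S) \<and>
     (\<forall>f\<in>dual_space T a S. \<forall>h\<in>dual_space T a S. ae_eq T (K (\<lambda>v. f v + h v)) (\<lambda>t. K f t + K h t)) \<and>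
     (\<forall>c. \<forall>f\<in>dual_space T a S. ae_eq T (K (\<lambda>v. c * f v)) (\<lambda>t. c *\<^sub>R K f t)) \<and>
     (\<exists>C. \<forall>f\<in>dual_space T a S. Ynorm T a (K f) \<le> C * dual_norm T a S f) \<and>
     (\<forall>v\<in>S. \<exists>f\<in>dual_space T a S. ae_eq T (K f) v) \<and>
     (\<exists>C. \<forall>f\<in>dual_space T a S. dual_norm T a S f \<le> C * Ynorm T a (K f))"

definition symmetric_map ::
  "real \<Rightarrow> (real \<Rightarrow> 'v \<Rightarrow> 'v \<Rightarrow> real) \<Rightarrow> (real \<Rightarrow> 'v::real_vector) set
    \<Rightarrow> (((real \<Rightarrow> 'v) \<Rightarrow> real) \<Rightarrow> (real \<Rightarrow> 'v)) \<Rightarrow> bool" where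
  "symmetric_map T a S K \<longleftrightarrow> (\<forall>f\<in>dual_space T a S. \<forall>h\<in>dual_space T a S. f (K h) = h (K f))"

text \<open>\<open>K\<^sup>-\<^sup>1 v\<close>: as an element of \<open>S'\<close>, i.e. on \<open>S\<close>, it does not depend on the choice of \<open>f\<close>.\<close>

definition inverse_map ::
  "real \<Rightarrow> (real \<Rightarrow> 'v \<Rightarrow> 'v \<Rightarrow> real) \<Rightarrow> (real \<Rightarrow> 'v::real_vector) set
    \<Rightarrow> (((real \<Rightarrow> 'v) \<Rightarrow> real) \<Rightarrow> (real \<Rightarrow> 'v)) \<Rightarrow> (real \<Rightarrow> 'v) \<Rightarrow> (real \<Rightarrow> 'v) \<Rightarrow> real" where
  "inverse_map T a S K v = (SOME f. f \<in> dual_space T a S \<and> ae_eq T (K f) v)"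

text \<open>
  All quotients are at most 1, so \<open>min 1\<close> is only relevant if \<open>\<partial>\<^sub>t w = 0\<close> for every \<open>w\<close> in every
  \<open>X\<^sup>\<delta>\<close>: the infimum is then over the empty set, and \<open>\<infinity>\<close> is replaced by 1.
\<close>

definition gamma_dt ::
  "('v::real_inner \<Rightarrow>\<^sub>L 'h::real_inner) \<Rightarrow> real \<Rightarrow> (real \<Rightarrow> 'v \<Rightarrow> 'v \<Rightarrow> real) \<Rightarrow> 'd set
    \<Rightarrow> ('d \<Rightarrow> (real \<Rightarrow> 'v) set) \<Rightarrow> ('d \<Rightarrow> (real \<Rightarrow> 'v) set) \<Rightarrow> real" where
  "gamma_dt \<iota> T a \<Delta> X Y =
     real_of_ereal (min 1
       (INF \<delta>\<in>\<Delta>. INF w\<in>{w \<in> X \<delta>. \<exists>v\<in>Yspace T. dt_op \<iota> T w v \<noteq> 0}.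
          ereal (dual_norm T a (Y \<delta>) (dt_op \<iota> T w) / dual_norm T a (Yspace T) (dt_op \<iota> T w))))"

end

theory Submission
  imports Defs
begin

text \<open>
  The discrete solution is the orthogonal projection of \<open>u\<close> on \<open>X\<^sup>\<delta>\<close> for the residual form
  \<open>E(z,w) = (Bw)(K Bz) + \<beta> \<langle>\<gamma>\<^sub>0 z, \<gamma>\<^sub>0 w\<rangle>\<close>.  The error of a projection is bounded by its norm times the
  error of best approximation, so it suffices to compare \<open>E\<close> with the norm of \<open>X\<close>: from above on \<open>X\<close>
  and from below on \<open>X\<^sup>\<delta>\<close>.

  Since \<open>A\<^sub>s\<close> is the Riesz map of \<open>Y\<close> and \<open>(A\<^sub>a w)(w) = 0\<close>, for \<open>w \<in> S\<close> the squared dual norm of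
  \<open>Bw = (\<partial>\<^sub>t + A\<^sub>a) w + A\<^sub>s w\<close> on a subspace \<open>S\<close> of \<open>Y\<close> is
  \<open>\<parallel>(\<partial>\<^sub>t + A\<^sub>a) w\<parallel>\<^sup>2 + 2 (\<partial>\<^sub>t w)(w) + \<parallel>w\<parallel>\<^sup>2\<close>, and \<open>2 (\<partial>\<^sub>t w)(w) = \<parallel>w(T)\<parallel>\<^sup>2 - \<parallel>w(0)\<parallel>\<^sup>2\<close>.  What remains are two
  quadratic forms in \<open>\<parallel>\<partial>\<^sub>t w\<parallel>\<close> and \<open>\<parallel>w\<parallel>\<close>, whose extreme eigenvalues are the constants of the theorem.

  The functional-analytic input is the trace theory of \<open>X\<close>.  A function of \<open>X\<close> satisfies
  \<open>\<langle>u(t) - u(s), \<eta>\<rangle> = \<integral>\<^sub>s\<^sup>t \<langle>u', \<eta>\<rangle>\<close> for almost all \<open>s < t\<close>; summing this with \<open>\<eta> = u(t) + u(s)\<close> over fine partitions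
  with well-chosen nodes gives the energy identity, and the energy identity for \<open>u - u(r)\<close>, with \<open>r\<close> such
  that \<open>\<parallel>u(r)\<parallel>\<close> in \<open>V\<close> is at most its local mean, shows that \<open>u\<close> is uniformly continuous into \<open>H\<close> off a null set.
\<close>

section \<open>Semi-inner products and the Riesz isomorphism\<close>

text \<open>The norm of X consists of what survives in the residual: adding
  \<open>\<beta> |w(0)|\<^sup>2\<close> to \<open>|w(T)|\<^sup>2 - |w(0)|\<^sup>2\<close> leaves
  \<open>|w(T)|\<^sup>2 + (\<beta> - 1) |w(0)|\<^sup>2\<close>, so the traces match and only the
  forms in \<open>|\<partial>\<^sub>t w|\<close> and \<open>|w|\<close> have to be compared.
  Completing the square with \<open>A\<^sub>s w\<close> requires that w be a test function itself.
  On all of X this means S = Y, which is enough for the upper bound, since restriction decreases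
  dual norms. For the lower bound \<open>S = Y\<^sup>\<delta>\<close> is admissible because it
  contains \<open>X\<^sup>\<delta>\<close>, and \<gamma> pays for passing from Y' to
  \<open>(Y\<^sup>\<delta>)'\<close>. The operator K exchanges squared dual norms for f(K f) at the
  cost of r and R; the trace term has weight 1, whence min(r,1) and max(R,1). Existence of the
  discrete solution is the Riesz theorem for E, and this needs X to be complete in its norm.
  Existence of traces does not give that; a bound of the traces by the L2 norms of u and u' does.
  Elements are functions, not classes, so that linearity of K holds only up to null sets. Such
  identities are used only after a bounded functional has been applied.\<close>

lemma quadratic_nonneg_imp_Cauchy_Schwarz:
  fixes A B C :: real
  assumes nonneg: "\<And>t. 0 \<le> A + 2 * B * t + C * t\<^sup>2"
  shows "B\<^sup>2 \<le> A * C"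
proof (cases "C = 0")
  case True
  have "B = 0"
  proof (rule ccontr)
    assume B: "B \<noteq> 0"
    have "A + 2 * B * (- (A + 1) / (2 * B)) = -1"
      using B by (simp add: field_simps)
    with nonneg[of "- (A + 1) / (2 * B)"] True show False by simp
  qed
  with True show ?thesis by simp
next
  case False
  have C: "C > 0"
  proof (rule ccontr)
    assume "\<not> C > 0"
    with False have C: "C < 0" by simp
    \<comment> \<open>Chosen so that \<open>- C * t\<close> exceeds
      \<open>\<bar>A\<bar> + 2 * \<bar>B\<bar>\<close>; since t is at least 1, the quadratic term
      then beats the constant and the linear one.\<close>
    define t where "t = 1 + (\<bar>A\<bar> + 2 * \<bar>B\<bar>) / (- C)"
    have t1: "t \<ge> 1" using C by (simp add: t_def divide_nonneg_neg)
    have Ct: "- C * t = - C + (\<bar>A\<bar> + 2 * \<bar>B\<bar>)" using C by (simp add: t_def field_simps)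
    have "A + 2 * B * t \<le> (\<bar>A\<bar> + 2 * \<bar>B\<bar>) * t"
    proof -
      have "A \<le> \<bar>A\<bar> * t" using t1 by (metis abs_ge_self abs_ge_zero mult.right_neutral mult_left_mono order_trans)
      moreover have "2 * B * t \<le> 2 * \<bar>B\<bar> * t" using t1 by (simp add: mult_right_mono)
      ultimately show ?thesis by (simp add: algebra_simps)
    qed
    also have "\<dots> < (- C * t) * t" using t1 C Ct by (intro mult_strict_right_mono) auto
    finally have "A + 2 * B * t + C * t\<^sup>2 < 0" by (simp add: power2_eq_square)
    with nonneg[of t] show False by simp
  qed
  have "A + 2 * B * (- B / C) + C * (- B / C)\<^sup>2 = A - B\<^sup>2 / C"
    using C by (simp add: field_simps power2_eq_square)
  with nonneg[of "- B / C"] have "B\<^sup>2 / C \<le> A" by simp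
  with C show ?thesis by (simp add: pos_divide_le_eq)
qed

text \<open>The direct method: \<open>mid\<close> is the parallelogram law as an inequality, so
  near-minimizers are close in the sense of \<open>d\<close> and every minimizing sequence is
  Cauchy. Here \<open>d\<close> stands for a multiple of a squared seminorm.\<close>

lemma minimizer_exists:
  fixes q :: "'a \<Rightarrow> real" and d :: "'a \<Rightarrow> 'a \<Rightarrow> real"
  assumes ne: "S \<noteq> {}" and low: "\<And>x. x \<in> S \<Longrightarrow> L \<le> q x"
    and mid: "\<And>x y. x \<in> S \<Longrightarrow> y \<in> S \<Longrightarrow> \<exists>m\<in>S. q m \<le> (q x + q y) / 2 - d x y"
    and complete: "\<And>s c. (\<And>n. s n \<in> S) \<Longrightarrow> (\<forall>e>0. \<exists>N. \<forall>m\<ge>N. \<forall>n\<ge>N. d (s m) (s n) < e)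
       \<Longrightarrow> (\<lambda>n. q (s n)) \<longlonglongrightarrow> c \<Longrightarrow> \<exists>x\<in>S. q x \<le> c"
  shows "\<exists>x\<in>S. \<forall>y\<in>S. q x \<le> q y"
proof -
  define I where "I = Inf (q ` S)"
  have bdd: "bdd_below (q ` S)" using low by (intro bdd_belowI[of _ L]) auto
  have I_le: "I \<le> q x" if "x \<in> S" for x unfolding I_def using that bdd by (intro cInf_lower) auto
  have "\<exists>x\<in>S. q x < I + 1 / real (Suc n)" for n
  proof -
    have "Inf (q ` S) < I + 1 / real (Suc n)" by (simp add: I_def)
    with cInf_lessD[of "q ` S"] ne show ?thesis by blast
  qed
  then obtain s where s: "s n \<in> S" "q (s n) < I + 1 / real (Suc n)" for n by metis
  have lim: "(\<lambda>n. q (s n)) \<longlonglongrightarrow> I"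
  proof (rule tendsto_sandwich)
    show "\<forall>\<^sub>F n in sequentially. I \<le> q (s n)" using I_le s by simp
    show "\<forall>\<^sub>F n in sequentially. q (s n) \<le> I + 1 / real (Suc n)" by (intro always_eventually allI less_imp_le s)
    show "(\<lambda>n. I + 1 / real (Suc n)) \<longlonglongrightarrow> I"
      using tendsto_add[OF tendsto_const LIMSEQ_inverse_real_of_nat, of I] by (simp add: inverse_eq_divide)
  qed simp
  have "\<forall>e>0. \<exists>N. \<forall>m\<ge>N. \<forall>n\<ge>N. d (s m) (s n) < e"
  proof (intro allI impI)
    fix e :: real assume "e > 0"
    then obtain N where "\<forall>n\<ge>N. q (s n) < I + e"
      using order_tendstoD(2)[OF lim, of "I + e"] by (auto simp: eventually_sequentially)
    \<comment> \<open>The midpoint cannot fall below the infimum, so \<open>mid\<close> leaves less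
      than e for \<open>d x y\<close>.\<close>
    moreover have "d x y < e" if "x \<in> S" "y \<in> S" "q x < I + e" "q y < I + e" for x y
    proof -
      obtain m where "m \<in> S" "q m \<le> (q x + q y) / 2 - d x y" using mid \<open>x \<in> S\<close> \<open>y \<in> S\<close> by blast
      with I_le[of m] that show ?thesis by (simp add: field_simps)
    qed
    ultimately show "\<exists>N. \<forall>m\<ge>N. \<forall>n\<ge>N. d (s m) (s n) < e" using s(1) by meson
  qed
  with complete s(1) lim obtain x where "x \<in> S" "q x \<le> I" by blast
  with I_le show ?thesis by (meson order_trans)
qed

text \<open>
  Vector space axioms for \<open>add\<close> and \<open>scale\<close> are not needed, since all identities are used only under
  the bilinear form \<open>E\<close>.  This permits carriers that consist of functions.
\<close>

locale semi_inner_product =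
  fixes Z :: "'x set" and add :: "'x \<Rightarrow> 'x \<Rightarrow> 'x" and scale :: "real \<Rightarrow> 'x \<Rightarrow> 'x" and E :: "'x \<Rightarrow> 'x \<Rightarrow> real"
  assumes add_closed: "x \<in> Z \<Longrightarrow> y \<in> Z \<Longrightarrow> add x y \<in> Z"
    and scale_closed: "x \<in> Z \<Longrightarrow> scale c x \<in> Z"
    and form_sym: "x \<in> Z \<Longrightarrow> y \<in> Z \<Longrightarrow> E x y = E y x"
    and form_add: "x \<in> Z \<Longrightarrow> y \<in> Z \<Longrightarrow> z \<in> Z \<Longrightarrow> E (add x y) z = E x z + E y z"
    and form_scale: "x \<in> Z \<Longrightarrow> y \<in> Z \<Longrightarrow> E (scale c x) y = c * E x y"
    and form_nonneg: "x \<in> Z \<Longrightarrow> 0 \<le> E x x"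
begin

abbreviation sub :: "'x \<Rightarrow> 'x \<Rightarrow> 'x" where
  "sub x y \<equiv> add x (scale (- 1) y)"

lemma form_add_right: "x \<in> Z \<Longrightarrow> y \<in> Z \<Longrightarrow> z \<in> Z \<Longrightarrow> E z (add x y) = E z x + E z y"
  using form_add form_sym add_closed by metis

lemma form_scale_right: "x \<in> Z \<Longrightarrow> y \<in> Z \<Longrightarrow> E y (scale c x) = c * E y x"
  using form_scale form_sym scale_closed by metis

lemmas form_simps = add_closed scale_closed form_add form_add_right form_scale form_scale_right

lemma form_combination:
  assumes "x \<in> Z" "y \<in> Z"
  shows "E (add (scale s x) (scale t y)) (add (scale s x) (scale t y)) = s\<^sup>2 * E x x + 2 * (s * t) * E x y + t\<^sup>2 * E y y"
  using assms form_sym[OF assms] by (simp add: form_simps power2_eq_square algebra_simps)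

lemma form_sub: "x \<in> Z \<Longrightarrow> y \<in> Z \<Longrightarrow> E (sub x y) (sub x y) = E x x - 2 * E x y + E y y"
  using form_sym[of x y] by (simp add: form_simps algebra_simps)

lemma form_Cauchy_Schwarz:
  assumes "x \<in> Z" "y \<in> Z" shows "(E x y)\<^sup>2 \<le> E x x * E y y"
proof (rule quadratic_nonneg_imp_Cauchy_Schwarz)
  fix t :: real
  show "0 \<le> E x x + 2 * E x y * t + E y y * t\<^sup>2"
    using form_combination[OF assms, of 1 t] form_nonneg[of "add (scale 1 x) (scale t y)"] assms
    by (simp add: form_simps algebra_simps)
qed

lemma form_le_sqrt: "x \<in> Z \<Longrightarrow> y \<in> Z \<Longrightarrow> \<bar>E x y\<bar> \<le> sqrt (E x x) * sqrt (E y y)"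
  using form_Cauchy_Schwarz[of x y] by (metis real_sqrt_abs real_sqrt_le_iff real_sqrt_mult)

text \<open>The representer is the minimizer of \<open>E x x - 2 * f x\<close>. Since E may be
  degenerate, completeness is phrased as existence of some limit in the seminorm, and no uniqueness
  is claimed.\<close>

lemma Riesz:
  assumes W: "W \<subseteq> Z" "W \<noteq> {}"
    and W_add: "\<And>x y. x \<in> W \<Longrightarrow> y \<in> W \<Longrightarrow> add x y \<in> W"
    and W_scale: "\<And>c x. x \<in> W \<Longrightarrow> scale c x \<in> W"
    and f_add: "\<And>x y. x \<in> W \<Longrightarrow> y \<in> W \<Longrightarrow> f (add x y) = f x + f y"
    and f_scale: "\<And>c x. x \<in> W \<Longrightarrow> f (scale c x) = c * f x"
    and f_bound: "\<And>x. x \<in> W \<Longrightarrow> \<bar>f x\<bar> \<le> C * sqrt (E x x)"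
    and complete: "\<And>s. (\<And>n. s n \<in> W) \<Longrightarrow>
      (\<forall>e>0. \<exists>N. \<forall>m\<ge>N. \<forall>n\<ge>N. E (sub (s m) (s n)) (sub (s m) (s n)) < e) \<Longrightarrow>
      \<exists>w\<in>W. (\<lambda>n. E (sub (s n) w) (sub (s n) w)) \<longlonglongrightarrow> 0"
  shows "\<exists>x\<in>W. \<forall>y\<in>W. E x y = f y"
proof -
  define q where "q x = E x x - 2 * f x" for x
  have WZ: "x \<in> Z" if "x \<in> W" for x using W that by blast
  have "\<exists>x\<in>W. \<forall>y\<in>W. q x \<le> q y"
  \<comment> \<open>Completing the square gives the lower bound; the defect in the parallelogram law
    at a midpoint is a quarter of the squared distance.\<close>
  proof (rule minimizer_exists[where L = "- C\<^sup>2" and d = "\<lambda>x y. E (sub x y) (sub x y) / 4"])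
    show "- C\<^sup>2 \<le> q x" if x: "x \<in> W" for x
    proof -
      have "f x \<le> C * sqrt (E x x)" using f_bound[OF x] by simp
      moreover have "0 \<le> (sqrt (E x x) - C)\<^sup>2" by simp
      moreover have "(sqrt (E x x))\<^sup>2 = E x x" using form_nonneg[OF WZ[OF x]] by simp
      ultimately show ?thesis unfolding q_def power2_diff by (simp add: algebra_simps)
    qed
    show "\<exists>m\<in>W. q m \<le> (q x + q y) / 2 - E (sub x y) (sub x y) / 4" if xy: "x \<in> W" "y \<in> W" for x y
    proof
      let ?m = "add (scale (1/2) x) (scale (1/2) y)"
      show "?m \<in> W" using xy W_add W_scale by blast
      have "E ?m ?m = (1/2)\<^sup>2 * E x x + 2 * (1/2 * (1/2)) * E x y + (1/2)\<^sup>2 * E y y"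
        using form_combination WZ xy by blast
      moreover have "f ?m = (f x + f y) / 2" using xy f_add f_scale W_scale by (simp add: field_simps)
      ultimately show "q ?m \<le> (q x + q y) / 2 - E (sub x y) (sub x y) / 4"
        unfolding q_def using form_sub[OF WZ[OF xy(1)] WZ[OF xy(2)]] by (simp add: power2_eq_square field_simps)
    qed
    fix s c
    assume s: "\<And>n. s n \<in> W" and Cau: "\<forall>e>0. \<exists>N. \<forall>m\<ge>N. \<forall>n\<ge>N. E (sub (s m) (s n)) (sub (s m) (s n)) / 4 < e"
      and c: "(\<lambda>n. q (s n)) \<longlonglongrightarrow> c"
    have "\<forall>e>0. \<exists>N. \<forall>m\<ge>N. \<forall>n\<ge>N. E (sub (s m) (s n)) (sub (s m) (s n)) < e"
    proof (intro allI impI)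
      fix e :: real assume "e > 0"
      then have "e / 4 > 0" by simp
      with Cau obtain N where "\<forall>m\<ge>N. \<forall>n\<ge>N. E (sub (s m) (s n)) (sub (s m) (s n)) / 4 < e / 4" by blast
      then show "\<exists>N. \<forall>m\<ge>N. \<forall>n\<ge>N. E (sub (s m) (s n)) (sub (s m) (s n)) < e" by auto
    qed
    from complete[OF s this] obtain w where w: "w \<in> W" and lim: "(\<lambda>n. E (sub (s n) w) (sub (s n) w)) \<longlonglongrightarrow> 0" by blast
    have d: "sub (s n) w \<in> W" for n using s w W_add W_scale by blast
    \<comment> \<open>Both f and \<open>E w\<close> are dominated by the seminorm, so expanding q
      about w shows that \<open>q (s n)\<close> tends to \<open>q w\<close>.\<close>
    have sqrt_lim: "(\<lambda>n. k * sqrt (E (sub (s n) w) (sub (s n) w))) \<longlonglongrightarrow> 0" for k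
      using tendsto_mult[OF tendsto_const tendsto_real_sqrt[OF lim], of k] by simp
    have "(\<lambda>n. f (sub (s n) w)) \<longlonglongrightarrow> 0"
      by (rule Lim_null_comparison[OF _ sqrt_lim[of C]]) (use f_bound[OF d] in auto)
    moreover have "(\<lambda>n. E w (sub (s n) w)) \<longlonglongrightarrow> 0"
      by (rule Lim_null_comparison[OF _ sqrt_lim[of "sqrt (E w w)"]]) (use form_le_sqrt WZ w d in auto)
    ultimately have "(\<lambda>n. q w + E (sub (s n) w) (sub (s n) w) + 2 * E w (sub (s n) w) - 2 * f (sub (s n) w)) \<longlonglongrightarrow> q w + 0 + 2 * 0 - 2 * 0"
      by (intro tendsto_intros lim)
    moreover have "q w + E (sub (s n) w) (sub (s n) w) + 2 * E w (sub (s n) w) - 2 * f (sub (s n) w) = q (s n)" for n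
      using form_sym[OF WZ[OF w] WZ[OF s[of n]]] f_add[OF s W_scale[OF w], of n "-1"] f_scale[OF w, of "-1"]
      by (simp add: q_def form_simps WZ s w algebra_simps)
    ultimately have "(\<lambda>n. q (s n)) \<longlonglongrightarrow> q w" by simp
    with c have "q w = c" using LIMSEQ_unique by blast
    with w show "\<exists>x\<in>W. q x \<le> c" by auto
  qed (use W in auto)
  then obtain x where x: "x \<in> W" "\<And>y. y \<in> W \<Longrightarrow> q x \<le> q y" by blast
  have "E x y = f y" if y: "y \<in> W" for y
  proof -
    \<comment> \<open>First variation: along x + t y the functional is a quadratic in t with its
      minimum at t = 0. The discriminant inequality with constant term 0 kills the linear
      coefficient.\<close>
    have "0 \<le> 0 + 2 * (E x y - f y) * t + E y y * t\<^sup>2" for t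
    proof -
      let ?z = "add x (scale t y)"
      have "q ?z = q x + 2 * (E x y - f y) * t + E y y * t\<^sup>2"
        using form_sym[OF WZ[OF x(1)] WZ[OF y]] f_add[OF x(1) W_scale[OF y], of t] f_scale[OF y, of t]
        by (simp add: q_def form_simps WZ x y power2_eq_square algebra_simps)
      with x(2)[OF W_add[OF x(1) W_scale[OF y, of t]]] show ?thesis by simp
    qed
    from quadratic_nonneg_imp_Cauchy_Schwarz[OF this] show ?thesis by simp
  qed
  with x(1) show ?thesis by blast
qed

end

section \<open>The Riesz map of a Hilbert space\<close>

lemma Riesz_representation:
  fixes \<phi> :: "'v::{real_inner, banach} \<Rightarrow>\<^sub>L real"
  shows "\<exists>x. \<forall>\<eta>. inner x \<eta> = \<phi> \<eta>"
proof -
  interpret V: semi_inner_product "UNIV :: 'v set" "(+)" "(*\<^sub>R)" inner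
    by standard (auto simp: inner_add_left intro: inner_commute)
  have "\<exists>x\<in>UNIV. \<forall>\<eta>\<in>UNIV. inner x \<eta> = \<phi> \<eta>"
  proof (rule V.Riesz)
    show "\<bar>\<phi> x\<bar> \<le> norm \<phi> * sqrt (inner x x)" for x
      using norm_blinfun[of \<phi> x] by (simp add: norm_eq_sqrt_inner)
    fix s :: "nat \<Rightarrow> 'v"
    assume C: "\<forall>e>0. \<exists>N. \<forall>m\<ge>N. \<forall>n\<ge>N. inner (s m + - 1 *\<^sub>R s n) (s m + - 1 *\<^sub>R s n) < e"
    have "Cauchy s"
    proof (rule CauchyI)
      fix e :: real assume e: "e > 0"
      then have "e\<^sup>2 > 0" by simp
      with C obtain N where N: "\<forall>m\<ge>N. \<forall>n\<ge>N. inner (s m + - 1 *\<^sub>R s n) (s m + - 1 *\<^sub>R s n) < e\<^sup>2" by blast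
      show "\<exists>N. \<forall>m\<ge>N. \<forall>n\<ge>N. norm (s m - s n) < e"
        using N e by (intro exI[of _ N]) (auto simp: power2_norm_eq_inner[symmetric] intro: power_less_imp_less_base[where n = 2])
    qed
    then obtain x where x: "s \<longlonglongrightarrow> x" using Cauchy_convergent_iff convergent_def by blast
    have "(\<lambda>n. (norm (s n - x))\<^sup>2) \<longlonglongrightarrow> (norm (x - x))\<^sup>2" by (intro tendsto_intros x)
    then show "\<exists>w\<in>UNIV. (\<lambda>n. inner (s n + - 1 *\<^sub>R w) (s n + - 1 *\<^sub>R w)) \<longlonglongrightarrow> 0"
      by (intro bexI[of _ x]) (auto simp: power2_norm_eq_inner)
  qed (auto simp: blinfun.add_right blinfun.scaleR_right)
  then show ?thesis by blast
qed

text \<open>Moves functions with values in V' to functions with values in V, where separability is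
  the type class that \<open>L2_add\<close> and \<open>L2_complete\<close> ask for.\<close>

definition riesz :: "('v::{real_inner, banach} \<Rightarrow>\<^sub>L real) \<Rightarrow> 'v" where
  "riesz \<phi> = (SOME x. \<forall>\<eta>. inner x \<eta> = \<phi> \<eta>)"

lemma inner_riesz: "inner (riesz \<phi>) \<eta> = blinfun_apply \<phi> \<eta>"
  unfolding riesz_def using someI_ex[OF Riesz_representation, of \<phi>] by blast

lemma riesz_eqI: "(\<And>\<eta>. inner x \<eta> = blinfun_apply \<phi> \<eta>) \<Longrightarrow> riesz \<phi> = x"
  using inner_riesz[of \<phi>] vector_eq_rdot[of "riesz \<phi>" x] by metis

lemma norm_riesz [simp]: "norm (riesz \<phi>) = norm \<phi>"
proof (rule antisym)
  have "norm (riesz \<phi>) * norm (riesz \<phi>) \<le> norm \<phi> * norm (riesz \<phi>)"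
    using norm_blinfun[of \<phi> "riesz \<phi>"] inner_riesz[of \<phi> "riesz \<phi>"] by (simp add: power2_norm_eq_inner[symmetric] power2_eq_square)
  then show "norm (riesz \<phi>) \<le> norm \<phi>"
    by (metis mult_right_le_imp_le norm_ge_zero order_le_less)
  show "norm \<phi> \<le> norm (riesz \<phi>)"
    by (rule norm_blinfun_bound) (auto simp: inner_riesz[symmetric] Cauchy_Schwarz_ineq2)
qed

lemma bounded_linear_riesz: "bounded_linear (riesz :: ('v::{real_inner, banach} \<Rightarrow>\<^sub>L real) \<Rightarrow> 'v)"
proof (rule bounded_linear_intro[where K = 1])
  show "riesz (x + y) = riesz x + riesz y" for x y :: "'v \<Rightarrow>\<^sub>L real"
    by (rule riesz_eqI) (simp add: inner_simps inner_riesz blinfun.add_left)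
  show "riesz (r *\<^sub>R x) = r *\<^sub>R riesz x" for r and x :: "'v \<Rightarrow>\<^sub>L real"
    by (rule riesz_eqI) (simp add: inner_simps inner_riesz blinfun.scaleR_left)
qed simp

section \<open>Square integrable functions\<close>

lemma (in complete_measure) borel_measurable_cong_AE:
  assumes f: "f \<in> borel_measurable M" and ae: "AE x in M. f x = g x"
  shows "g \<in> borel_measurable M"
proof (rule measurableI)
  fix A :: "'b set" assume "A \<in> sets borel"
  with f have "f -` A \<inter> space M \<in> sets M" by (rule measurable_sets)
  then show "g -` A \<inter> space M \<in> sets M"
    by (rule in_sets_AE[rotated]) (use ae in \<open>auto elim: AE_mp\<close>)
qed simp

lemma complete_measure_leb_on: "complete_measure (leb_on T)"
proof
  fix A B assume BA: "B \<subseteq> A" and A: "A \<in> null_sets (leb_on T)"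
  have I: "{0<..<T} \<in> sets lebesgue" by simp
  have "A \<subseteq> {0<..<T}" "A \<in> null_sets lebesgue" using A null_sets_restrict_space[OF I] by auto
  with BA completion.complete2[OF BA] show "B \<in> sets (leb_on T)"
    by (subst sets_restrict_space_iff) auto
qed

lemma finite_measure_leb_on: "finite_measure (leb_on T)"
  by (rule finite_measure_lebesgue_on) simp

lemma measure_leb_on_space: "T > 0 \<Longrightarrow> measure (leb_on T) {0<..<T} = T"
  by (simp add: measure_restrict_space)

lemma integrable_leb_on_const [simp]: "integrable (leb_on T) (\<lambda>t. c)"
  using finite_measure.integrable_const[OF finite_measure_leb_on] .

abbreviation sqint :: "real \<Rightarrow> (real \<Rightarrow> 'b::real_normed_vector) \<Rightarrow> real" where
  "sqint T f \<equiv> (LINT t|leb_on T. (norm (f t))\<^sup>2)"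

lemma L2D:
  assumes "f \<in> L2 T"
  shows L2_measurable: "f \<in> borel_measurable (leb_on T)"
    and L2_square_integrable: "integrable (leb_on T) (\<lambda>t. (norm (f t))\<^sup>2)"
  using assms by (auto simp: L2_def)

lemma L2_bound:
  assumes "f \<in> borel_measurable (leb_on T)" "integrable (leb_on T) h" "AE t in leb_on T. (norm (f t))\<^sup>2 \<le> h t"
  shows "f \<in> L2 T"
  unfolding L2_def
  using assms by (auto intro!: Bochner_Integration.integrable_bound[OF assms(2)] elim!: AE_mp)

lemma L2_zero [simp]: "(\<lambda>t. 0) \<in> L2 T"
  by (rule L2_bound[where h = "\<lambda>_. 0"]) auto

lemma L2_const [simp]: "(\<lambda>t. c) \<in> L2 T"
  by (rule L2_bound[where h = "\<lambda>_. (norm c)\<^sup>2"]) auto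

lemma L2_scaleR:
  fixes f :: "real \<Rightarrow> 'b::{real_normed_vector, second_countable_topology}"
  shows "f \<in> L2 T \<Longrightarrow> (\<lambda>t. c *\<^sub>R f t) \<in> L2 T"
  by (rule L2_bound[where h = "\<lambda>t. c\<^sup>2 * (norm (f t))\<^sup>2"])
     (auto dest: L2D simp: power_mult_distrib)

lemma power2_norm_add_le: "(norm (x + y))\<^sup>2 \<le> 2 * (norm x)\<^sup>2 + 2 * (norm (y::'b::real_normed_vector))\<^sup>2"
proof -
  have "(norm (x + y))\<^sup>2 \<le> (norm x + norm y)\<^sup>2" by (simp add: norm_triangle_ineq power_mono)
  also have "\<dots> = 2 * (norm x)\<^sup>2 + 2 * (norm y)\<^sup>2 - (norm x - norm y)\<^sup>2"
    by (simp add: power2_eq_square algebra_simps)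
  finally show ?thesis by (smt (verit) zero_le_power2)
qed

lemma L2_add:
  fixes f g :: "real \<Rightarrow> 'b::{real_normed_vector, second_countable_topology}"
  assumes "f \<in> L2 T" "g \<in> L2 T"
  shows "(\<lambda>t. f t + g t) \<in> L2 T"
  by (rule L2_bound[where h = "\<lambda>t. 2 * (norm (f t))\<^sup>2 + 2 * (norm (g t))\<^sup>2"])
     (use L2D[OF assms(1)] L2D[OF assms(2)] in \<open>auto simp: power2_norm_add_le\<close>)

lemma L2_diff:
  fixes f g :: "real \<Rightarrow> 'b::{real_normed_vector, second_countable_topology}"
  assumes "f \<in> L2 T" "g \<in> L2 T"
  shows "(\<lambda>t. f t - g t) \<in> L2 T"
  using L2_add[OF assms(1) L2_scaleR[OF assms(2), of "-1"]] by simp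

lemma L2_cong_AE:
  assumes "f \<in> L2 T" "AE t in leb_on T. f t = g t"
  shows "g \<in> L2 T"
proof (rule L2_bound)
  show "g \<in> borel_measurable (leb_on T)"
    using complete_measure.borel_measurable_cong_AE[OF complete_measure_leb_on] L2D assms by blast
  show "AE t in leb_on T. (norm (g t))\<^sup>2 \<le> (norm (f t))\<^sup>2" using assms(2) by (auto elim: AE_mp)
qed (use assms L2D in blast)

lemma L2_bounded_linear:
  fixes f :: "real \<Rightarrow> 'b::real_normed_vector" and A :: "'b \<Rightarrow> 'c::real_normed_vector"
  assumes A: "bounded_linear A" and f: "f \<in> L2 T"
  shows "(\<lambda>t. A (f t)) \<in> L2 T"
proof -
  obtain K where K: "\<And>x. norm (A x) \<le> norm x * K"
    using bounded_linear.bounded[OF A] by blast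
  show ?thesis
  proof (rule L2_bound[where h = "\<lambda>t. K\<^sup>2 * (norm (f t))\<^sup>2"])
    show "(\<lambda>t. A (f t)) \<in> borel_measurable (leb_on T)"
      by (rule measurable_compose[OF L2_measurable[OF f]])
         (simp add: borel_measurable_continuous_onI linear_continuous_on A)
    have "(norm (A x))\<^sup>2 \<le> K\<^sup>2 * (norm x)\<^sup>2" for x
      using K[of x] by (simp add: power_mult_distrib[symmetric] mult.commute power_mono)
    then show "AE t in leb_on T. (norm (A (f t)))\<^sup>2 \<le> K\<^sup>2 * (norm (f t))\<^sup>2" by simp
  qed (use L2D[OF f] in auto)
qed

lemmas L2_blinfun_apply = L2_bounded_linear[OF blinfun.bounded_linear_right]

lemma L2_integrable:
  fixes f :: "real \<Rightarrow> 'b::{banach, second_countable_topology}"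
  assumes "f \<in> L2 T" shows "integrable (leb_on T) f"
proof (rule Bochner_Integration.integrable_bound[where f = "\<lambda>t. 1 + (norm (f t))\<^sup>2"])
  have "x \<le> 1 + x\<^sup>2" for x :: real using zero_le_power2[of "x - 1/2"] by (simp add: power2_diff field_simps power2_eq_square)
  then show "AE t in leb_on T. norm (f t) \<le> norm (1 + (norm (f t))\<^sup>2)" by (auto simp: abs_of_nonneg add_nonneg_nonneg)
qed (use L2D[OF assms] in auto)

lemma L2_norm_mult_integrable:
  assumes "f \<in> L2 T" "g \<in> L2 T"
  shows "integrable (leb_on T) (\<lambda>t. norm (f t) * norm (g t))"
proof (rule Bochner_Integration.integrable_bound[where f = "\<lambda>t. (norm (f t))\<^sup>2 + (norm (g t))\<^sup>2"])
  have "x * y \<le> x\<^sup>2 + y\<^sup>2" for x y :: real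
    using zero_le_power2[of "x - y"] zero_le_power2[of x] zero_le_power2[of y] unfolding power2_diff by linarith
  then show "AE t in leb_on T. norm (norm (f t) * norm (g t)) \<le> norm ((norm (f t))\<^sup>2 + (norm (g t))\<^sup>2)"
    by (auto simp: abs_of_nonneg)
qed (use L2D[OF assms(1)] L2D[OF assms(2)] in auto)

lemma L2_mult_integrable:
  fixes f g :: "real \<Rightarrow> real"
  assumes "f \<in> L2 T" "g \<in> L2 T"
  shows "integrable (leb_on T) (\<lambda>t. f t * g t)"
  by (rule Bochner_Integration.integrable_bound[OF L2_norm_mult_integrable[OF assms]])
     (use L2D[OF assms(1)] L2D[OF assms(2)] in \<open>auto simp: abs_mult\<close>)

lemma L2_inner_integrable:
  fixes f g :: "real \<Rightarrow> 'b::{real_inner, second_countable_topology}"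
  assumes "f \<in> L2 T" "g \<in> L2 T"
  shows "integrable (leb_on T) (\<lambda>t. inner (f t) (g t))"
  by (rule Bochner_Integration.integrable_bound[OF L2_norm_mult_integrable[OF assms]])
     (use L2D[OF assms(1)] L2D[OF assms(2)] in \<open>auto simp: Cauchy_Schwarz_ineq2\<close>)

lemma L2_Cauchy_Schwarz:
  fixes f :: "real \<Rightarrow> 'b::real_normed_vector" and g :: "real \<Rightarrow> 'c::real_normed_vector"
  assumes f: "f \<in> L2 T" and g: "g \<in> L2 T"
  shows "(LINT t|leb_on T. norm (f t) * norm (g t))\<^sup>2
    \<le> (sqint T f) * (sqint T g)"
proof (rule quadratic_nonneg_imp_Cauchy_Schwarz)
  fix c :: real
  have "0 \<le> (LINT t|leb_on T. (norm (f t) + c * norm (g t))\<^sup>2)" by simp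
  also have "\<dots> = (LINT t|leb_on T. (norm (f t))\<^sup>2 + 2 * c * (norm (f t) * norm (g t)) + c\<^sup>2 * (norm (g t))\<^sup>2)"
    by (rule Bochner_Integration.integral_cong) (auto simp: power2_eq_square algebra_simps)
  also have "\<dots> = (sqint T f) + 2 * (LINT t|leb_on T. norm (f t) * norm (g t)) * c
      + (sqint T g) * c\<^sup>2"
    using L2D[OF f] L2D[OF g] L2_norm_mult_integrable[OF f g] by simp
  finally show "0 \<le> (sqint T f) + 2 * (LINT t|leb_on T. norm (f t) * norm (g t)) * c
      + (sqint T g) * c\<^sup>2" .
qed

lemma L2_norm_mult_le_sqrt:
  fixes f :: "real \<Rightarrow> 'b::real_normed_vector" and g :: "real \<Rightarrow> 'c::real_normed_vector"
  assumes f: "f \<in> L2 T" and g: "g \<in> L2 T"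
  shows "(LINT t|leb_on T. norm (f t) * norm (g t))
    \<le> sqrt (sqint T f) * sqrt (sqint T g)"
  using L2_Cauchy_Schwarz[OF f g] by (simp add: real_sqrt_mult[symmetric] real_le_rsqrt)

text \<open>Riesz-Fischer: a subsequence with geometrically small steps converges almost everywhere,
  and Fatou's lemma turns the pointwise limit into a limit in mean square.\<close>

lemma L2_complete:
  fixes s :: "nat \<Rightarrow> real \<Rightarrow> 'b::{banach, second_countable_topology}"
  assumes s: "\<And>n. s n \<in> L2 T"
    and C: "\<forall>e>0. \<exists>N. \<forall>m\<ge>N. \<forall>n\<ge>N. (sqint T (\<lambda>t. s m t - s n t)) < e"
  shows "\<exists>f\<in>L2 T. (\<lambda>n. LINT t|leb_on T. (norm (s n t - f t))\<^sup>2) \<longlonglongrightarrow> 0"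
proof -
  let ?M = "leb_on T"
  interpret finite_measure ?M by (rule finite_measure_leb_on)
  note [measurable] = L2_measurable[OF s]
  have sq: "integrable ?M (\<lambda>t. (norm (s m t - s n t))\<^sup>2)" for m n using L2D[OF L2_diff[OF s s]] by blast
  have "\<exists>N. \<forall>m\<ge>N. \<forall>n\<ge>N. (sqint T (\<lambda>t. s m t - s n t)) < (1/4)^k" for k :: nat
    using C by simp
  then obtain N where N: "\<And>k m n. m \<ge> N k \<Longrightarrow> n \<ge> N k \<Longrightarrow> (sqint T (\<lambda>t. s m t - s n t)) < (1/4)^k" by metis
  \<comment> \<open>The partial sums of N make r nondecreasing and at least \<open>N k\<close>; the
    summand k lets r tend to infinity.\<close>
  define r where "r k = k + (\<Sum>i\<le>k. N i)" for k
  have rN: "N k \<le> r k" for k unfolding r_def by (simp add: member_le_sum trans_le_add2)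
  have r_Suc: "r k \<le> r (Suc k)" for k unfolding r_def by simp
  have r_ge: "k \<le> r k" for k unfolding r_def by simp
  define g where "g k = s (r k)" for k
  have g_meas [measurable]: "g k \<in> borel_measurable ?M" for k unfolding g_def by simp
  have diffL2: "(\<lambda>t. g (Suc k) t - g k t) \<in> L2 T" for k unfolding g_def by (intro L2_diff s)
  define \<mu> where "\<mu> = measure ?M (space ?M)"
  have step: "(LINT t|?M. norm (g (Suc k) t - g k t)) \<le> (1/2)^k * ((\<mu> + 1) / 2)" for k
  proof -
    have le: "(sqint T (\<lambda>t. g (Suc k) t - g k t)) \<le> (1/4)^k"
      unfolding g_def using N[of k "r (Suc k)" "r k"] rN[of k] r_Suc[of k] by (simp add: less_imp_le)
    \<comment> \<open>The weight 2^k balances the squared step 4^-k: on a space of finite measure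
      the step is then of order 2^-k in L1, hence summable.\<close>
    have Young: "x \<le> (1/2)^k / 2 + 2^k / 2 * x\<^sup>2" for x :: real
    proof -
      have "0 \<le> 2^k / 2 * (x - (1/2)^k)\<^sup>2" by simp
      also have "\<dots> = 2^k / 2 * x\<^sup>2 - x + (1/2)^k / 2"
        by (simp add: power2_eq_square field_simps)
      finally show ?thesis by simp
    qed
    have "(LINT t|?M. norm (g (Suc k) t - g k t)) \<le> (LINT t|?M. (1/2)^k / 2 + 2^k / 2 * (norm (g (Suc k) t - g k t))\<^sup>2)"
      using L2_integrable[OF diffL2] L2D[OF diffL2]
      by (intro integral_mono Young Bochner_Integration.integrable_add integrable_norm) auto
    also have "\<dots> = (1/2)^k / 2 * \<mu> + 2^k / 2 * (sqint T (\<lambda>t. g (Suc k) t - g k t))"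
      using L2D[OF diffL2, of k] by (subst Bochner_Integration.integral_add) (auto simp: \<mu>_def)
    also have "\<dots> \<le> (1/2)^k / 2 * \<mu> + 2^k / 2 * (1/4)^k" using le by (intro add_left_mono mult_left_mono) auto
    also have "\<dots> = (1/2)^k * ((\<mu> + 1) / 2)"
    proof -
      have "(2::real)^k * (1/4)^k = (1/2)^k" by (simp add: power_mult_distrib[symmetric])
      then show ?thesis by (simp add: field_simps)
    qed
    finally show ?thesis .
  qed
  have "(\<integral>\<^sup>+ t. (\<Sum>k. ennreal (norm (g (Suc k) t - g k t))) \<partial>?M) = (\<Sum>k. \<integral>\<^sup>+ t. ennreal (norm (g (Suc k) t - g k t)) \<partial>?M)"
    by (rule nn_integral_suminf) simp
  also have "\<dots> = (\<Sum>k. ennreal (LINT t|?M. norm (g (Suc k) t - g k t)))"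
    using L2_integrable[OF diffL2] by (subst nn_integral_eq_integral) auto
  also have "\<dots> \<le> (\<Sum>k. ennreal ((1/2)^k * ((\<mu> + 1) / 2)))"
    by (intro suminf_le ennreal_leI step) auto
  also have "\<dots> < \<infinity>"
  proof -
    have "summable (\<lambda>k. (1/2::real)^k * ((\<mu> + 1) / 2))" by (intro summable_mult2 summable_geometric) simp
    then show ?thesis by (subst suminf_ennreal2) (auto simp: \<mu>_def)
  qed
  finally have "AE t in ?M. (\<Sum>k. ennreal (norm (g (Suc k) t - g k t))) \<noteq> \<infinity>"
    by (intro nn_integral_PInf_AE) auto
  then have conv: "AE t in ?M. convergent (\<lambda>k. g k t)"
  proof eventually_elim
    case (elim t)
    then have "summable (\<lambda>k. norm (g (Suc k) t - g k t))"
      by (intro summable_suminf_not_top) auto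
    from summable_LIMSEQ[OF summable_norm_cancel[OF this]]
    have "(\<lambda>n. \<Sum>k<n. g (Suc k) t - g k t) \<longlonglongrightarrow> (\<Sum>k. g (Suc k) t - g k t)" .
    moreover have "(\<Sum>k<n. g (Suc k) t - g k t) = g n t - g 0 t" for n
      by (rule sum_lessThan_telescope[of "\<lambda>k. g k t"])
    ultimately have "(\<lambda>n. (g n t - g 0 t) + g 0 t) \<longlonglongrightarrow> (\<Sum>k. g (Suc k) t - g k t) + g 0 t"
      by (intro tendsto_add tendsto_const) simp
    then show ?case by (auto simp: convergent_def)
  qed
  define f where "f t = lim (\<lambda>k. g k t)" for t
  have f_meas [measurable]: "f \<in> borel_measurable ?M" unfolding f_def by (rule borel_measurable_lim_metric) simp
  have lim: "AE t in ?M. (\<lambda>k. g k t) \<longlonglongrightarrow> f t"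
    using conv by eventually_elim (simp add: f_def convergent_LIMSEQ_iff)
  \<comment> \<open>The Cauchy bound between \<open>s n\<close> and the members of the subsequence
    passes to the pointwise limit.\<close>
  have Fatou: "(\<integral>\<^sup>+ t. ennreal ((norm (s n t - f t))\<^sup>2) \<partial>?M) \<le> ennreal e"
    if e: "e > 0" and K: "\<forall>m\<ge>K. \<forall>n\<ge>K. (sqint T (\<lambda>t. s m t - s n t)) < e" and n: "n \<ge> K" for e K n
  proof -
    have "(\<integral>\<^sup>+ t. ennreal ((norm (s n t - f t))\<^sup>2) \<partial>?M)
        = (\<integral>\<^sup>+ t. liminf (\<lambda>k. ennreal ((norm (s n t - g k t))\<^sup>2)) \<partial>?M)"
    proof (rule nn_integral_cong_AE)
      show "AE t in ?M. ennreal ((norm (s n t - f t))\<^sup>2) = liminf (\<lambda>k. ennreal ((norm (s n t - g k t))\<^sup>2))"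
        using lim
      proof eventually_elim
        case (elim t)
        then have "(\<lambda>k. ennreal ((norm (s n t - g k t))\<^sup>2)) \<longlonglongrightarrow> ennreal ((norm (s n t - f t))\<^sup>2)"
          by (intro tendsto_intros)
        from lim_imp_Liminf[OF _ this] show ?case by simp
      qed
    qed
    also have "\<dots> \<le> liminf (\<lambda>k. \<integral>\<^sup>+ t. ennreal ((norm (s n t - g k t))\<^sup>2) \<partial>?M)"
      by (rule nn_integral_liminf) simp
    also have "\<dots> \<le> ennreal e"
    proof (rule Liminf_le)
      show "\<forall>\<^sub>F k in sequentially. (\<integral>\<^sup>+ t. ennreal ((norm (s n t - g k t))\<^sup>2) \<partial>?M) \<le> ennreal e"
        using eventually_ge_at_top[of K]
      proof eventually_elim
        case (elim k)
        then have "(sqint T (\<lambda>t. s n t - g k t)) < e"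
          unfolding g_def using K n r_ge[of k] by (auto intro: order_trans)
        then show ?case using sq[of n "r k"] unfolding g_def by (subst nn_integral_eq_integral) (auto intro: ennreal_leI)
      qed
    qed simp
    finally show ?thesis .
  qed
  have lim_le: "\<exists>K. \<forall>n\<ge>K. (\<lambda>t. s n t - f t) \<in> L2 T \<and> (sqint T (\<lambda>t. s n t - f t)) \<le> e" if e: "e > 0" for e
  proof -
    obtain K where K: "\<forall>m\<ge>K. \<forall>n\<ge>K. (sqint T (\<lambda>t. s m t - s n t)) < e" using C e by blast
    have "(\<lambda>t. s n t - f t) \<in> L2 T \<and> (sqint T (\<lambda>t. s n t - f t)) \<le> e" if n: "n \<ge> K" for n
    proof -
      from Fatou[OF e K n] have le: "(\<integral>\<^sup>+ t. ennreal ((norm (s n t - f t))\<^sup>2) \<partial>?M) \<le> ennreal e" .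
      have int: "integrable ?M (\<lambda>t. (norm (s n t - f t))\<^sup>2)"
        using le by (intro integrableI_bounded) (auto intro: le_less_trans simp: ennreal_less_top)
      with le e have "(sqint T (\<lambda>t. s n t - f t)) \<le> e"
        by (subst (asm) nn_integral_eq_integral) auto
      with int show ?thesis unfolding L2_def by simp
    qed
    then show ?thesis by blast
  qed
  show ?thesis
  proof
    obtain K where "(\<lambda>t. s K t - f t) \<in> L2 T" using lim_le[of 1] by auto
    from L2_diff[OF s[of K] this] show "f \<in> L2 T" by simp
    show "(\<lambda>n. LINT t|?M. (norm (s n t - f t))\<^sup>2) \<longlonglongrightarrow> 0"
    proof (rule LIMSEQ_I)
      fix e :: real assume "e > 0"
      then obtain K where K: "\<forall>n\<ge>K. (sqint T (\<lambda>t. s n t - f t)) \<le> e / 2" using lim_le[of "e / 2"] by auto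
      show "\<exists>K. \<forall>n\<ge>K. norm ((sqint T (\<lambda>t. s n t - f t)) - 0) < e"
        using K \<open>e > 0\<close> by (intro exI[of _ K]) (auto simp: abs_of_nonneg intro: le_less_trans)
    qed
  qed
qed

section \<open>Density of the continuous functions in L2\<close>

lemma L2_continuous:
  fixes g :: "real \<Rightarrow> 'b::{real_normed_vector, second_countable_topology}"
  assumes "continuous_on UNIV g"
  shows "g \<in> L2 T"
proof -
  have "compact (g ` {0..T})" using assms by (intro compact_continuous_image) (auto intro: continuous_on_subset)
  then obtain B where B: "\<And>t. t \<in> {0..T} \<Longrightarrow> norm (g t) \<le> B"
    by (meson bounded_iff compact_imp_bounded image_eqI)
  show ?thesis
  proof (rule L2_bound[where h = "\<lambda>_. B\<^sup>2"])
    show "g \<in> borel_measurable (leb_on T)"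
      using borel_measurable_continuous_onI[OF assms] 
      by (simp add: measurable_completion measurable_restrict_space1)
    show "AE t in leb_on T. (norm (g t))\<^sup>2 \<le> B\<^sup>2" using B by (auto intro!: AE_I2 power_mono)
  qed simp
qed

text \<open>Regularity of Lebesgue measure encloses A between a closed C and an open U with U - C
  small. A Urysohn function that is 1 on C and 0 off U differs from the indicator only on U - C, and
  by at most 1.\<close>

lemma indicator_approx_continuous:
  assumes A: "A \<in> sets (leb_on T)" and e: "e > 0"
  shows "\<exists>k::real \<Rightarrow> real. continuous_on UNIV k \<and> (LINT t|leb_on T. (indicator A t - k t)\<^sup>2) < e"
proof -
  let ?M = "leb_on T"
  have A': "A \<in> sets lebesgue" using A by (auto simp: sets_restrict_space)
  obtain U where U: "open U" "A \<subseteq> U" "U - A \<in> lmeasurable" "emeasure lebesgue (U - A) < ennreal (e/2)"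
    using sets_lebesgue_outer_open[OF A', of "e/2"] e by auto
  obtain C where C: "closed C" "C \<subseteq> A" "A - C \<in> lmeasurable" "emeasure lebesgue (A - C) < ennreal (e/2)"
    using sets_lebesgue_inner_closed[OF A', of "e/2"] e by auto
  obtain k :: "real \<Rightarrow> real" where k: "continuous_on UNIV k" "\<And>x. k x \<in> closed_segment 1 0"
      "\<And>x. x \<in> C \<Longrightarrow> k x = 1" "\<And>x. x \<in> - U \<Longrightarrow> k x = 0"
    using Urysohn[of C "- U" 1 "0::real"] C U by auto
  have k01: "0 \<le> k x" "k x \<le> 1" for x using k(2)[of x] by (auto simp: closed_segment_eq_real_ivl)
  have UC: "U - C \<in> lmeasurable" 
  proof -
    have "U - C = (U - A) \<union> (A - C)" using U C by auto
    then show ?thesis using fmeasurable.Un[OF U(3) C(3)] by simp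
  qed
  have "(LINT t|?M. (indicator A t - k t)\<^sup>2) \<le> (LINT t|lebesgue. indicator (U - C) t)"
  proof -
    have le: "(indicator A t - k t)\<^sup>2 \<le> indicator (U - C) t" for t
      using k01[of t] k(3)[of t] k(4)[of t] C(2) U(2)
      by (cases "t \<in> C"; cases "t \<in> U"; cases "t \<in> A") (auto simp: power2_eq_square mult_le_one)
    have "(LINT t|?M. (indicator A t - k t)\<^sup>2) = (LINT t|lebesgue. indicator {0<..<T} t *\<^sub>R (indicator A t - k t)\<^sup>2)"
      by (rule integral_restrict_space) simp
    also have "\<dots> \<le> (LINT t|lebesgue. indicator (U - C) t)"
    proof (rule integral_mono_AE')
      show "integrable lebesgue (\<lambda>t. indicator (U - C) t :: real)"
        using UC by (auto simp: fmeasurable_def intro: integrable_real_indicator)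
      have "indicator {0<..<T} t *\<^sub>R (indicator A t - k t)\<^sup>2 \<le> (indicator (U - C) t :: real)" for t
        using le[of t] by (cases "t \<in> {0<..<T}") simp_all
      then show "AE t in lebesgue. indicator {0<..<T} t *\<^sub>R (indicator A t - k t)\<^sup>2 \<le> (indicator (U - C) t :: real)"
        by (rule always_eventually[OF allI])
    qed simp
    finally show ?thesis .
  qed
  also have "\<dots> = measure lebesgue (U - C)" using UC by simp
  also have "\<dots> \<le> measure lebesgue (U - A) + measure lebesgue (A - C)"
  proof -
    have "U - C = (U - A) \<union> (A - C)" using U C by auto
    then show ?thesis using measure_Un_le[of "U - A" lebesgue "A - C"] U C by auto
  qed
  also have "\<dots> < e/2 + e/2"
    using U(3,4) C(3,4) e by (intro add_strict_mono) (auto simp: emeasure_eq_measure2 ennreal_less_iff)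
  finally show ?thesis using k(1) by auto
qed

text \<open>The approximable functions \<open>app\<close> contain the indicators times vectors and
  are closed under finite sums, hence contain the simple functions; \<open>near\<close> carries the
  property over to their limit f.\<close>

lemma L2_dense_continuous:
  fixes f :: "real \<Rightarrow> 'b::{real_normed_vector, second_countable_topology}"
  assumes f: "f \<in> L2 T" and e: "e > 0"
  shows "\<exists>g. continuous_on UNIV g \<and> (sqint T (\<lambda>t. f t - g t)) < e"
proof -
  let ?M = "leb_on T"
  interpret finite_measure ?M by (rule finite_measure_leb_on)
  define app where "app f \<longleftrightarrow> f \<in> L2 T \<and> (\<forall>e>0. \<exists>g. continuous_on UNIV g \<and> (sqint T (\<lambda>t. f t - g t)) < e)"
    for f :: "real \<Rightarrow> 'b"
  have app_ind: "app (\<lambda>t. indicator A t *\<^sub>R y)" if A: "A \<in> sets ?M" for A y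
    unfolding app_def
  proof (intro conjI allI impI)
    show "(\<lambda>t. indicator A t *\<^sub>R y) \<in> L2 T"
      by (rule L2_bound[where h = "\<lambda>_. (norm y)\<^sup>2"]) (use A in \<open>auto simp: indicator_def\<close>)
    fix e :: real assume e: "e > 0"
    have "e / (1 + (norm y)\<^sup>2) > 0" using e by (simp add: add_pos_nonneg)
    then obtain k :: "real \<Rightarrow> real" where k: "continuous_on UNIV k" "(LINT t|?M. (indicator A t - k t)\<^sup>2) < e / (1 + (norm y)\<^sup>2)"
      using indicator_approx_continuous[OF A] by blast
    have "(sqint T (\<lambda>t. indicator A t *\<^sub>R y - k t *\<^sub>R y)) = (LINT t|?M. (indicator A t - k t)\<^sup>2) * (norm y)\<^sup>2"
      by (simp add: scaleR_left_diff_distrib[symmetric] power_mult_distrib)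
    also have "\<dots> \<le> (LINT t|?M. (indicator A t - k t)\<^sup>2) * (1 + (norm y)\<^sup>2)" by (intro mult_left_mono) auto
    also have "\<dots> < e" using k(2) by (simp add: pos_less_divide_eq add_pos_nonneg)
    finally show "\<exists>g. continuous_on UNIV g \<and> (sqint T (\<lambda>t. indicator A t *\<^sub>R y - g t)) < e"
      using k(1) by (intro exI[of _ "\<lambda>t. k t *\<^sub>R y"]) (auto intro!: continuous_intros)
  qed
  \<comment> \<open>Two squared errors below e / 4 combine to one below e, because
    \<open>power2_norm_add_le\<close> doubles each of them.\<close>
  have near: "\<exists>g. continuous_on UNIV g \<and> (sqint T (\<lambda>t. f t - g t)) < e"
    if f: "f \<in> L2 T" and h: "h \<in> L2 T" and c: "(sqint T (\<lambda>t. f t - h t)) < e / 4"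
      and g: "continuous_on UNIV g" "(sqint T (\<lambda>t. h t - g t)) < e / 4" for f h g :: "real \<Rightarrow> 'b" and e
  proof (intro exI conjI)
    note i1 = L2D[OF L2_diff[OF f h]] and i2 = L2D[OF L2_diff[OF h L2_continuous[OF g(1)]]]
      and i3 = L2D[OF L2_diff[OF f L2_continuous[OF g(1)]]]
    have "(sqint T (\<lambda>t. f t - g t)) \<le> (LINT t|?M. 2 * (norm (f t - h t))\<^sup>2 + 2 * (norm (h t - g t))\<^sup>2)"
      using i1 i2 i3 power2_norm_add_le[of "f t - h t" "h t - g t" for t] by (intro integral_mono) auto
    also have "\<dots> < e" using c g(2) i1 i2 by simp
    finally show "(sqint T (\<lambda>t. f t - g t)) < e" .
  qed (rule g(1))
  have app_add: "app (\<lambda>t. f t + g t)" if f: "app f" and g: "app g" for f g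
    unfolding app_def
  proof (intro conjI allI impI)
    show fg: "(\<lambda>t. f t + g t) \<in> L2 T" using f g by (auto simp: app_def intro: L2_add)
    fix e :: real assume e: "e > 0"
    obtain k where k: "continuous_on UNIV k" "(sqint T (\<lambda>t. f t - k t)) < e / 4"
      using f e unfolding app_def by (meson divide_pos_pos zero_less_numeral)
    obtain l where l: "continuous_on UNIV l" "(sqint T (\<lambda>t. g t - l t)) < e / 4"
      using g e unfolding app_def by (meson divide_pos_pos zero_less_numeral)
    note kl = L2_continuous[OF k(1)] L2_continuous[OF l(1)]
    have "f \<in> L2 T" "g \<in> L2 T" using f g by (auto simp: app_def)
    then show "\<exists>h. continuous_on UNIV h \<and> (sqint T (\<lambda>t. f t + g t - h t)) < e"
      using k l fg kl
      by (intro near[where h = "\<lambda>t. k t + g t" and g = "\<lambda>t. k t + l t"]) (auto intro: L2_add continuous_intros)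
  qed
  have app_sum: "app (\<lambda>t. \<Sum>i\<in>I. h i t)" if "finite I" "\<And>i. i \<in> I \<Longrightarrow> app (h i)" for I :: "'b set" and h
    using that
  proof (induction I rule: finite_induct)
    case empty
    show ?case using app_ind[of "{}" 0] by simp
  qed (auto intro: app_add)
  obtain F where F: "\<And>i. simple_function ?M (F i)" "\<And>x. x \<in> space ?M \<Longrightarrow> (\<lambda>i. F i x) \<longlonglongrightarrow> f x"
      "\<And>i x. x \<in> space ?M \<Longrightarrow> norm (F i x) \<le> 2 * norm (f x)"
    using borel_measurable_implies_sequence_metric[OF L2_measurable[OF f], of 0] unfolding dist_norm diff_zero by blast
  have Fmeas [measurable]: "F i \<in> borel_measurable ?M" for i using F(1) by (rule borel_measurable_simple_function)
  note [measurable] = L2_measurable[OF f]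
  have app_F: "app (F i)" for i
  proof -
    define G where "G t = (\<Sum>y\<in>F i ` space ?M. indicator (F i -` {y} \<inter> space ?M) t *\<^sub>R y)" for t
    have fin: "finite (F i ` space ?M)" and ms: "F i -` {y} \<inter> space ?M \<in> sets ?M" if "y \<in> F i ` space ?M" for y
      using F(1)[of i] that by (auto simp: simple_function_def)
    have app_G: "app G" unfolding G_def using ms simple_functionD(1)[OF F(1)[of i]] by (intro app_sum app_ind) auto
    have eq: "G t = F i t" if "t \<in> space ?M" for t
    proof -
      have "G t = (\<Sum>y\<in>F i ` space ?M. if y = F i t then y else 0)"
        unfolding G_def by (rule sum.cong) (use that in \<open>auto simp: indicator_def\<close>)
      also have "\<dots> = F i t" using that simple_functionD(1)[OF F(1)[of i]] by (subst sum.delta) auto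
      finally show ?thesis .
    qed
    have "F i \<in> L2 T" by (rule L2_cong_AE[of G]) (use app_G eq in \<open>auto simp: app_def\<close>)
    moreover have "(sqint T (\<lambda>t. G t - g t)) = (sqint T (\<lambda>t. F i t - g t))" for g
      by (rule Bochner_Integration.integral_cong) (auto simp: eq)
    ultimately show ?thesis using app_G unfolding app_def by simp
  qed
  have "(\<lambda>i. LINT t|?M. (norm (f t - F i t))\<^sup>2) \<longlonglongrightarrow> (LINT t|?M. 0)"
  \<comment> \<open>The simple functions satisfy |F i| <= 2 |f|, so the difference is at most 3 |f|,
    whence the 9.\<close>
  proof (rule integral_dominated_convergence[where w = "\<lambda>t. 9 * (norm (f t))\<^sup>2"])
    show "AE t in ?M. (\<lambda>i. (norm (f t - F i t))\<^sup>2) \<longlonglongrightarrow> 0"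
    proof (rule AE_I2)
      fix t assume "t \<in> space ?M"
      from tendsto_power[OF tendsto_norm[OF tendsto_diff[OF tendsto_const[of "f t"] F(2)[OF this]]], of 2]
      show "(\<lambda>i. (norm (f t - F i t))\<^sup>2) \<longlonglongrightarrow> 0" by simp
    qed
    show "AE t in ?M. norm ((norm (f t - F i t))\<^sup>2) \<le> 9 * (norm (f t))\<^sup>2" for i
    proof (rule AE_I2)
      fix t assume "t \<in> space ?M"
      have "norm (f t - F i t) \<le> 3 * norm (f t)"
        using F(3)[OF \<open>t \<in> space ?M\<close>, of i] norm_triangle_ineq4[of "f t" "F i t"] by linarith
      then have "(norm (f t - F i t))\<^sup>2 \<le> (3 * norm (f t))\<^sup>2" by (intro power_mono) auto
      then show "norm ((norm (f t - F i t))\<^sup>2) \<le> 9 * (norm (f t))\<^sup>2" by (simp add: power_mult_distrib)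
    qed
  qed (use L2D[OF f] in auto)
  then obtain i where i: "(sqint T (\<lambda>t. f t - F i t)) < e / 4"
    using order_tendstoD(2)[of _ 0 sequentially "e / 4"] e by (auto simp: eventually_sequentially)
  obtain g where "continuous_on UNIV g" "(sqint T (\<lambda>t. F i t - g t)) < e / 4"
    using app_F[of i] e unfolding app_def by (meson divide_pos_pos zero_less_numeral)
  with near[OF f _ i this] app_F[of i] show ?thesis by (auto simp: app_def)
qed

section \<open>Weak derivatives of scalar functions\<close>

text \<open>The regularity clause of \<open>test_function\<close>, separated from the support
  condition so that it is stable under products, shifts and antiderivatives.\<close>

definition smooth :: "(real \<Rightarrow> real) \<Rightarrow> bool" where
  "smooth f \<longleftrightarrow> (\<forall>n t. ((deriv ^^ n) f) differentiable (at t))"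

lemma smooth_has_derivative: "smooth f \<Longrightarrow> (f has_real_derivative deriv f t) (at t)"
  unfolding smooth_def by (metis DERIV_imp_deriv funpow_0 real_differentiable_def)

lemma smooth_deriv: "smooth f \<Longrightarrow> smooth (deriv f)"
  unfolding smooth_def by (metis comp_apply funpow_Suc_right)

text \<open>Smoothness by coinduction. It replaces formulas for higher derivatives: each closure
  property below needs only a set of functions that is stable under one differentiation.\<close>

lemma smooth_coinduct:
  assumes "f \<in> S" and step: "\<And>f. f \<in> S \<Longrightarrow> \<exists>f'\<in>S. \<forall>t. (f has_real_derivative f' t) (at t)"
  shows "smooth f"
proof -
  have "(deriv ^^ n) f \<in> S" for n
  proof (induction n)
    case (Suc n)
    then obtain f' where f': "f' \<in> S" "\<And>t. ((deriv ^^ n) f has_real_derivative f' t) (at t)" using step by blast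
    then have "deriv ((deriv ^^ n) f) = f'" by (intro ext DERIV_imp_deriv)
    with f' show ?case by simp
  qed (use assms in simp)
  with step show ?thesis unfolding smooth_def real_differentiable_def by blast
qed

lemma smooth_antiderivative:
  assumes "\<And>t. (F has_real_derivative f t) (at t)" "smooth f"
  shows "smooth F"
  by (rule smooth_coinduct[of _ "insert F {f. smooth f}"])
     (use assms in \<open>auto intro: smooth_has_derivative smooth_deriv\<close>)

lemma smooth_affine:
  assumes "smooth f"
  shows "smooth (\<lambda>t. k * f (c * t + d))"
proof (rule smooth_coinduct[of _ "{\<lambda>t. k * f (c * t + d) |k f. smooth f}"])
  fix g assume "g \<in> {\<lambda>t. k * f (c * t + d) |k f. smooth f}"
  then obtain k f where g: "g = (\<lambda>t. k * f (c * t + d))" and f: "smooth f" by auto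
  have "(g has_real_derivative (k * c) * deriv f (c * t + d)) (at t)" for t
    unfolding g by (auto intro!: derivative_eq_intros DERIV_chain2[OF smooth_has_derivative[OF f]])
  with smooth_deriv[OF f] show "\<exists>f'\<in>{\<lambda>t. k * f (c * t + d) |k f. smooth f}. \<forall>t. (g has_real_derivative f' t) (at t)"
    by (intro bexI[of _ "\<lambda>t. (k * c) * deriv f (c * t + d)"]) auto
qed (use assms in auto)

text \<open>Products are not stable under differentiation, but sums of products are, by the product
  rule. This is the set to which \<open>smooth_coinduct\<close> is applied.\<close>

inductive_set product_span :: "(real \<Rightarrow> real) set" where
  prod: "smooth f \<Longrightarrow> smooth g \<Longrightarrow> (\<lambda>t. f t * g t) \<in> product_span"
| add: "f \<in> product_span \<Longrightarrow> g \<in> product_span \<Longrightarrow> (\<lambda>t. f t + g t) \<in> product_span"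

lemma smooth_mult:
  assumes "smooth f" "smooth g"
  shows "smooth (\<lambda>t. f t * g t)"
proof (rule smooth_coinduct[of _ product_span])
  show "(\<lambda>t. f t * g t) \<in> product_span" using assms by (rule product_span.prod)
  fix h assume "h \<in> product_span"
  then show "\<exists>f'\<in>product_span. \<forall>t. (h has_real_derivative f' t) (at t)"
  proof induction
    case (prod f g)
    then show ?case
      by (intro bexI[of _ "\<lambda>t. deriv f t * g t + f t * deriv g t"])
         (auto intro!: derivative_eq_intros product_span.intros smooth_has_derivative smooth_deriv)
  next
    case (add f g)
    then obtain f' g' where "f' \<in> product_span" "g' \<in> product_span"
      "\<forall>t. (f has_real_derivative f' t) (at t)" "\<forall>t. (g has_real_derivative g' t) (at t)" by blast
    then show ?case
      by (intro bexI[of _ "\<lambda>t. f' t + g' t"]) (auto intro!: derivative_eq_intros product_span.intros)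
  qed
qed

section \<open>Smooth cutoff functions\<close>

lemma tendsto_poly_times_exp_minus: "((\<lambda>x. poly p x * exp (- x)) \<longlongrightarrow> (0::real)) at_top"
proof -
  have "((\<lambda>x. x ^ k * exp (- x)) \<longlongrightarrow> (0::real)) at_top" for k
    using tendsto_power_div_exp_0[of k] by (simp add: exp_minus field_simps)
  then have "((\<lambda>x. \<Sum>i\<le>degree p. coeff p i * (x ^ i * exp (- x))) \<longlongrightarrow> (\<Sum>i\<le>degree p. coeff p i * 0)) at_top"
    by (intro tendsto_intros)
  then show ?thesis by (simp add: poly_altdef sum_distrib_right mult.assoc)
qed

text \<open>The classical function exp(-1/t), extended by 0. The polynomial in 1/t makes the family
  stable under differentiation.\<close>

definition flat :: "real poly \<Rightarrow> real \<Rightarrow> real" where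
  "flat p t = (if t > 0 then poly p (1 / t) * exp (- (1 / t)) else 0)"

text \<open>With x = 1/t the chain rule gives \<open>x\<^sup>2 (p x - p' x) exp (- x)\<close>, and
  \<open>[:0, 0, 1:]\<close> is the polynomial x^2. At 0 the difference quotient only gains a factor
  x, which the exponential absorbs.\<close>

lemma flat_has_derivative: "(flat p has_real_derivative flat ([:0, 0, 1:] * (p - pderiv p)) t) (at t)"
proof -
  consider "t > 0" | "t = 0" | "t < 0" by linarith
  then show ?thesis
  proof cases
    case 1
    have ev: "eventually (\<lambda>x. x > 0) (nhds t)" using eventually_nhds_in_open[of "{0<..}" t] 1 by simp
    have "((\<lambda>x. poly p (1 / x) * exp (- (1 / x))) has_real_derivative
        flat ([:0, 0, 1:] * (p - pderiv p)) t) (at t)"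
      using 1 by (auto intro!: derivative_eq_intros DERIV_chain2[OF poly_DERIV] simp: flat_def field_simps power2_eq_square)
    then show ?thesis
      by (rule DERIV_cong_ev[THEN iffD1, rotated -1]) (use ev in \<open>auto simp: flat_def elim: eventually_mono\<close>)
  next
    case 3
    have ev: "eventually (\<lambda>x. x < 0) (nhds t)" using eventually_nhds_in_open[of "{..<0}" t] 3 by simp
    have "((\<lambda>x. 0) has_real_derivative flat ([:0, 0, 1:] * (p - pderiv p)) t) (at t)"
      using 3 by (simp add: flat_def)
    then show ?thesis
      by (rule DERIV_cong_ev[THEN iffD1, rotated -1]) (use ev in \<open>auto simp: flat_def elim: eventually_mono\<close>)
  next
    case 2
    have right: "((\<lambda>h. flat p h / h) \<longlongrightarrow> 0) (at_right 0)"
    proof -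
      have "((\<lambda>h. poly ([:0, 1:] * p) (inverse h) * exp (- inverse h)) \<longlongrightarrow> 0) (at_right 0)"
        by (rule filterlim_compose[OF tendsto_poly_times_exp_minus filterlim_inverse_at_top_right])
      moreover have "eventually (\<lambda>h. poly ([:0, 1:] * p) (inverse h) * exp (- inverse h) = flat p h / h) (at_right 0)"
        using eventually_at_right_less[of 0] by eventually_elim (simp add: flat_def field_simps)
      ultimately show ?thesis by (rule Lim_transform_eventually)
    qed
    have left: "((\<lambda>h. flat p h / h) \<longlongrightarrow> 0) (at_left 0)"
    proof (rule Lim_transform_eventually[OF tendsto_const])
      show "eventually (\<lambda>h. 0 = flat p h / h) (at_left 0)"
        by (simp add: eventually_at_filter flat_def)
    qed
    have "((\<lambda>h. flat p h / h) \<longlongrightarrow> 0) (at 0)" using left right by (rule filterlim_split_at)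
    then show ?thesis using 2 by (simp add: DERIV_def flat_def cong: if_cong)
  qed
qed

lemma smooth_flat: "smooth (flat p)"
  by (rule smooth_coinduct[of _ "range flat"]) (use flat_has_derivative in auto)

text \<open>Smooth, and pointwise convergent to the indicator of \<open>(0,h)\<close>.\<close>

definition bump :: "real \<Rightarrow> nat \<Rightarrow> real \<Rightarrow> real" where
  "bump h n t = flat 1 (real (Suc n) * t) * flat 1 (real (Suc n) * (h - t))"

lemma smooth_bump: "smooth (bump h n)"
proof -
  have "smooth (\<lambda>t. (1 * flat 1 (real (Suc n) * t + 0)) * (1 * flat 1 (- real (Suc n) * t + real (Suc n) * h)))"
    by (intro smooth_mult smooth_affine smooth_flat)
  then show ?thesis unfolding bump_def[abs_def] by (simp add: algebra_simps)
qed

lemma flat_1_bounds: "0 \<le> flat 1 t" "flat 1 t \<le> 1"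
  by (auto simp: flat_def)

lemma bump_bounds: "0 \<le> bump h n t" "bump h n t \<le> 1"
  unfolding bump_def using flat_1_bounds by (auto intro!: mult_nonneg_nonneg mult_le_one)

lemma bump_eq_0: "t \<notin> {0<..<h} \<Longrightarrow> bump h n t = 0"
proof -
  assume "t \<notin> {0<..<h}"
  then have "real (Suc n) * t \<le> 0 \<or> real (Suc n) * (h - t) \<le> 0"
    by (auto simp: mult_le_0_iff)
  then show ?thesis by (auto simp: bump_def flat_def)
qed

lemma bump_tendsto: "(\<lambda>n. bump h n t) \<longlonglongrightarrow> indicator {0<..<h} t"
proof (cases "t \<in> {0<..<h}")
  case True
  have lim: "(\<lambda>n. flat 1 (real (Suc n) * x)) \<longlonglongrightarrow> 1" if "x > 0" for x
  proof -
    have "(\<lambda>n. inverse x * inverse (real (Suc n))) \<longlonglongrightarrow> inverse x * 0"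
      by (intro tendsto_mult tendsto_const LIMSEQ_inverse_real_of_nat)
    then have "(\<lambda>n. exp (- (inverse x * inverse (real (Suc n))))) \<longlonglongrightarrow> exp (- 0)"
      by (intro tendsto_intros) simp
    moreover have "flat 1 (real (Suc n) * x) = exp (- (inverse x * inverse (real (Suc n))))" for n
      unfolding flat_def using that by (simp add: zero_less_mult_iff divide_inverse mult.commute)
    ultimately show ?thesis by simp
  qed
  have "(\<lambda>n. bump h n t) \<longlonglongrightarrow> 1 * 1" unfolding bump_def using True by (intro tendsto_mult lim) auto
  with True show ?thesis by simp
qed (simp add: bump_eq_0)

text \<open>Starting at -1 instead of 0 keeps the point 0 inside the interval of integration, so
  that the fundamental theorem gives a two-sided derivative there.\<close>

definition ramp :: "real \<Rightarrow> nat \<Rightarrow> real \<Rightarrow> real" where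
  "ramp h n x = integral {-1..x} (bump h n)"

lemma continuous_bump: "continuous_on A (bump h n)"
  using smooth_has_derivative[OF smooth_bump] by (intro DERIV_continuous_on) (auto intro: DERIV_subset)

lemma ramp_eq_0: "x \<le> 0 \<Longrightarrow> ramp h n x = 0"
  unfolding ramp_def by (subst Henstock_Kurzweil_Integration.integral_cong[of _ _ "\<lambda>_. 0"]) (auto intro: bump_eq_0)

lemma ramp_const:
  assumes "h > 0" "h \<le> x" shows "ramp h n x = ramp h n h"
proof -
  have "integral {-1..h} (bump h n) + integral {h..x} (bump h n) = integral {-1..x} (bump h n)"
    using assms by (intro Henstock_Kurzweil_Integration.integral_combine integrable_continuous_real continuous_bump) auto
  moreover have "integral {h..x} (bump h n) = 0" by (subst Henstock_Kurzweil_Integration.integral_cong[of _ _ "\<lambda>_. 0"]) (auto intro: bump_eq_0)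
  ultimately show ?thesis unfolding ramp_def by simp
qed

lemma ramp_has_derivative: "(ramp h n has_real_derivative bump h n x) (at x)"
proof (cases "x < 0")
  case True
  have ev: "eventually (\<lambda>x. x < 0) (nhds x)" using eventually_nhds_in_open[of "{..<0}" x] True by simp
  have "((\<lambda>x. 0) has_real_derivative bump h n x) (at x)" using True by (simp add: bump_eq_0)
  then show ?thesis
    by (rule DERIV_cong_ev[THEN iffD1, rotated -1]) (use ev in \<open>auto simp: ramp_eq_0 elim: eventually_mono\<close>)
next
  case False
  have "((\<lambda>x. integral {-1..x} (bump h n)) has_real_derivative bump h n x) (at x within {-1..x+1})"
    using False by (intro integral_has_real_derivative continuous_bump) auto
  moreover have "at x within {-1..x+1} = at x" using False by (intro at_within_interior) auto
  ultimately show ?thesis unfolding ramp_def[abs_def] by simp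
qed

text \<open>For h > 0 the limit is the piecewise linear function that rises from 0 to h on [0,h]; it
  is kept in the form in which dominated convergence delivers it.\<close>

lemma ramp_tendsto: "(\<lambda>n. ramp h n x) \<longlonglongrightarrow> measure lebesgue ({-1..x} \<inter> {0<..<h})"
proof -
  let ?M = "lebesgue_on {-1..x}"
  have int: "integrable ?M (bump h n)" for n
    by (intro continuous_imp_integrable_real continuous_bump)
  have eq: "ramp h n x = integral\<^sup>L ?M (bump h n)" for n
    unfolding ramp_def using lebesgue_integral_eq_integral[OF int] by simp
  have "(\<lambda>n. integral\<^sup>L ?M (bump h n)) \<longlonglongrightarrow> integral\<^sup>L ?M (indicator {0<..<h})"
  proof (rule integral_dominated_convergence[where w = "\<lambda>_. 1"])
    show "integrable ?M (\<lambda>_. 1::real)" by (intro continuous_imp_integrable_real) auto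
    show "indicator {0<..<h} \<in> borel_measurable ?M"
      by (intro measurable_restrict_space1 measurable_completion) simp
  qed (use int bump_bounds bump_tendsto in \<open>auto simp: abs_of_nonneg\<close>)
  also have "integral\<^sup>L ?M (indicator {0<..<h}) = measure lebesgue ({-1..x} \<inter> {0<..<h})"
  proof -
    have "integral\<^sup>L ?M (indicator {0<..<h}) = measure ?M ({0<..<h} \<inter> {-1..x})" by simp
    also have "\<dots> = measure lebesgue ({0<..<h} \<inter> {-1..x})" by (rule measure_restrict_space) auto
    finally show ?thesis by (simp add: Int_commute)
  qed
  finally show ?thesis unfolding eq .
qed

lemma ramp_bounds:
  assumes "h > 0" shows "0 \<le> ramp h n x" "ramp h n x \<le> h"
proof -
  show "0 \<le> ramp h n x" unfolding ramp_def
    by (intro integral_nonneg integrable_continuous_real continuous_bump bump_bounds)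
  have *: "ramp h n x \<le> h" if "0 \<le> x" "x \<le> h" for x
  proof -
    have "integral {-1..0} (bump h n) + integral {0..x} (bump h n) = integral {-1..x} (bump h n)"
      using that by (intro Henstock_Kurzweil_Integration.integral_combine integrable_continuous_real continuous_bump) auto
    moreover have "integral {-1..0} (bump h n) = 0" using ramp_eq_0[of 0 h n] by (simp add: ramp_def)
    moreover have "integral {0..x} (bump h n) \<le> integral {0..x} (\<lambda>_. 1)"
      by (intro integral_le integrable_continuous_real continuous_bump bump_bounds) auto
    ultimately show ?thesis using that by (simp add: ramp_def)
  qed
  show "ramp h n x \<le> h"
    using *[of x] *[of h] ramp_eq_0[of x h n] ramp_const[OF assms, of x n] assms
    by (cases "x \<le> 0"; cases "x \<le> h") auto
qed

text \<open>Both ramps vanish before s and have reached the same constant after t + h, so their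
  difference is a smoothed trapezoid. Its derivative sits in (s, s + h) and (t, t + h): the weak
  identity then compares two local integrals.\<close>

lemma test_function_ramp:
  assumes "0 < s" "s < t" "h > 0" "t + h < T"
  shows "test_function T (\<lambda>x. ramp h n (x - s) - ramp h n (x - t))"
    and "deriv (\<lambda>x. ramp h n (x - s) - ramp h n (x - t)) = (\<lambda>x. bump h n (x - s) - bump h n (x - t))"
proof -
  have smooth_sub: "smooth (\<lambda>x. f (x - c))" if "smooth f" for f c
    using smooth_affine[OF that, of 1 1 "-c"] by simp
  have D: "((\<lambda>x. ramp h n (x - s) - ramp h n (x - t)) has_real_derivative bump h n (x - s) - bump h n (x - t)) (at x)" for x
    by (auto intro!: derivative_eq_intros DERIV_chain2[OF ramp_has_derivative])
  then show "deriv (\<lambda>x. ramp h n (x - s) - ramp h n (x - t)) = (\<lambda>x. bump h n (x - s) - bump h n (x - t))"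
    by (intro ext DERIV_imp_deriv)
  have "smooth (\<lambda>x. bump h n (x - s) - bump h n (x - t))"
  proof (rule smooth_coinduct[of _ "{\<lambda>x. f x - g x |f g. smooth f \<and> smooth g}"])
    show "(\<lambda>x. bump h n (x - s) - bump h n (x - t)) \<in> {\<lambda>x. f x - g x |f g. smooth f \<and> smooth g}"
      by (intro CollectI exI[of _ "\<lambda>x. bump h n (x - s)"] exI[of _ "\<lambda>x. bump h n (x - t)"] conjI refl
          smooth_sub[OF smooth_bump])
    fix k assume "k \<in> {\<lambda>x. f x - g x |f g. smooth f \<and> smooth g}"
    then obtain f g where "k = (\<lambda>x. f x - g x)" "smooth f" "smooth g" by auto
    then show "\<exists>f'\<in>{\<lambda>x. f x - g x |f g. smooth f \<and> smooth g}. \<forall>t. (k has_real_derivative f' t) (at t)"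
      by (intro bexI[of _ "\<lambda>t. deriv f t - deriv g t"])
         (auto intro!: derivative_eq_intros smooth_has_derivative smooth_deriv)
  qed
  from smooth_antiderivative[OF D this] have "smooth (\<lambda>x. ramp h n (x - s) - ramp h n (x - t))" .
  moreover have "ramp h n (x - s) - ramp h n (x - t) = 0" if "x \<notin> {s..t + h}" for x
    using that ramp_eq_0[of "x - s" h n] ramp_eq_0[of "x - t" h n] assms
      ramp_const[of h "x - s" n] ramp_const[of h "x - t" n] by (cases "x < s") auto
  ultimately show "test_function T (\<lambda>x. ramp h n (x - s) - ramp h n (x - t))"
    unfolding test_function_def smooth_def using assms by blast
qed

section \<open>From weak derivatives to increments\<close>

lemma borel_measurable_leb_on: "f \<in> borel_measurable borel \<Longrightarrow> f \<in> borel_measurable (leb_on T)"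
  by (simp add: measurable_completion measurable_restrict_space1)

lemma test_function_continuous:
  assumes "test_function T \<phi>"
  shows "continuous_on UNIV \<phi>" "continuous_on UNIV (deriv \<phi>)"
proof -
  have "(\<phi> differentiable (at t)) \<and> (deriv \<phi> differentiable (at t))" for t
  proof -
    have "((deriv ^^ n) \<phi>) differentiable (at t)" for n using assms unfolding test_function_def by blast
    from this[of 0] this[of "Suc 0"] show ?thesis by simp
  qed
  then show "continuous_on UNIV \<phi>" "continuous_on UNIV (deriv \<phi>)"
    by (auto intro!: continuous_at_imp_continuous_on differentiable_imp_continuous_within)
qed

lemma integrable_indicator_shift:
  fixes p :: "real \<Rightarrow> real"
  assumes p: "integrable (leb_on T) p"
  shows "integrable (leb_on T) (\<lambda>x. indicator {0<..<h} (x - s) * p x)"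
proof (rule Bochner_Integration.integrable_bound[OF p])
  note [measurable] = borel_measurable_integrable[OF p]
  have "(\<lambda>x. indicator {0<..<h} (x - s)) \<in> borel_measurable (leb_on T)"
    by (rule borel_measurable_leb_on) measurable
  then show "(\<lambda>x. indicator {0<..<h} (x - s) * p x) \<in> borel_measurable (leb_on T)" by measurable
qed (auto simp: indicator_def)

text \<open>Extending p by 0 to P reduces this to differentiation of Henstock-Kurzweil integrals.
  The averages are one-sided and written with shifted indicators, as the limits of bumps produce
  them.\<close>

lemma Lebesgue_differentiation:
  fixes p :: "real \<Rightarrow> real"
  assumes p: "integrable (leb_on T) p"
  shows "\<exists>N\<in>null_sets lebesgue. \<forall>s. s \<notin> N \<longrightarrow> 0 < s \<longrightarrow> s < T \<longrightarrow>
    ((\<lambda>h. (LINT x|leb_on T. indicator {0<..<h} (x - s) * p x) / h) \<longlongrightarrow> p s) (at_right 0)"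
proof -
  let ?M = "leb_on T"
  note shift_int = integrable_indicator_shift[OF p]
  define P where "P x = indicator {0<..<T} x * p x" for x
  have P_int: "integrable lebesgue P"
    using p integrable_restrict_space[of "{0<..<T}" lebesgue p] by (simp add: P_def[abs_def])
  have "P integrable_on cbox a b" for a b
    using integrable_on_lebesgue[OF P_int] integrable_on_subcbox[of P UNIV a b] by simp
  from integrable_ccontinuous_explicit[OF this] obtain N where N: "negligible N"
    and Leb: "\<And>x e. x \<notin> N \<Longrightarrow> 0 < e \<Longrightarrow> \<exists>d>0. \<forall>h. 0 < h \<and> h < d \<longrightarrow>
        norm (integral (cbox x (x + h *\<^sub>R One)) P /\<^sub>R h ^ DIM(real) - P x) < e" by blast
  have avg: "((\<lambda>h. (LINT x|?M. indicator {0<..<h} (x - s) * p x) / h) \<longlongrightarrow> p s) (at_right 0)"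
    if s: "s \<notin> N" "0 < s" "s < T" for s
  proof -
    have eq: "integral {s..s + h} P = (LINT x|?M. indicator {0<..<h} (x - s) * p x)" if "h > 0" for h
    proof -
      have "integrable (lebesgue_on {s..s + h}) P"
        using P_int integrable_restrict_space[of "{s..s+h}" lebesgue P]
          integrable_mult_indicator[of "{s..s+h}" lebesgue P] by simp
      from lebesgue_integral_eq_integral[OF this] have "integral {s..s + h} P = integral\<^sup>L (lebesgue_on {s..s + h}) P" by simp
      also have "\<dots> = (LINT x|lebesgue. indicator {s..s + h} x *\<^sub>R P x)" by (rule integral_restrict_space) simp
      also have "\<dots> = (LINT x|lebesgue. indicator {0<..<T} x *\<^sub>R (indicator {0<..<h} (x - s) * p x))"
      proof (rule integral_cong_AE)
        show "(\<lambda>x. indicator {s..s + h} x *\<^sub>R P x) \<in> borel_measurable lebesgue"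
          using P_int by (intro borel_measurable_scaleR borel_measurable_indicator borel_measurable_integrable) auto
        show "(\<lambda>x. indicator {0<..<T} x *\<^sub>R (indicator {0<..<h} (x - s) * p x)) \<in> borel_measurable lebesgue"
          using shift_int integrable_restrict_space[of "{0<..<T}" lebesgue "\<lambda>x. indicator {0<..<h} (x - s) * p x"]
          by (auto intro: borel_measurable_integrable)
        have "{s, s + h} \<in> null_sets lebesgue" by (simp add: negligible_iff_null_sets[symmetric])
        from AE_not_in[OF this] show "AE x in lebesgue. indicator {s..s + h} x *\<^sub>R P x = indicator {0<..<T} x *\<^sub>R (indicator {0<..<h} (x - s) * p x)"
          by eventually_elim (auto simp: P_def indicator_def)
      qed
      also have "\<dots> = (LINT x|?M. indicator {0<..<h} (x - s) * p x)"
        by (rule integral_restrict_space[symmetric]) simp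
      finally show ?thesis .
    qed
    show ?thesis
    proof (rule tendstoI)
      fix e :: real assume "e > 0"
      from Leb[OF s(1) this] obtain d where d: "d > 0" "\<And>h. 0 < h \<Longrightarrow> h < d \<Longrightarrow> norm (integral (cbox s (s + h *\<^sub>R One)) P /\<^sub>R h ^ DIM(real) - P s) < e"
        by blast
      have "eventually (\<lambda>h. h \<in> {0<..<d}) (at_right 0)" using d(1) by (rule eventually_at_right_real)
      then show "eventually (\<lambda>h. dist ((LINT x|?M. indicator {0<..<h} (x - s) * p x) / h) (p s) < e) (at_right 0)"
      proof eventually_elim
        case (elim h)
        then have "h > 0" "h < d" by auto
        from d(2)[OF this] show ?case
          using s eq[OF \<open>h > 0\<close>] by (simp add: P_def dist_real_def divide_inverse_commute)
      qed
    qed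
  qed
  show ?thesis
    using N avg by (intro bexI[of _ N]) (auto simp: negligible_iff_null_sets)
qed

text \<open>The test functions rise just after s and fall just after t. Letting n tend to infinity
  replaces them by piecewise linear ones; after division by h, letting h tend to 0 turns the two
  local integrals of p into point values wherever p is the derivative of its integral.\<close>

theorem weak_derivative_imp_absolutely_continuous:
  fixes p q :: "real \<Rightarrow> real"
  assumes p: "integrable (leb_on T) p" and q: "integrable (leb_on T) q"
    and weak: "\<And>\<phi>. test_function T \<phi> \<Longrightarrow>
      (LINT t|leb_on T. deriv \<phi> t * p t) = - (LINT t|leb_on T. \<phi> t * q t)"
  shows "\<exists>N\<in>null_sets lebesgue. \<forall>s t. 0 < s \<longrightarrow> s < t \<longrightarrow> t < T \<longrightarrow> s \<notin> N \<longrightarrow> t \<notin> N \<longrightarrow>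
    p t - p s = (LINT x|leb_on T. indicator {s<..t} x * q x)"
proof -
  let ?M = "leb_on T"
  note [measurable] = borel_measurable_integrable[OF p] borel_measurable_integrable[OF q]
  \<comment> \<open>The limit of the ramps: 0 up to 0, slope 1 on (0,h), constant h
    afterwards.\<close>
  define l where "l h x = measure lebesgue ({-1..x} \<inter> {0<..<h})" for h x :: real
  have l0: "l h x = 0" if "x \<le> 0" for h x
  proof -
    have "{-1..x} \<inter> {0<..<h} = {}" using that by auto
    then show ?thesis by (simp add: l_def)
  qed
  have lh: "l h x = h" if "h > 0" "h \<le> x" for h x
  proof -
    have "{-1..x} \<inter> {0<..<h} = {0<..<h}" using that by auto
    then show ?thesis using that by (simp add: l_def)
  qed
  have l_bounds: "0 \<le> l h x" "l h x \<le> h" if "h > 0" for h x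
    using LIMSEQ_le_const[OF ramp_tendsto[of h x]] LIMSEQ_le_const2[OF ramp_tendsto[of h x]] ramp_bounds[OF that]
    unfolding l_def by (blast, blast)
  note shift_int = integrable_indicator_shift[OF p]
  have key: "(LINT x|?M. indicator {0<..<h} (x - s) * p x) - (LINT x|?M. indicator {0<..<h} (x - t) * p x)
      = - (LINT x|?M. (l h (x - s) - l h (x - t)) * q x)"
    if st: "0 < s" "s < t" "h > 0" "t + h < T" for s t h
  proof -
    define \<phi> where "\<phi> n x = ramp h n (x - s) - ramp h n (x - t)" for n x
    have test: "test_function T (\<phi> n)" for n unfolding \<phi>_def[abs_def] using test_function_ramp[OF st] by blast
    note cont = test_function_continuous[OF test]
    have d\<phi>: "deriv (\<phi> n) x = bump h n (x - s) - bump h n (x - t)" for n x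
      unfolding \<phi>_def[abs_def] using test_function_ramp(2)[OF st] by simp
    have \<phi>_meas [measurable]: "(\<lambda>x. \<phi> n x) \<in> borel_measurable ?M" "(\<lambda>x. deriv (\<phi> n) x) \<in> borel_measurable ?M" for n
      using borel_measurable_leb_on[OF borel_measurable_continuous_onI[OF cont(1)]]
        borel_measurable_leb_on[OF borel_measurable_continuous_onI[OF cont(2)]] by auto
    have lim1: "(\<lambda>n. LINT x|?M. deriv (\<phi> n) x * p x)
       \<longlonglongrightarrow> (LINT x|?M. (indicator {0<..<h} (x - s) - indicator {0<..<h} (x - t)) * p x)"
    proof (rule integral_dominated_convergence[where w = "\<lambda>x. 1 * \<bar>p x\<bar>"])
      have "(\<lambda>x. indicator {0<..<h} (x - s) - indicator {0<..<h} (x - t) :: real) \<in> borel_measurable ?M"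
        by (rule borel_measurable_leb_on) measurable
      then show "(\<lambda>x. (indicator {0<..<h} (x - s) - indicator {0<..<h} (x - t)) * p x) \<in> borel_measurable ?M"
        by measurable
      show "AE x in ?M. (\<lambda>n. deriv (\<phi> n) x * p x)
          \<longlonglongrightarrow> (indicator {0<..<h} (x - s) - indicator {0<..<h} (x - t)) * p x"
        unfolding d\<phi> by (intro AE_I2 tendsto_intros bump_tendsto)
      show "AE x in ?M. norm (deriv (\<phi> n) x * p x) \<le> 1 * \<bar>p x\<bar>" for n
      proof (rule AE_I2)
        fix x
        have "\<bar>deriv (\<phi> n) x\<bar> \<le> 1" unfolding d\<phi>
          using bump_bounds[of h n "x - s"] bump_bounds[of h n "x - t"] by auto
        then show "norm (deriv (\<phi> n) x * p x) \<le> 1 * \<bar>p x\<bar>"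
          unfolding real_norm_def abs_mult by (rule mult_right_mono) simp
      qed
    qed (use p in auto)
    have lim2: "(\<lambda>n. LINT x|?M. \<phi> n x * q x) \<longlonglongrightarrow> (LINT x|?M. (l h (x - s) - l h (x - t)) * q x)"
    proof (rule integral_dominated_convergence[where w = "\<lambda>x. h * \<bar>q x\<bar>"])
      have lim: "(\<lambda>n. \<phi> n x) \<longlonglongrightarrow> l h (x - s) - l h (x - t)" for x
        unfolding \<phi>_def l_def by (intro tendsto_diff ramp_tendsto)
      have "(\<lambda>x. l h (x - s) - l h (x - t)) \<in> borel_measurable ?M"
        by (rule borel_measurable_LIMSEQ_real[OF lim \<phi>_meas(1)])
      then show "(\<lambda>x. (l h (x - s) - l h (x - t)) * q x) \<in> borel_measurable ?M" by measurable
      show "AE x in ?M. (\<lambda>n. \<phi> n x * q x) \<longlonglongrightarrow> (l h (x - s) - l h (x - t)) * q x"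
        by (intro AE_I2 tendsto_mult lim tendsto_const)
      show "AE x in ?M. norm (\<phi> n x * q x) \<le> h * \<bar>q x\<bar>" for n
      proof (rule AE_I2)
        fix x
        have "\<bar>\<phi> n x\<bar> \<le> h" unfolding \<phi>_def
          using ramp_bounds[OF st(3), of n "x - s"] ramp_bounds[OF st(3), of n "x - t"] by auto
        then show "norm (\<phi> n x * q x) \<le> h * \<bar>q x\<bar>"
          unfolding real_norm_def abs_mult by (rule mult_right_mono) simp
      qed
    qed (use q in auto)
    have "(LINT x|?M. (indicator {0<..<h} (x - s) - indicator {0<..<h} (x - t)) * p x)
        = - (LINT x|?M. (l h (x - s) - l h (x - t)) * q x)"
      using LIMSEQ_unique[OF lim1] tendsto_minus[OF lim2] weak[OF test] by simp
    then show ?thesis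
      using shift_int[of h s] shift_int[of h t] by (simp add: left_diff_distrib)
  qed
  obtain N where N: "N \<in> null_sets lebesgue"
    and avg: "\<And>s. s \<notin> N \<Longrightarrow> 0 < s \<Longrightarrow> s < T \<Longrightarrow> ((\<lambda>h. (LINT x|?M. indicator {0<..<h} (x - s) * p x) / h) \<longlongrightarrow> p s) (at_right 0)"
    using Lebesgue_differentiation[OF p] by blast
  show ?thesis
  proof (intro bexI[of _ N] allI impI)
    show "N \<in> null_sets lebesgue" by (rule N)
    fix s t assume st: "0 < s" "s < t" "t < T" "s \<notin> N" "t \<notin> N"
    \<comment> \<open>The support has to end before T. The double successor makes \<open>h n\<close>
      smaller than T - t already for n = 0.\<close>
    define h where "h n = (T - t) * inverse (real (Suc (Suc n)))" for n
    have h_pos: "h n > 0" for n using st by (simp add: h_def)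
    have h_less: "t + h n < T" for n
    proof -
      have "inverse (real (Suc (Suc n))) < 1" by (simp add: field_simps)
      then have "h n < (T - t) * 1" unfolding h_def using st by (intro mult_strict_left_mono) auto
      then show ?thesis by simp
    qed
    have h_lim: "h \<longlonglongrightarrow> 0"
      using tendsto_mult[OF tendsto_const LIMSEQ_Suc[OF LIMSEQ_inverse_real_of_nat], of "T - t"] by (simp add: h_def[abs_def])
    have h_right: "filterlim h (at_right 0) sequentially"
      unfolding filterlim_at using h_lim h_pos less_imp_neq[OF h_pos] by (auto intro!: always_eventually simp: greaterThan_def)
    let ?L = "\<lambda>n. (LINT x|?M. indicator {0<..<h n} (x - s) * p x) / h n - (LINT x|?M. indicator {0<..<h n} (x - t) * p x) / h n"
    have L1: "?L \<longlonglongrightarrow> p s - p t"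
      using st by (intro tendsto_diff filterlim_compose[OF avg h_right]) auto
    have L_eq: "?L n = - (LINT x|?M. ((l (h n) (x - s) - l (h n) (x - t)) / h n) * q x)" for n
      using key[OF st(1,2) h_pos h_less, of n] by (simp add: diff_divide_distrib[symmetric])
    have "(\<lambda>n. LINT x|?M. ((l (h n) (x - s) - l (h n) (x - t)) / h n) * q x)
        \<longlonglongrightarrow> (LINT x|?M. indicator {s<..t} x * q x)"
    proof (rule integral_dominated_convergence[where w = "\<lambda>x. 1 * \<bar>q x\<bar>"])
      show "(\<lambda>x. indicator {s<..t} x * q x) \<in> borel_measurable ?M"
        by (intro borel_measurable_times borel_measurable_leb_on borel_measurable_indicator
            borel_measurable_integrable[OF q]) simp
      have l_meas: "(\<lambda>x. l h (x - c)) \<in> borel_measurable ?M" for h c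
      proof (rule borel_measurable_LIMSEQ_real[where u = "\<lambda>n x. ramp h n (x - c)"])
        have "continuous_on UNIV (ramp h n)" for n
          using ramp_has_derivative by (intro DERIV_continuous_on) auto
        from continuous_on_compose2[OF this, of UNIV "\<lambda>x. x - c"]
        show "(\<lambda>x. ramp h n (x - c)) \<in> borel_measurable ?M" for n
          by (intro borel_measurable_leb_on borel_measurable_continuous_onI) (simp add: continuous_on_diff)
      qed (unfold l_def, rule ramp_tendsto)
      show "(\<lambda>x. (l (h n) (x - s) - l (h n) (x - t)) / h n * q x) \<in> borel_measurable ?M" for n
        using l_meas[of "h n" s] l_meas[of "h n" t] by measurable
      show "AE x in ?M. (\<lambda>n. (l (h n) (x - s) - l (h n) (x - t)) / h n * q x) \<longlonglongrightarrow> indicator {s<..t} x * q x"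
      proof (intro AE_I2 tendsto_mult tendsto_const)
        fix x
        \<comment> \<open>The quotient is 1 once \<open>h n\<close> < x - c and is 0 for x <= c.
          These endpoint conventions are those of \<open>{s<..t}\<close>.\<close>
        have ev: "eventually (\<lambda>n. l (h n) (x - c) / h n = indicator {c<..} x) sequentially" for c
        proof (cases "x \<le> c")
          case False
          then have "eventually (\<lambda>n. h n < x - c) sequentially" using order_tendstoD(2)[OF h_lim, of "x - c"] by simp
          then show ?thesis
          proof eventually_elim
            case (elim n)
            with lh[OF h_pos, of n "x - c"] h_pos[of n] False show ?case by simp
          qed
        qed (simp add: l0)
        have "eventually (\<lambda>n. indicator {s<..t} x = (l (h n) (x - s) - l (h n) (x - t)) / h n) sequentially"
          using ev[of s] ev[of t]
        proof eventually_elim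
          case (elim n)
          then show ?case using st(2) by (auto simp: diff_divide_distrib indicator_def)
        qed
        then show "(\<lambda>n. (l (h n) (x - s) - l (h n) (x - t)) / h n) \<longlonglongrightarrow> indicator {s<..t} x"
          by (rule Lim_transform_eventually[OF tendsto_const])
      qed
      show "AE x in ?M. norm ((l (h n) (x - s) - l (h n) (x - t)) / h n * q x) \<le> 1 * \<bar>q x\<bar>" for n
      proof (rule AE_I2)
        fix x
        have "\<bar>(l (h n) (x - s) - l (h n) (x - t)) / h n\<bar> \<le> 1"
          using l_bounds[OF h_pos, of n "x - s"] l_bounds[OF h_pos, of n "x - t"] h_pos[of n] by (auto simp: abs_le_iff field_simps)
        then show "norm ((l (h n) (x - s) - l (h n) (x - t)) / h n * q x) \<le> 1 * \<bar>q x\<bar>"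
          unfolding real_norm_def abs_mult by (rule mult_right_mono) simp
      qed
    qed (use q in auto)
    from tendsto_minus[OF this] have "?L \<longlonglongrightarrow> - (LINT x|?M. indicator {s<..t} x * q x)" unfolding L_eq .
    with L1 have "p s - p t = - (LINT x|?M. indicator {s<..t} x * q x)" by (rule LIMSEQ_unique)
    then show "p t - p s = (LINT x|?M. indicator {s<..t} x * q x)" by simp
  qed
qed

section \<open>The energy identity and the trace\<close>

text \<open>\<open>z\<close> represents the derivative of \<open>u\<close> in \<open>L\<^sub>2(I;V')\<close> through the Riesz isomorphism \<open>V' \<rightarrow> V\<close>.\<close>

definition has_time_deriv ::
  "('v::real_inner \<Rightarrow>\<^sub>L 'h::real_inner) \<Rightarrow> real \<Rightarrow> (real \<Rightarrow> 'v) \<Rightarrow> (real \<Rightarrow> 'v) \<Rightarrow> bool" where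
  "has_time_deriv \<iota> T u z \<longleftrightarrow> u \<in> L2 T \<and> z \<in> L2 T \<and>
     (\<forall>\<phi> \<eta>. test_function T \<phi> \<longrightarrow>
        (LINT t|leb_on T. deriv \<phi> t * inner (\<iota> (u t)) (\<iota> \<eta>)) = - (LINT t|leb_on T. \<phi> t * inner (z t) \<eta>))"

section \<open>Primitives and the choice of good points\<close>

definition primitive :: "real \<Rightarrow> (real \<Rightarrow> real) \<Rightarrow> real \<Rightarrow> real" where
  "primitive T f x = (LINT y|leb_on T. indicator {0<..x} y * f y)"

lemma integrable_indicator_mult:
  fixes f :: "real \<Rightarrow> real"
  assumes f: "integrable (leb_on T) f"
  shows "integrable (leb_on T) (\<lambda>y. indicator {a<..b} y * f y)"
proof (rule Bochner_Integration.integrable_bound[OF f])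
  show "(\<lambda>y. indicator {a<..b} y * f y) \<in> borel_measurable (leb_on T)"
    by (intro borel_measurable_times borel_measurable_leb_on borel_measurable_indicator
        borel_measurable_integrable[OF f]) simp
qed (auto simp: indicator_def)

lemma primitive_diff:
  assumes "integrable (leb_on T) f" "0 \<le> a" "a \<le> b"
  shows "primitive T f b - primitive T f a = (LINT y|leb_on T. indicator {a<..b} y * f y)"
proof -
  have "primitive T f b - primitive T f a
      = (LINT y|leb_on T. indicator {0<..b} y * f y - indicator {0<..a} y * f y)"
    unfolding primitive_def using assms integrable_indicator_mult by simp
  also have "\<dots> = (LINT y|leb_on T. indicator {a<..b} y * f y)"
    by (rule Bochner_Integration.integral_cong) (use assms in \<open>auto simp: indicator_def\<close>)
  finally show ?thesis .
qed

lemma primitive_0 [simp]: "primitive T f 0 = 0"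
  by (simp add: primitive_def)

lemma primitive_T: "primitive T f T = (LINT y|leb_on T. f y)"
  unfolding primitive_def by (rule Bochner_Integration.integral_cong) auto

lemma primitive_mono:
  assumes "integrable (leb_on T) f" "0 \<le> a" "a \<le> b" "\<And>y. 0 \<le> f y"
  shows "primitive T f a \<le> primitive T f b"
proof -
  have "0 \<le> primitive T f b - primitive T f a"
    unfolding primitive_diff[OF assms(1-3)] by (rule integral_nonneg_AE) (use assms(4) in auto)
  then show ?thesis by simp
qed

lemma primitive_const:
  assumes "0 \<le> a" "a \<le> b" "b \<le> T"
  shows "(LINT y|leb_on T. indicator {a<..b} y * c) = (b - a) * c"
proof -
  have "(LINT y|leb_on T. indicator {a<..b} y * c) = (LINT y|lebesgue. indicator {0<..<T} y *\<^sub>R (indicator {a<..b} y * c))"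
    by (rule integral_restrict_space) simp
  also have "\<dots> = (LINT y|lebesgue. indicator {a<..b} y * c)"
  proof (rule integral_cong_AE)
    have "{T} \<in> null_sets lebesgue" by (simp add: negligible_iff_null_sets[symmetric])
    from AE_not_in[OF this] show "AE y in lebesgue. indicator {0<..<T} y *\<^sub>R (indicator {a<..b} y * c) = indicator {a<..b} y * c"
      by eventually_elim (use assms in \<open>auto simp: indicator_def\<close>)
    show "(\<lambda>y. indicator {a<..b} y * c) \<in> borel_measurable lebesgue"
      by (intro measurable_completion) simp
    show "(\<lambda>y. indicator {0<..<T} y *\<^sub>R (indicator {a<..b} y * c)) \<in> borel_measurable lebesgue"
      by (intro measurable_completion) simp
  qed
  also have "\<dots> = (b - a) * c" using assms by simp
  finally show ?thesis .
qed

lemma AE_leb_on_not_in: "N \<in> null_sets lebesgue \<Longrightarrow> AE t in leb_on T. t \<notin> N \<and> t \<in> {0<..<T}"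
  using AE_not_in[of N lebesgue] by (subst AE_restrict_space_iff) (auto elim: eventually_mono)

text \<open>If f exceeded its mean by more than e off a null set, integration would give a
  contradiction. This selects nodes that avoid N and at which a merely integrable quantity is under
  control.\<close>

lemma point_below_average:
  assumes f: "integrable (leb_on T) f" and ab: "0 \<le> a" "a < b" "b \<le> T" and N: "N \<in> null_sets lebesgue" and e: "e > 0"
  shows "\<exists>x. a < x \<and> x < b \<and> x \<notin> N \<and> (b - a) * f x \<le> primitive T f b - primitive T f a + (b - a) * e"
proof (rule ccontr)
  assume contr: "\<not> ?thesis"
  define c where "c = primitive T f b - primitive T f a"
  have c: "c = (LINT y|leb_on T. indicator {a<..b} y * f y)" unfolding c_def using primitive_diff[OF f] ab by simp
  have "{b} \<in> null_sets lebesgue" by (simp add: negligible_iff_null_sets[symmetric])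
  then have Nb: "N \<union> {b} \<in> null_sets lebesgue" using N by blast
  have "(LINT y|leb_on T. indicator {a<..b} y * (c + (b - a) * e)) \<le> (LINT y|leb_on T. (b - a) * (indicator {a<..b} y * f y))"
  proof (rule integral_mono_AE)
    show "AE y in leb_on T. indicator {a<..b} y * (c + (b - a) * e) \<le> (b - a) * (indicator {a<..b} y * f y)"
      using AE_leb_on_not_in[OF Nb]
    proof eventually_elim
      case (elim y)
      then show ?case
      proof (cases "a < y \<and> y < b")
        case True
        with contr elim have "\<not> (b - a) * f y \<le> c + (b - a) * e" unfolding c_def by blast
        with True show ?thesis by simp
      qed (auto simp: indicator_def)
    qed
    show "integrable (leb_on T) (\<lambda>y. indicator {a<..b} y * (c + (b - a) * e))"
      by (rule integrable_indicator_mult) simp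
    show "integrable (leb_on T) (\<lambda>y. (b - a) * (indicator {a<..b} y * f y))"
      using integrable_indicator_mult[OF f] by simp
  qed
  moreover have "(LINT y|leb_on T. indicator {a<..b} y * (c + (b - a) * e)) = (b - a) * (c + (b - a) * e)"
    using ab by (intro primitive_const) auto
  moreover have "(LINT y|leb_on T. (b - a) * (indicator {a<..b} y * f y)) = (b - a) * c"
    by (simp only: integral_mult_right_zero c)
  ultimately have "(b - a) * (c + (b - a) * e) \<le> (b - a) * c" by (simp only:)
  then show False using ab e by (simp add: distrib_left mult_le_0_iff)
qed

lemma good_set_dense:
  fixes T :: real
  assumes "T > 0" "N \<in> null_sets lebesgue"
  shows "{0..T} \<subseteq> closure ({0<..<T} - N)"
proof -
  have "x \<in> closure ({0<..<T} - N)" if x: "x \<in> {0<..<T}" for x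
    unfolding closure_approachable
  proof (intro allI impI)
    fix e :: real assume e: "e > 0"
    \<comment> \<open>Only the existence of a point off N is wanted, so the zero function with slack
      1 will do.\<close>
    have "\<exists>y. x < y \<and> y < min T (x + e) \<and> y \<notin> N \<and> (min T (x + e) - x) * 0 \<le> primitive T (\<lambda>_. 0) (min T (x + e)) - primitive T (\<lambda>_. 0) x + (min T (x + e) - x) * 1"
      using point_below_average[of T "\<lambda>_. 0" x "min T (x + e)" N 1] x e assms by auto
    then obtain y where "x < y" "y < min T (x + e)" "y \<notin> N" by blast
    then show "\<exists>y\<in>{0<..<T} - N. dist y x < e" using x by (intro bexI[of _ y]) (auto simp: dist_real_def)
  qed
  then have "closure {0<..<T} \<subseteq> closure ({0<..<T} - N)" by (intro closure_minimal) auto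
  then show ?thesis using assms by simp
qed

lemma continuous_on_primitive:
  assumes f: "integrable (leb_on T) f"
  shows "continuous_on {0..T} (primitive T f)"
  unfolding continuous_on_sequentially
proof (intro allI ballI impI)
  fix s a assume "a \<in> {0..T}" and s: "(\<forall>n. s n \<in> {0..T}) \<and> s \<longlonglongrightarrow> a"
  note [measurable] = borel_measurable_integrable[OF f]
  have "(\<lambda>n. LINT y|leb_on T. indicator {0<..s n} y * f y) \<longlonglongrightarrow> (LINT y|leb_on T. indicator {0<..a} y * f y)"
  proof (rule integral_dominated_convergence[where w = "\<lambda>y. \<bar>f y\<bar>"])
    have "{a} \<in> null_sets lebesgue" by (simp add: negligible_iff_null_sets[symmetric])
    from AE_leb_on_not_in[OF this] show "AE y in leb_on T. (\<lambda>n. indicator {0<..s n} y * f y) \<longlonglongrightarrow> indicator {0<..a} y * f y"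
    proof eventually_elim
      case (elim y)
      then consider "y < a" | "a < y" by fastforce
      then have "eventually (\<lambda>n. indicator {0<..a} y * f y = indicator {0<..s n} y * f y) sequentially"
      proof cases
        case 1
        from order_tendstoD(1)[OF conjunct2[OF s] this] show ?thesis by eventually_elim (use 1 in \<open>auto simp: indicator_def\<close>)
      next
        case 2
        from order_tendstoD(2)[OF conjunct2[OF s] this] show ?thesis by eventually_elim (use 2 in \<open>auto simp: indicator_def\<close>)
      qed
      then show ?case by (rule Lim_transform_eventually[OF tendsto_const])
    qed
  qed (use integrable_indicator_mult[OF f] f in \<open>auto simp: indicator_def\<close>)
  then show "(primitive T f \<circ> s) \<longlonglongrightarrow> primitive T f a" by (simp add: primitive_def comp_def)
qed

lemma has_time_derivD:
  assumes "has_time_deriv \<iota> T u z"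
  shows "u \<in> L2 T" "z \<in> L2 T"
  using assms by (auto simp: has_time_deriv_def)

context
  fixes \<iota> :: "'v::{real_inner, banach, second_countable_topology} \<Rightarrow>\<^sub>L 'h::{real_inner, banach, second_countable_topology}"
    and T :: real
  assumes T: "T > 0"
begin

lemma L2_iota_integrable: "u \<in> L2 T \<Longrightarrow> integrable (leb_on T) (\<lambda>t. inner (\<iota> (u t)) h)"
  using L2_inner_integrable[OF L2_blinfun_apply L2_const] by blast

text \<open>The scalar theorem yields a null set that depends on \<eta>. A countable dense set of
  \<eta> leaves a single null set, and for fixed s and t both sides are continuous in
  \<eta>.\<close>

lemma time_deriv_increment:
  assumes uz: "has_time_deriv \<iota> T u z"
  shows "\<exists>N\<in>null_sets lebesgue. \<forall>s t \<eta>. 0 < s \<longrightarrow> s < t \<longrightarrow> t < T \<longrightarrow> s \<notin> N \<longrightarrow> t \<notin> N \<longrightarrow>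
    inner (\<iota> (u t) - \<iota> (u s)) (\<iota> \<eta>) = (LINT x|leb_on T. indicator {s<..t} x * inner (z x) \<eta>)"
proof -
  note u = has_time_derivD(1)[OF uz] and z = has_time_derivD(2)[OF uz]
  obtain D :: "'v set" where D: "countable D" "UNIV \<subseteq> closure D"
    using separable[of "UNIV :: 'v set"] by metis
  define Q where "Q \<eta> N \<longleftrightarrow> (\<forall>s t. 0 < s \<longrightarrow> s < t \<longrightarrow> t < T \<longrightarrow> s \<notin> N \<longrightarrow> t \<notin> N \<longrightarrow>
     inner (\<iota> (u t)) (\<iota> \<eta>) - inner (\<iota> (u s)) (\<iota> \<eta>) = (LINT x|leb_on T. indicator {s<..t} x * inner (z x) \<eta>))" for \<eta> N
  have "\<exists>N\<in>null_sets lebesgue. Q \<eta> N" for \<eta>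
    unfolding Q_def
    by (rule weak_derivative_imp_absolutely_continuous)
       (use uz L2_iota_integrable[OF u] L2_inner_integrable[OF z L2_const] in \<open>auto simp: has_time_deriv_def\<close>)
  then obtain N where N: "\<And>\<eta>. N \<eta> \<in> null_sets lebesgue" and NQ: "\<And>\<eta>. Q \<eta> (N \<eta>)"
    by metis
  have incr: "inner (\<iota> (u t)) (\<iota> \<eta>) - inner (\<iota> (u s)) (\<iota> \<eta>) = (LINT x|leb_on T. indicator {s<..t} x * inner (z x) \<eta>)"
    if "0 < s" "s < t" "t < T" "s \<notin> N \<eta>" "t \<notin> N \<eta>" for \<eta> s t
    using NQ[of \<eta>] that unfolding Q_def by blast
  show ?thesis
  proof (intro bexI[of _ "\<Union>\<eta>\<in>D. N \<eta>"] allI impI)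
    show "(\<Union>\<eta>\<in>D. N \<eta>) \<in> null_sets lebesgue" using D(1) N by (intro null_sets_UN') auto
    fix s t \<eta> assume st: "0 < s" "s < t" "t < T" "s \<notin> (\<Union>\<eta>\<in>D. N \<eta>)" "t \<notin> (\<Union>\<eta>\<in>D. N \<eta>)"
    \<comment> \<open>The Bochner integral shows the right-hand side to be an inner product with a
      fixed vector, hence continuous in \<eta>.\<close>
    define Z where "Z = (LINT x|leb_on T. indicator {s<..t} x *\<^sub>R z x)"
    have Zint: "integrable (leb_on T) (\<lambda>x. indicator {s<..t} x *\<^sub>R z x)"
    proof (rule Bochner_Integration.integrable_bound[OF L2_integrable[OF z]])
      show "(\<lambda>x. indicator {s<..t} x *\<^sub>R z x) \<in> borel_measurable (leb_on T)"
        by (intro borel_measurable_scaleR borel_measurable_leb_on borel_measurable_indicator L2_measurable[OF z]) simp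
    qed (auto simp: indicator_def)
    have Z: "inner Z \<eta> = (LINT x|leb_on T. indicator {s<..t} x * inner (z x) \<eta>)" for \<eta>
      unfolding Z_def using integral_inner_left[OF Zint, of \<eta>] by simp
    have "closed {\<eta>. inner (\<iota> (u t) - \<iota> (u s)) (\<iota> \<eta>) = inner Z \<eta>}"
      by (intro closed_Collect_eq continuous_intros)
    moreover have "D \<subseteq> {\<eta>. inner (\<iota> (u t) - \<iota> (u s)) (\<iota> \<eta>) = inner Z \<eta>}"
    proof
      fix \<eta> assume "\<eta> \<in> D"
      with st incr[of s t \<eta>] Z[of \<eta>] show "\<eta> \<in> {\<eta>. inner (\<iota> (u t) - \<iota> (u s)) (\<iota> \<eta>) = inner Z \<eta>}"
        by (simp add: inner_diff_left)
    qed
    ultimately have "UNIV \<subseteq> {\<eta>. inner (\<iota> (u t) - \<iota> (u s)) (\<iota> \<eta>) = inner Z \<eta>}"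
      using closure_minimal[of D] D(2) by (meson order_trans)
    then show "inner (\<iota> (u t) - \<iota> (u s)) (\<iota> \<eta>) = (LINT x|leb_on T. indicator {s<..t} x * inner (z x) \<eta>)"
      using Z by auto
  qed
qed

text \<open>
  On a fine partition with nodes off a null set, the exact increments
  \<open>|u(b)|\<^sup>2 - |u(a)|\<^sup>2 = \<integral> \<langle>z, u(a) + u(b)\<rangle>\<close> differ from \<open>2 \<integral> \<langle>z, u\<rangle>\<close> by terms that are controlled by the
  distance of \<open>u\<close> to a continuous function \<open>g\<close>; the nodes are chosen such that this distance is
  at most its mean over the mesh interval.
\<close>

lemma energy_identity_AE:
  assumes uz: "has_time_deriv \<iota> T u z" and N: "N \<in> null_sets lebesgue"
    and incr: "\<And>s t \<eta>. 0 < s \<Longrightarrow> s < t \<Longrightarrow> t < T \<Longrightarrow> s \<notin> N \<Longrightarrow> t \<notin> N \<Longrightarrow>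
      inner (\<iota> (u t) - \<iota> (u s)) (\<iota> \<eta>) = (LINT x|leb_on T. indicator {s<..t} x * inner (z x) \<eta>)"
    and st: "0 < s" "s < t" "t < T" "s \<notin> N" "t \<notin> N"
  shows "(norm (\<iota> (u t)))\<^sup>2 - (norm (\<iota> (u s)))\<^sup>2
    = 2 * (primitive T (\<lambda>x. inner (z x) (u x)) t - primitive T (\<lambda>x. inner (z x) (u x)) s)"
proof -
  note u = has_time_derivD(1)[OF uz] and z = has_time_derivD(2)[OF uz]
  note zu_int = L2_inner_integrable[OF z u]
  \<comment> \<open>The claim is F s = F t; the increments of F along a partition are shown to add
    up to O(e).\<close>
  define F where "F x = (norm (\<iota> (u x)))\<^sup>2 - 2 * primitive T (\<lambda>x. inner (z x) (u x)) x" for x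
  define Z where "Z = (sqint T z)"
  have Z0: "Z \<ge> 0" by (simp add: Z_def)
  have main: "\<bar>F t - F s\<bar> \<le> e * (3 * Z + 4 + 3 * T)" if e: "e > 0" for e
  proof -
    \<comment> \<open>A single e bounds the L2 distance of u and g and the oscillation of g between
      neighbouring nodes, and its square is the slack in the choice of nodes. It is also the weight
      in Young's inequality, which makes every contribution O(e).\<close>
    obtain g where g: "continuous_on UNIV g" "(sqint T (\<lambda>t. u t - g t)) < e\<^sup>2"
      using L2_dense_continuous[OF u, of "e\<^sup>2"] e by auto
    define k where "k x = norm (u x - g x)" for x
    have k_int: "integrable (leb_on T) (\<lambda>x. (k x)\<^sup>2)"
      unfolding k_def by (rule L2_square_integrable[OF L2_diff[OF u L2_continuous[OF g(1)]]])
    have k_le: "(LINT x|leb_on T. (k x)\<^sup>2) \<le> e\<^sup>2" using g(2) by (simp add: k_def)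
    have "uniformly_continuous_on {0..T} g"
      by (rule compact_uniformly_continuous) (use g(1) in \<open>auto intro: continuous_on_subset\<close>)
    then obtain d where d: "d > 0" "\<And>x y. x \<in> {0..T} \<Longrightarrow> y \<in> {0..T} \<Longrightarrow> dist y x < d \<Longrightarrow> dist (g y) (g x) < e"
      using e unfolding uniformly_continuous_on_def by metis
    define S where "S = (k s)\<^sup>2 + (k t)\<^sup>2"
    have S0: "S \<ge> 0" by (simp add: S_def)
    \<comment> \<open>The mesh meets two demands: neighbouring nodes are closer than d, and the
      prescribed nodes s and t, where |u - g| is not governed by a mean, contribute at most e^2
      after multiplication by the mesh size.\<close>
    define n where "n = Suc (nat \<lceil>(t - s) * (2 / d + S / e\<^sup>2)\<rceil>)"
    define \<delta> where "\<delta> = (t - s) / n"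
    have n0: "n > 0" by (simp add: n_def)
    have \<delta>0: "\<delta> > 0" using st n0 by (simp add: \<delta>_def)
    have n\<delta>: "n * \<delta> = t - s" using n0 by (simp add: \<delta>_def)
    have nbig: "(t - s) * (2 / d + S / e\<^sup>2) < n" unfolding n_def by linarith
    have \<delta>_d: "2 * \<delta> < d"
    proof -
      have "(t - s) * (2 / d) \<le> (t - s) * (2 / d + S / e\<^sup>2)" using st S0 by (intro mult_left_mono) auto
      then have "(t - s) * (2 / d) < n" using nbig by simp
      then show ?thesis using d(1) n0 by (simp add: \<delta>_def field_simps)
    qed
    have \<delta>_S: "\<delta> * S \<le> e\<^sup>2"
    proof -
      have "(t - s) * (S / e\<^sup>2) \<le> (t - s) * (2 / d + S / e\<^sup>2)" using st d(1) by (intro mult_left_mono) auto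
      then have "(t - s) * (S / e\<^sup>2) \<le> n" using nbig by simp
      then show ?thesis using e n0 by (simp add: \<delta>_def field_simps)
    qed
    have node_le: "s + real i * \<delta> + \<delta> \<le> t" if "i < n" for i
    proof -
      have "(real i + 1) * \<delta> \<le> n * \<delta>" using that \<delta>0 by (intro mult_right_mono) auto
      then show ?thesis using n\<delta> by (simp add: algebra_simps)
    qed
    have "\<exists>x. s + i * \<delta> < x \<and> x < s + i * \<delta> + \<delta> \<and> x \<notin> N \<and> \<delta> * (k x)\<^sup>2 \<le> primitive T (\<lambda>x. (k x)\<^sup>2) (s + i * \<delta> + \<delta>)
        - primitive T (\<lambda>x. (k x)\<^sup>2) (s + i * \<delta>) + \<delta> * e\<^sup>2" if "i < n" for i
      using point_below_average[OF k_int _ _ _ N, of "s + i * \<delta>" "s + i * \<delta> + \<delta>" "e\<^sup>2"] st \<delta>0 e node_le[OF that] by auto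
    then obtain \<tau> where \<tau>: "\<And>i. i < n \<Longrightarrow> s + i * \<delta> < \<tau> i" "\<And>i. i < n \<Longrightarrow> \<tau> i < s + i * \<delta> + \<delta>" "\<And>i. i < n \<Longrightarrow> \<tau> i \<notin> N"
      "\<And>i. i < n \<Longrightarrow> \<delta> * (k (\<tau> i))\<^sup>2 \<le> primitive T (\<lambda>x. (k x)\<^sup>2) (s + i * \<delta> + \<delta>) - primitive T (\<lambda>x. (k x)\<^sup>2) (s + i * \<delta>) + \<delta> * e\<^sup>2"
      by metis
    \<comment> \<open>The ends are prescribed, and every cell supplies one further node. Nodes of
      adjacent cells may be almost \<open>2 * \<delta>\<close> apart.\<close>
    define p where "p i = (if i = 0 then s else if i \<le> n then \<tau> (i - 1) else t)" for i
    have p0: "p 0 = s" and pS: "\<And>i. i < n \<Longrightarrow> p (Suc i) = \<tau> i" and pn: "p (Suc n) = t" by (auto simp: p_def)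
    have p_mono: "p i < p (Suc i)" and p_step: "p (Suc i) - p i \<le> 2 * \<delta>" if "i < Suc n" for i
    proof -
      have "p i < p (Suc i) \<and> p (Suc i) - p i \<le> 2 * \<delta>"
      proof (cases i)
        case 0
        then show ?thesis using \<tau>(1,2)[of 0] n0 \<delta>0 pS[of 0] p0 by auto
      next
        case (Suc j)
        then have j: "j < n" using that by simp
        show ?thesis
        proof (cases "i < n")
          case True
          then show ?thesis using Suc j \<tau>(1,2)[of j] \<tau>(1,2)[of i] \<delta>0 pS[of j] pS[of i] by (auto simp: algebra_simps)
        next
          case False
          with that Suc have "n = Suc j" by simp
          then have "s + real j * \<delta> + \<delta> = t" using n\<delta> by (simp add: algebra_simps)
          then show ?thesis using Suc j \<tau>(1,2)[of j] \<delta>0 pS[of j] pn \<open>n = Suc j\<close> by auto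
        qed
      qed
      then show "p i < p (Suc i)" "p (Suc i) - p i \<le> 2 * \<delta>" by auto
    qed
    have p_range: "s \<le> p i \<and> p i \<le> t \<and> p i \<notin> N" if "i \<le> Suc n" for i
    proof (cases "i = 0 \<or> i = Suc n")
      case True
      then show ?thesis using st p0 pn by auto
    next
      case False
      then obtain j where j: "i = Suc j" "j < n" using \<open>i \<le> Suc n\<close> by (cases i) auto
      have "0 \<le> real j * \<delta>" using \<delta>0 by simp
      with \<tau>(1,2)[OF j(2)] node_le[OF j(2)] have "s \<le> \<tau> j" "\<tau> j \<le> t" by linarith+
      then show ?thesis using \<tau>(3)[OF j(2)] pS[OF j(2)] j by simp
    qed
    \<comment> \<open>Young's inequality splits the products of |z| with the errors; m collects all
      that depends on x or only on e. The remaining terms, with \<open>k a\<close> and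
      \<open>k b\<close>, are summed over the nodes instead.\<close>
    define m where "m x = 3 * e * (norm (z x))\<^sup>2 + ((k x)\<^sup>2 + e\<^sup>2) / e" for x
    have m_int: "integrable (leb_on T) m"
      unfolding m_def[abs_def] using k_int L2_square_integrable[OF z] by simp
    have Young: "a * b \<le> (e * a\<^sup>2 + b\<^sup>2 / e) / 2" for a b :: real
    proof -
      have "0 \<le> (e * a - b)\<^sup>2 / (2 * e)" using e by simp
      also have "\<dots> = (e * a\<^sup>2 + b\<^sup>2 / e) / 2 - a * b" using e by (simp add: power2_eq_square field_simps)
      finally show ?thesis by simp
    qed
    have step: "\<bar>F b - F a\<bar> \<le> (primitive T m b - primitive T m a) + (\<delta> / e) * ((k a)\<^sup>2 + (k b)\<^sup>2)"
      if ab: "s \<le> a" "a < b" "b \<le> t" "a \<notin> N" "b \<notin> N" "b - a \<le> 2 * \<delta>" for a b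
    proof -
      have ab': "0 < a" "b < T" using ab st by auto
      have "(norm (\<iota> (u b)))\<^sup>2 - (norm (\<iota> (u a)))\<^sup>2 = inner (\<iota> (u b) - \<iota> (u a)) (\<iota> (u b + u a))"
        unfolding power2_norm_eq_inner blinfun.add_right by (simp add: inner_simps inner_commute)
      also have "\<dots> = (LINT x|leb_on T. indicator {a<..b} x * inner (z x) (u b + u a))"
        using incr ab ab' by simp
      finally have "F b - F a = (LINT x|leb_on T. indicator {a<..b} x * inner (z x) (u b + u a))
          - 2 * (LINT x|leb_on T. indicator {a<..b} x * inner (z x) (u x))"
        unfolding F_def using primitive_diff[OF zu_int, of a b] ab ab' by (simp add: algebra_simps)
      also have "\<dots> = (LINT x|leb_on T. indicator {a<..b} x * inner (z x) (u b + u a) - 2 * (indicator {a<..b} x * inner (z x) (u x)))"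
        using integrable_indicator_mult[OF zu_int] integrable_indicator_mult[OF L2_inner_integrable[OF z L2_const]] by simp
      finally have F_eq: "F b - F a = (LINT x|leb_on T. indicator {a<..b} x * inner (z x) (u b + u a) - 2 * (indicator {a<..b} x * inner (z x) (u x)))" .
      have "\<bar>F b - F a\<bar> \<le> (LINT x|leb_on T. indicator {a<..b} x * (m x + ((k a)\<^sup>2 + (k b)\<^sup>2) / (2 * e)))"
        unfolding F_eq
      proof (rule order_trans[OF integral_abs_bound], rule integral_mono)
        show "integrable (leb_on T) (\<lambda>x. indicator {a<..b} x * (m x + ((k a)\<^sup>2 + (k b)\<^sup>2) / (2 * e)))"
          by (intro integrable_indicator_mult) (use m_int in auto)
        show "integrable (leb_on T) (\<lambda>x. \<bar>indicator {a<..b} x * inner (z x) (u b + u a) - 2 * (indicator {a<..b} x * inner (z x) (u x))\<bar>)"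
          using integrable_indicator_mult[OF zu_int] integrable_indicator_mult[OF L2_inner_integrable[OF z L2_const]] by simp
        fix x assume "x \<in> space (leb_on T)"
        then have x: "x \<in> {0..T}" by simp
        show "\<bar>indicator {a<..b} x * inner (z x) (u b + u a) - 2 * (indicator {a<..b} x * inner (z x) (u x))\<bar>
          \<le> indicator {a<..b} x * (m x + ((k a)\<^sup>2 + (k b)\<^sup>2) / (2 * e))"
        proof (cases "x \<in> {a<..b}")
          case True
          have near: "norm (u y - u x) \<le> k y + k x + e" if "y \<in> {a, b}" for y
          proof -
            have "dist (g y) (g x) < e"
              using that True ab ab' x \<delta>_d by (intro d(2)) (auto simp: dist_real_def)
            moreover have "u y - u x = (u y - g y) + ((g x - u x) + (g y - g x))" by simp
            ultimately show ?thesis unfolding k_def dist_norm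
              using norm_triangle_ineq[of "u y - g y" "(g x - u x) + (g y - g x)"] norm_triangle_ineq[of "g x - u x" "g y - g x"]
              by (simp add: norm_minus_commute)
          qed
          have "\<bar>inner (z x) (u b + u a) - 2 * inner (z x) (u x)\<bar> = \<bar>inner (z x) ((u b - u x) + (u a - u x))\<bar>"
            by (simp add: inner_simps)
          also have "\<dots> \<le> norm (z x) * norm ((u b - u x) + (u a - u x))" by (rule Cauchy_Schwarz_ineq2)
          also have "\<dots> \<le> norm (z x) * ((k b + k x + e) + (k a + k x + e))"
            using near[of a] near[of b] norm_triangle_ineq[of "u b - u x" "u a - u x"] by (intro mult_left_mono) auto
          also have "\<dots> = norm (z x) * k b + norm (z x) * k a + 2 * (norm (z x) * k x) + 2 * (norm (z x) * e)"
            by (simp add: algebra_simps)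
          also have "\<dots> \<le> (e * (norm (z x))\<^sup>2 + (k b)\<^sup>2 / e) / 2 + (e * (norm (z x))\<^sup>2 + (k a)\<^sup>2 / e) / 2
              + 2 * ((e * (norm (z x))\<^sup>2 + (k x)\<^sup>2 / e) / 2) + 2 * ((e * (norm (z x))\<^sup>2 + e\<^sup>2 / e) / 2)"
            by (intro add_mono mult_left_mono Young) auto
          also have "\<dots> = m x + ((k a)\<^sup>2 + (k b)\<^sup>2) / (2 * e)"
            unfolding m_def using e by (simp add: field_simps)
          finally show ?thesis using True by simp
        qed simp
      qed
      also have "\<dots> = (LINT x|leb_on T. indicator {a<..b} x * m x) + (LINT x|leb_on T. indicator {a<..b} x * (((k a)\<^sup>2 + (k b)\<^sup>2) / (2 * e)))"
        unfolding distrib_left using integrable_indicator_mult[OF m_int] integrable_indicator_mult[OF integrable_leb_on_const]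
        by (rule Bochner_Integration.integral_add)
      also have "\<dots> = (primitive T m b - primitive T m a) + (b - a) * (((k a)\<^sup>2 + (k b)\<^sup>2) / (2 * e))"
        using ab ab' st by (subst primitive_const) (auto simp: primitive_diff[OF m_int])
      also have "\<dots> \<le> (primitive T m b - primitive T m a) + (2 * \<delta>) * (((k a)\<^sup>2 + (k b)\<^sup>2) / (2 * e))"
        using ab e by (intro add_left_mono mult_right_mono) auto
      also have "\<dots> = (primitive T m b - primitive T m a) + (\<delta> / e) * ((k a)\<^sup>2 + (k b)\<^sup>2)" by simp
      finally show ?thesis .
    qed
    \<comment> \<open>An interior node belongs to two steps and each end to one, whence the factor 2
      and the single S.\<close>
    have k_sum: "(\<Sum>i<Suc n. (k (p i))\<^sup>2) + (\<Sum>i<Suc n. (k (p (Suc i)))\<^sup>2) = S + 2 * (\<Sum>i<n. (k (\<tau> i))\<^sup>2)"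
    proof -
      have "(\<Sum>i<n. (k (p (Suc i)))\<^sup>2) = (\<Sum>i<n. (k (\<tau> i))\<^sup>2)" by (rule sum.cong) (auto simp: pS)
      moreover have "(\<Sum>i<Suc n. (k (p i))\<^sup>2) = (k (p 0))\<^sup>2 + (\<Sum>i<n. (k (p (Suc i)))\<^sup>2)" by (rule sum.lessThan_Suc_shift)
      ultimately show ?thesis using p0 pn by (simp add: S_def)
    qed
    have m_le: "primitive T m t - primitive T m s \<le> 3 * e * Z + (e\<^sup>2 + T * e\<^sup>2) / e"
    proof -
      have "primitive T m t - primitive T m s \<le> primitive T m T"
        using primitive_mono[OF m_int, of t T] primitive_mono[OF m_int, of 0 s] st e by (auto simp: m_def)
      also have "\<dots> = 3 * e * Z + ((LINT x|leb_on T. (k x)\<^sup>2) + T * e\<^sup>2) / e"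
        unfolding primitive_T m_def Z_def using k_int L2_square_integrable[OF z] T by (simp add: measure_leb_on_space)
      also have "\<dots> \<le> 3 * e * Z + (e\<^sup>2 + T * e\<^sup>2) / e"
        using k_le e by (intro add_mono divide_right_mono) auto
      finally show ?thesis .
    qed
    have \<tau>_le: "(\<Sum>i<n. \<delta> * (k (\<tau> i))\<^sup>2) \<le> e\<^sup>2 + T * e\<^sup>2"
    proof -
      have "(\<Sum>i<n. \<delta> * (k (\<tau> i))\<^sup>2) \<le> (\<Sum>i<n. (primitive T (\<lambda>x. (k x)\<^sup>2) (s + Suc i * \<delta>) - primitive T (\<lambda>x. (k x)\<^sup>2) (s + i * \<delta>)) + \<delta> * e\<^sup>2)"
      proof (rule sum_mono)
        fix i assume "i \<in> {..<n}"
        moreover have "s + Suc i * \<delta> = s + i * \<delta> + \<delta>" by (simp add: algebra_simps)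
        ultimately show "\<delta> * (k (\<tau> i))\<^sup>2 \<le> (primitive T (\<lambda>x. (k x)\<^sup>2) (s + Suc i * \<delta>) - primitive T (\<lambda>x. (k x)\<^sup>2) (s + i * \<delta>)) + \<delta> * e\<^sup>2"
          using \<tau>(4)[of i] by (simp add: add.assoc)
      qed
      also have "\<dots> = primitive T (\<lambda>x. (k x)\<^sup>2) t - primitive T (\<lambda>x. (k x)\<^sup>2) s + (t - s) * e\<^sup>2"
      proof -
        have "(\<Sum>i<n. primitive T (\<lambda>x. (k x)\<^sup>2) (s + Suc i * \<delta>) - primitive T (\<lambda>x. (k x)\<^sup>2) (s + i * \<delta>))
            = primitive T (\<lambda>x. (k x)\<^sup>2) (s + n * \<delta>) - primitive T (\<lambda>x. (k x)\<^sup>2) (s + 0 * \<delta>)"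
          using sum_lessThan_telescope[of "\<lambda>i. primitive T (\<lambda>x. (k x)\<^sup>2) (s + real i * \<delta>)" n] by simp
        moreover have "(\<Sum>i<n. \<delta> * e\<^sup>2) = (t - s) * e\<^sup>2" using n\<delta> by simp
        moreover have "s + n * \<delta> = t" using n\<delta> by simp
        ultimately show ?thesis by (simp only: sum.distrib) simp
      qed
      also have "\<dots> \<le> primitive T (\<lambda>x. (k x)\<^sup>2) T + T * e\<^sup>2"
      proof (intro add_mono mult_right_mono)
        show "primitive T (\<lambda>x. (k x)\<^sup>2) t - primitive T (\<lambda>x. (k x)\<^sup>2) s \<le> primitive T (\<lambda>x. (k x)\<^sup>2) T"
          using primitive_mono[OF k_int, of t T] primitive_mono[OF k_int, of 0 s] st by auto
      qed (use st in auto)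
      also have "\<dots> \<le> e\<^sup>2 + T * e\<^sup>2" using k_le by (simp add: primitive_T)
      finally show ?thesis .
    qed
    have "F t - F s = (\<Sum>i<Suc n. F (p (Suc i)) - F (p i))"
      using sum_lessThan_telescope[of "\<lambda>i. F (p i)" "Suc n"] p0 pn by simp
    then have "\<bar>F t - F s\<bar> \<le> (\<Sum>i<Suc n. \<bar>F (p (Suc i)) - F (p i)\<bar>)" by (simp only: sum_abs)
    also have "\<dots> \<le> (\<Sum>i<Suc n. (primitive T m (p (Suc i)) - primitive T m (p i)) + (\<delta> / e) * ((k (p i))\<^sup>2 + (k (p (Suc i)))\<^sup>2))"
      by (intro sum_mono step) (use p_range p_mono p_step in \<open>auto simp: less_Suc_eq_le\<close>)
    also have "\<dots> = (primitive T m t - primitive T m s) + (\<delta> / e) * (S + 2 * (\<Sum>i<n. (k (\<tau> i))\<^sup>2))"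
      using sum_lessThan_telescope[of "\<lambda>i. primitive T m (p i)" "Suc n"] p0 pn k_sum
      by (simp only: sum.distrib sum_distrib_left[symmetric])
    also have "\<dots> = (primitive T m t - primitive T m s) + (\<delta> * S + 2 * (\<Sum>i<n. \<delta> * (k (\<tau> i))\<^sup>2)) / e"
      unfolding sum_distrib_left[symmetric] by (simp add: algebra_simps add_divide_distrib)
    also have "\<dots> \<le> (3 * e * Z + (e\<^sup>2 + T * e\<^sup>2) / e) + (e\<^sup>2 + 2 * (e\<^sup>2 + T * e\<^sup>2)) / e"
      by (intro add_mono divide_right_mono mult_left_mono m_le \<tau>_le \<delta>_S) (use e in auto)
    also have "\<dots> = e * (3 * Z + 4 + 3 * T)" using e by (simp add: power2_eq_square field_simps)
    finally show ?thesis .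
  qed
  have "\<bar>F t - F s\<bar> \<le> 0"
  proof (rule field_le_epsilon)
    fix e :: real assume e: "e > 0"
    have pos: "3 * Z + 4 + 3 * T > 0" using Z0 T by simp
    with main[of "e / (3 * Z + 4 + 3 * T)"] e show "\<bar>F t - F s\<bar> \<le> 0 + e" by simp
  qed
  then show ?thesis by (simp add: F_def algebra_simps)
qed

text \<open>The energy identity controls |u| but not the increments of u. Combined with the
  increment formula for the fixed \<eta> = u(r) it expresses |u(y) - u(x)|^2 by an integral over
  (x,y). The price is the squared norm of u(r) in V times a length, and a good choice of r bounds
  this by an integral as well.\<close>

lemma trace_good_set:
  assumes uz: "has_time_deriv \<iota> T u z"
  obtains N where "N \<in> null_sets lebesgue" "uniformly_continuous_on ({0<..<T} - N) (\<lambda>t. \<iota> (u t))"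
    "(\<lambda>t. (norm (\<iota> (u t)))\<^sup>2 - 2 * primitive T (\<lambda>x. inner (z x) (u x)) t) constant_on ({0<..<T} - N)"
proof -
  note u = has_time_derivD(1)[OF uz] and z = has_time_derivD(2)[OF uz]
  let ?I = "primitive T (\<lambda>x. inner (z x) (u x))"
  from time_deriv_increment[OF uz] obtain N where N: "N \<in> null_sets lebesgue"
    and incr: "\<And>s t \<eta>. 0 < s \<Longrightarrow> s < t \<Longrightarrow> t < T \<Longrightarrow> s \<notin> N \<Longrightarrow> t \<notin> N \<Longrightarrow>
      inner (\<iota> (u t) - \<iota> (u s)) (\<iota> \<eta>) = (LINT x|leb_on T. indicator {s<..t} x * inner (z x) \<eta>)" by blast
  have energy: "(norm (\<iota> (u t)))\<^sup>2 - (norm (\<iota> (u s)))\<^sup>2 = 2 * (?I t - ?I s)"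
    if "0 < s" "s < t" "t < T" "s \<notin> N" "t \<notin> N" for s t
    using energy_identity_AE[OF uz N incr that] by blast
  define m where "m x = 2 * (norm (z x))\<^sup>2 + (norm (u x))\<^sup>2" for x
  note z2 = L2_square_integrable[OF z] and u2 = L2_square_integrable[OF u]
  have m_int: "integrable (leb_on T) m" unfolding m_def[abs_def] using z2 u2 by simp
  have zc_int: "integrable (leb_on T) (\<lambda>x. inner (z x) c)" for c by (rule L2_inner_integrable[OF z L2_const])
  have local: "(norm (\<iota> (u y) - \<iota> (u x)))\<^sup>2 \<le> primitive T m b - primitive T m a + (b - a) * (norm (u r))\<^sup>2"
    if "0 \<le> a" "a \<le> x" "x < y" "y \<le> b" "b \<le> T" "0 < x" "y < T" "x \<notin> N" "y \<notin> N" "r = x \<or> r = y" for a b x y r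
  proof -
    \<comment> \<open>For r = x the expression on the right is the squared distance, for r = y its
      negative. Both cases occur, since the good point may lie on either side.\<close>
    have "(norm (\<iota> (u y) - \<iota> (u x)))\<^sup>2 \<le> \<bar>((norm (\<iota> (u y)))\<^sup>2 - (norm (\<iota> (u x)))\<^sup>2) - 2 * inner (\<iota> (u y) - \<iota> (u x)) (\<iota> (u r))\<bar>"
      using that(10) unfolding power2_norm_eq_inner by (auto simp: inner_simps inner_commute)
    also have "((norm (\<iota> (u y)))\<^sup>2 - (norm (\<iota> (u x)))\<^sup>2) - 2 * inner (\<iota> (u y) - \<iota> (u x)) (\<iota> (u r))
      = 2 * (?I y - ?I x) - 2 * (LINT t|leb_on T. indicator {x<..y} t * inner (z t) (u r))"
      using energy[of x y] incr[of x y "u r"] that by simp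
    also have "\<dots> = (LINT t|leb_on T. 2 * (indicator {x<..y} t * inner (z t) (u t)) - 2 * (indicator {x<..y} t * inner (z t) (u r)))"
      using primitive_diff[OF L2_inner_integrable[OF z u], of x y] that
        integrable_indicator_mult[OF L2_inner_integrable[OF z u]] integrable_indicator_mult[OF zc_int] by simp
    also have "\<bar>\<dots>\<bar> \<le> (LINT t|leb_on T. indicator {a<..b} t * (m t + (norm (u r))\<^sup>2))"
    proof (rule order_trans[OF integral_abs_bound], rule integral_mono)
      show "integrable (leb_on T) (\<lambda>t. \<bar>2 * (indicator {x<..y} t * inner (z t) (u t)) - 2 * (indicator {x<..y} t * inner (z t) (u r))\<bar>)"
        using integrable_indicator_mult[OF L2_inner_integrable[OF z u]] integrable_indicator_mult[OF zc_int] by simp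
      show "integrable (leb_on T) (\<lambda>t. indicator {a<..b} t * (m t + (norm (u r))\<^sup>2))"
        by (intro integrable_indicator_mult) (use m_int in auto)
      fix t
      have Young: "2 * (p * q) \<le> p\<^sup>2 + q\<^sup>2" for p q :: real using zero_le_power2[of "p - q"] by (simp add: power2_diff)
      have "\<bar>2 * inner (z t) (u t) - 2 * inner (z t) (u r)\<bar> \<le> 2 * \<bar>inner (z t) (u t)\<bar> + 2 * \<bar>inner (z t) (u r)\<bar>" by linarith
      also have "\<dots> \<le> 2 * (norm (z t) * norm (u t)) + 2 * (norm (z t) * norm (u r))"
        using Cauchy_Schwarz_ineq2[of "z t" "u t"] Cauchy_Schwarz_ineq2[of "z t" "u r"] by linarith
      also have "\<dots> \<le> m t + (norm (u r))\<^sup>2"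
        using Young[of "norm (z t)" "norm (u t)"] Young[of "norm (z t)" "norm (u r)"] by (simp add: m_def)
      finally have "\<bar>2 * inner (z t) (u t) - 2 * inner (z t) (u r)\<bar> \<le> m t + (norm (u r))\<^sup>2" .
      moreover have "0 \<le> m t + (norm (u r))\<^sup>2" by (simp add: m_def)
      ultimately show "\<bar>2 * (indicator {x<..y} t * inner (z t) (u t)) - 2 * (indicator {x<..y} t * inner (z t) (u r))\<bar>
          \<le> indicator {a<..b} t * (m t + (norm (u r))\<^sup>2)"
        using that by (auto simp: indicator_def)
    qed
    also have "\<dots> = (LINT t|leb_on T. indicator {a<..b} t * m t) + (LINT t|leb_on T. indicator {a<..b} t * (norm (u r))\<^sup>2)"
      unfolding distrib_left using integrable_indicator_mult[OF m_int] integrable_indicator_mult[OF integrable_leb_on_const]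
      by (rule Bochner_Integration.integral_add)
    also have "\<dots> = primitive T m b - primitive T m a + (b - a) * (norm (u r))\<^sup>2"
      using that by (subst primitive_const) (auto simp: primitive_diff[OF m_int])
    finally show ?thesis .
  qed
  \<comment> \<open>The additional |u|^2 pays for u(r), so that one modulus of continuity covers
    both terms.\<close>
  define M where "M x = m x + (norm (u x))\<^sup>2" for x
  have M_int: "integrable (leb_on T) M" unfolding M_def[abs_def] using m_int u2 by simp
  have M_split: "primitive T M b - primitive T M a
      = (primitive T m b - primitive T m a) + (primitive T (\<lambda>x. (norm (u x))\<^sup>2) b - primitive T (\<lambda>x. (norm (u x))\<^sup>2) a)" for a b
    unfolding primitive_def M_def distrib_left using integrable_indicator_mult[OF m_int] integrable_indicator_mult[OF u2] by simp
  have ucont: "uniformly_continuous_on ({0<..<T} - N) (\<lambda>t. \<iota> (u t))"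
    unfolding uniformly_continuous_on_def
  proof (intro allI impI)
    fix e :: real assume e: "e > 0"
    \<comment> \<open>Each squared distance to u(r) is at most 2 e' = e^2 / 8, which is below (e /
      2)^2.\<close>
    define e' where "e' = e\<^sup>2 / 16"
    have e': "e' > 0" using e by (simp add: e'_def)
    have "uniformly_continuous_on {0..T} (primitive T M)"
      by (rule compact_uniformly_continuous[OF continuous_on_primitive[OF M_int]]) simp
    then obtain d0 where d0: "d0 > 0"
      "\<And>a b. a \<in> {0..T} \<Longrightarrow> b \<in> {0..T} \<Longrightarrow> dist b a < d0 \<Longrightarrow> dist (primitive T M b) (primitive T M a) < e'"
      using e' unfolding uniformly_continuous_on_def by metis
    define d where "d = min T (min (d0 / 2) 1)"
    have d: "d > 0" "d \<le> T" "d < d0" "d \<le> 1" using T d0(1) by (auto simp: d_def)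
    have close: "norm (\<iota> (u t) - \<iota> (u s)) < e" if st: "s \<in> {0<..<T} - N" "t \<in> {0<..<T} - N" "s \<le> t" "t - s < d" for s t
    proof -
      \<comment> \<open>The window around s and t has length d, so it is nondegenerate even for s =
        t; near T it is shifted to the left to stay in [0,T].\<close>
      define a where "a = min s (T - d)"
      define b where "b = a + d"
      have ab: "0 \<le> a" "a \<le> s" "t \<le> b" "b \<le> T" "a < b" using st d unfolding a_def b_def by auto
      obtain r where r: "a < r" "r < b" "r \<notin> N"
        "(b - a) * (norm (u r))\<^sup>2 \<le> primitive T (\<lambda>x. (norm (u x))\<^sup>2) b - primitive T (\<lambda>x. (norm (u x))\<^sup>2) a + (b - a) * e'"
        using point_below_average[OF u2 ab(1,5,4) N e'] by blast
      have "primitive T M b - primitive T M a < e'"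
        using d0(2)[of a b] ab d b_def by (auto simp: dist_real_def)
      moreover have "(b - a) * e' \<le> e'" using d e' by (simp add: b_def mult_left_le_one_le)
      ultimately have bound: "primitive T m b - primitive T m a + (b - a) * (norm (u r))\<^sup>2 \<le> 2 * e'"
        using M_split[of b a] r(4) by linarith
      have near: "norm (\<iota> (u y) - \<iota> (u r)) < e / 2" if y: "y \<in> {s, t}" for y
      proof -
        have "(norm (\<iota> (u y) - \<iota> (u r)))\<^sup>2 \<le> 2 * e'"
        proof -
          consider "y < r" | "y = r" | "r < y" by linarith
          then show ?thesis
          proof cases
            case 1
            with local[of a y r b r] bound y ab st r show ?thesis by (auto simp: norm_minus_commute)
          next
            case 3
            with local[of a r y b r] bound y ab st r show ?thesis by auto
          qed (use e' in auto)
        qed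
        also have "\<dots> < (e / 2)\<^sup>2" using e by (simp add: e'_def power2_eq_square)
        finally show ?thesis by (rule power_less_imp_less_base) (use e in simp)
      qed
      have "norm (\<iota> (u t) - \<iota> (u s)) \<le> norm (\<iota> (u t) - \<iota> (u r)) + norm (\<iota> (u s) - \<iota> (u r))"
        using norm_triangle_ineq4[of "\<iota> (u t) - \<iota> (u r)" "\<iota> (u s) - \<iota> (u r)"] by simp
      with near[of s] near[of t] show ?thesis by simp
    qed
    show "\<exists>d>0. \<forall>x\<in>{0<..<T} - N. \<forall>x'\<in>{0<..<T} - N. dist x' x < d \<longrightarrow> dist (\<iota> (u x')) (\<iota> (u x)) < e"
    proof (intro exI[of _ d] conjI ballI impI d(1))
      fix x x' assume x: "x \<in> {0<..<T} - N" "x' \<in> {0<..<T} - N" "dist x' x < d"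
      show "dist (\<iota> (u x')) (\<iota> (u x)) < e"
        using close[OF x(1,2)] close[OF x(2,1)] x(3)
        by (cases "x \<le> x'") (auto simp: dist_norm dist_real_def norm_minus_commute)
    qed
  qed
  have "(norm (\<iota> (u s)))\<^sup>2 - 2 * ?I s = (norm (\<iota> (u t)))\<^sup>2 - 2 * ?I t"
    if "s \<in> {0<..<T} - N" "t \<in> {0<..<T} - N" for s t
    using energy[of s t] energy[of t s] that by (cases s t rule: linorder_cases) auto
  then have "(\<lambda>t. (norm (\<iota> (u t)))\<^sup>2 - 2 * ?I t) constant_on ({0<..<T} - N)"
    unfolding constant_on_def by (cases "{0<..<T} - N = {}") blast+
  with that[OF N ucont] show thesis by blast
qed

text \<open>Uniform continuity extends to the closure of the good set, which is [0,T]. Thus also 0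
  and T, which the good set never contains, receive values, and the energy identity follows by
  continuity.\<close>

lemma trace_representative:
  assumes uz: "has_time_deriv \<iota> T u z"
  obtains c where "continuous_on {0..T} c" "ae_eq T c (\<lambda>t. \<iota> (u t))"
    "(\<lambda>t. (norm (c t))\<^sup>2 - 2 * primitive T (\<lambda>x. inner (z x) (u x)) t) constant_on {0..T}"
proof -
  note u = has_time_derivD(1)[OF uz] and z = has_time_derivD(2)[OF uz]
  let ?I = "primitive T (\<lambda>x. inner (z x) (u x))"
  obtain N where N: "N \<in> null_sets lebesgue" "uniformly_continuous_on ({0<..<T} - N) (\<lambda>t. \<iota> (u t))"
    and energy: "(\<lambda>t. (norm (\<iota> (u t)))\<^sup>2 - 2 * ?I t) constant_on ({0<..<T} - N)"
    using trace_good_set[OF uz] by blast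
  obtain c where c: "uniformly_continuous_on (closure ({0<..<T} - N)) c" "\<And>x. x \<in> {0<..<T} - N \<Longrightarrow> \<iota> (u x) = c x"
    using uniformly_continuous_on_extension_on_closure[OF N(2)] by metis
  have dense: "{0..T} \<subseteq> closure ({0<..<T} - N)" by (rule good_set_dense[OF T N(1)])
  have "closure ({0<..<T} - N) \<subseteq> {0..T}" by (rule closure_minimal) auto
  with dense have cl: "closure ({0<..<T} - N) = {0..T}" by blast
  have cont: "continuous_on {0..T} c" using uniformly_continuous_imp_continuous[OF c(1)] cl by simp
  have ae: "ae_eq T c (\<lambda>t. \<iota> (u t))"
    unfolding ae_eq_def using AE_leb_on_not_in[OF N(1)] by eventually_elim (use c(2) in auto)
  obtain k where k: "\<And>x. x \<in> {0<..<T} - N \<Longrightarrow> (norm (\<iota> (u x)))\<^sup>2 - 2 * ?I x = k"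
    using energy unfolding constant_on_def by blast
  have "(norm (c x))\<^sup>2 - 2 * ?I x = k" if "x \<in> {0..T}" for x
  proof (rule continuous_constant_on_closure[where S = "{0<..<T} - N" and f = "\<lambda>x. (norm (c x))\<^sup>2 - 2 * ?I x"])
    show "continuous_on (closure ({0<..<T} - N)) (\<lambda>x. (norm (c x))\<^sup>2 - 2 * ?I x)"
      unfolding cl by (intro continuous_intros cont continuous_on_primitive L2_inner_integrable z u)
    show "x \<in> closure ({0<..<T} - N)" using that cl by simp
    show "(norm (c y))\<^sup>2 - 2 * ?I y = k" if "y \<in> {0<..<T} - N" for y
      using k[OF that] c(2)[OF that] by simp
  qed
  then have "(\<lambda>t. (norm (c t))\<^sup>2 - 2 * ?I t) constant_on {0..T}" unfolding constant_on_def by blast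
  with that[OF cont ae] show thesis by blast
qed

text \<open>This is how the choice in \<open>trace_at\<close> is evaluated: continuous functions
  that agree almost everywhere agree on a dense set. Linearity of the trace is deduced from
  it.\<close>

lemma trace_at_eqI:
  assumes c: "continuous_on {0..T} c" "ae_eq T c (\<lambda>t. \<iota> (u t))" and t: "t \<in> {0..T}"
  shows "trace_at \<iota> T t u = c t"
proof -
  define c' where "c' = (SOME c. continuous_on {0..T} c \<and> ae_eq T c (\<lambda>s. \<iota> (u s)))"
  have c': "continuous_on {0..T} c'" "ae_eq T c' (\<lambda>s. \<iota> (u s))"
    unfolding c'_def using someI[of "\<lambda>c. continuous_on {0..T} c \<and> ae_eq T c (\<lambda>s. \<iota> (u s))" c] c by auto
  have "AE x in leb_on T. c' x = c x"
    using c(2) c'(2) unfolding ae_eq_def by eventually_elim simp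
  then obtain N where N: "N \<in> null_sets (leb_on T)" "{x \<in> space (leb_on T). c' x \<noteq> c x} \<subseteq> N"
    by (auto simp: eventually_ae_filter)
  then have "N \<in> null_sets lebesgue" by (subst (asm) null_sets_restrict_space) auto
  from good_set_dense[OF T this] have "closure ({0<..<T} - N) = {0..T}"
    by (intro antisym closure_minimal) auto
  moreover have "c' x - c x = 0" if "x \<in> {0<..<T} - N" for x using that N by auto
  ultimately have "c' t - c t = 0"
    using continuous_constant_on_closure[of "{0<..<T} - N" "\<lambda>x. c' x - c x" 0 t] t c c'
    by (auto intro: continuous_intros)
  then show ?thesis unfolding trace_at_def c'_def by simp
qed

lemma trace_continuous_ae:
  assumes uz: "has_time_deriv \<iota> T u z"
  shows "continuous_on {0..T} (\<lambda>t. trace_at \<iota> T t u)" "ae_eq T (\<lambda>t. trace_at \<iota> T t u) (\<lambda>t. \<iota> (u t))"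
proof -
  obtain c where c: "continuous_on {0..T} c" "ae_eq T c (\<lambda>t. \<iota> (u t))" using trace_representative[OF uz] by blast
  have eq: "trace_at \<iota> T t u = c t" if "t \<in> {0..T}" for t using trace_at_eqI[OF c that] .
  show "continuous_on {0..T} (\<lambda>t. trace_at \<iota> T t u)"
    using c(1) by (subst continuous_on_cong[OF refl eq])
  have "{} \<in> null_sets lebesgue" by simp
  from AE_leb_on_not_in[OF this] c(2) show "ae_eq T (\<lambda>t. trace_at \<iota> T t u) (\<lambda>t. \<iota> (u t))"
    unfolding ae_eq_def by eventually_elim (use eq in auto)
qed

lemma trace_energy:
  assumes uz: "has_time_deriv \<iota> T u z" and st: "s \<in> {0..T}" "t \<in> {0..T}"
  shows "(norm (trace_at \<iota> T t u))\<^sup>2 - (norm (trace_at \<iota> T s u))\<^sup>2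
      = 2 * (primitive T (\<lambda>x. inner (z x) (u x)) t - primitive T (\<lambda>x. inner (z x) (u x)) s)"
proof -
  let ?I = "primitive T (\<lambda>x. inner (z x) (u x))"
  obtain c where c: "continuous_on {0..T} c" "ae_eq T c (\<lambda>t. \<iota> (u t))"
    and energy: "(\<lambda>t. (norm (c t))\<^sup>2 - 2 * ?I t) constant_on {0..T}"
    using trace_representative[OF uz] by blast
  obtain k where "\<And>x. x \<in> {0..T} \<Longrightarrow> (norm (c x))\<^sup>2 - 2 * ?I x = k"
    using energy unfolding constant_on_def by blast
  from this[OF st(1)] this[OF st(2)] show ?thesis
    using trace_at_eqI[OF c st(1)] trace_at_eqI[OF c st(2)] by simp
qed

text \<open>The energy identity compares the values at t and s; averaging over s trades the value at
  s for the L2 norm of u. The bound lets the trace terms of the norm of X pass to limits.\<close>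

lemma trace_bound:
  assumes uz: "has_time_deriv \<iota> T u z" and t: "t \<in> {0..T}"
  shows "T * (norm (trace_at \<iota> T t u))\<^sup>2
    \<le> ((norm \<iota>)\<^sup>2 + T) * ((sqint T u) + (sqint T z))"
proof -
  note u = has_time_derivD(1)[OF uz] and z = has_time_derivD(2)[OF uz]
  note z2 = L2_square_integrable[OF z] and u2 = L2_square_integrable[OF u]
  let ?I = "primitive T (\<lambda>x. inner (z x) (u x))"
  define U where "U = (sqint T u)"
  define Z where "Z = (sqint T z)"
  have UZ: "U \<ge> 0" "Z \<ge> 0" by (auto simp: U_def Z_def)
  have I_diff: "2 * (?I t - ?I s) \<le> U + Z" if st: "s \<in> {0..T}" "t \<in> {0..T}" for s t
  proof -
    have "2 * (?I t - ?I s) = (LINT x|leb_on T. 2 * (indicator {0<..t} x * inner (z x) (u x)) - 2 * (indicator {0<..s} x * inner (z x) (u x)))"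
      unfolding primitive_def using integrable_indicator_mult[OF L2_inner_integrable[OF z u]] by simp
    also have "\<dots> \<le> (LINT x|leb_on T. (norm (u x))\<^sup>2 + (norm (z x))\<^sup>2)"
    proof (rule integral_mono)
      fix x
      have "2 * \<bar>inner (z x) (u x)\<bar> \<le> (norm (u x))\<^sup>2 + (norm (z x))\<^sup>2"
        using Cauchy_Schwarz_ineq2[of "z x" "u x"] zero_le_power2[of "norm (z x) - norm (u x)"]
        unfolding power2_diff by linarith
      then show "2 * (indicator {0<..t} x * inner (z x) (u x)) - 2 * (indicator {0<..s} x * inner (z x) (u x)) \<le> (norm (u x))\<^sup>2 + (norm (z x))\<^sup>2"
        by (auto simp: indicator_def)
    qed (use integrable_indicator_mult[OF L2_inner_integrable[OF z u]] u2 z2 in auto)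
    also have "\<dots> = U + Z" unfolding U_def Z_def using u2 z2 by simp
    finally show ?thesis .
  qed
  have "T * (norm (trace_at \<iota> T t u))\<^sup>2 = (sqint T (\<lambda>s. trace_at \<iota> T t u))"
    using T by (simp add: measure_leb_on_space)
  also have "\<dots> \<le> (LINT s|leb_on T. (norm \<iota>)\<^sup>2 * (norm (u s))\<^sup>2 + (U + Z))"
  proof (rule integral_mono_AE)
    have "{} \<in> null_sets lebesgue" by simp
    from AE_leb_on_not_in[OF this] trace_continuous_ae(2)[OF uz]
    show "AE s in leb_on T. (norm (trace_at \<iota> T t u))\<^sup>2 \<le> (norm \<iota>)\<^sup>2 * (norm (u s))\<^sup>2 + (U + Z)"
      unfolding ae_eq_def
    proof eventually_elim
      case (elim s)
      then have s: "s \<in> {0..T}" by simp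
      have "(norm (\<iota> (u s)))\<^sup>2 \<le> (norm \<iota>)\<^sup>2 * (norm (u s))\<^sup>2"
        by (simp add: power_mult_distrib[symmetric] norm_blinfun power_mono)
      then show ?case using trace_energy[OF uz s t] I_diff[OF s t] elim by simp
    qed
  qed (use u2 in auto)
  also have "\<dots> = (norm \<iota>)\<^sup>2 * U + T * (U + Z)"
    using u2 T by (simp add: U_def measure_leb_on_space)
  also have "\<dots> \<le> ((norm \<iota>)\<^sup>2 + T) * (U + Z)"
    using UZ by (simp add: distrib_left distrib_right)
  finally show ?thesis by (simp add: U_def Z_def)
qed

end

section \<open>The form and dual norms\<close>

lemma H_to_dual_apply [simp]: "blinfun_apply (H_to_dual \<iota> h) \<eta> = inner h (\<iota> \<eta>)"
  by (simp add: H_to_dual_def)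

lemma bounded_linear_H_to_dual: "bounded_linear (H_to_dual \<iota>)"
  unfolding H_to_dual_def
  by (rule bounded_linear_compose[OF bounded_bilinear.bounded_linear_left[OF bounded_bilinear_blinfun_compose]
        bounded_linear_blinfun_inner_right])

lemma Xspace_has_time_deriv:
  assumes "u \<in> Xspace \<iota> T"
  shows "has_time_deriv \<iota> T u (\<lambda>t. riesz (time_deriv \<iota> T u t))"
proof -
  have "\<exists>u'. u' \<in> L2 T \<and> weak_deriv T (\<lambda>t. H_to_dual \<iota> (\<iota> (u t))) u'"
    using assms by (auto simp: Xspace_def H1_dual_def)
  from someI_ex[OF this] have "time_deriv \<iota> T u \<in> L2 T" "weak_deriv T (\<lambda>t. H_to_dual \<iota> (\<iota> (u t))) (time_deriv \<iota> T u)"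
    unfolding time_deriv_def by auto
  then show ?thesis
    using assms L2_bounded_linear[OF bounded_linear_riesz]
    by (auto simp: has_time_deriv_def weak_deriv_def Xspace_def inner_riesz)
qed

lemma has_time_deriv_Xspace:
  assumes uz: "has_time_deriv \<iota> T u z"
  shows "u \<in> Xspace \<iota> T"
proof -
  note u = has_time_derivD(1)[OF uz] and z = has_time_derivD(2)[OF uz]
  have "(\<lambda>t. H_to_dual \<iota> (\<iota> (u t))) \<in> L2 T"
    using L2_bounded_linear[OF bounded_linear_H_to_dual L2_blinfun_apply[OF u]] .
  moreover have "(\<lambda>t. blinfun_inner_right (z t)) \<in> L2 T"
    using L2_bounded_linear[OF bounded_linear_blinfun_inner_right z] .
  moreover have "weak_deriv T (\<lambda>t. H_to_dual \<iota> (\<iota> (u t))) (\<lambda>t. blinfun_inner_right (z t))"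
    using uz by (auto simp: has_time_deriv_def weak_deriv_def)
  ultimately show ?thesis using u by (auto simp: Xspace_def H1_dual_def)
qed

section \<open>Linearity and uniqueness of the weak time derivative\<close>

lemma test_function_mult_integrable:
  assumes "test_function T \<phi>" "f \<in> L2 T"
  shows "integrable (leb_on T) (\<lambda>t. \<phi> t * f t)" "integrable (leb_on T) (\<lambda>t. deriv \<phi> t * f t)"
  using L2_mult_integrable[OF L2_continuous assms(2)] test_function_continuous[OF assms(1)] by auto

lemma has_time_deriv_combination:
  fixes \<iota> :: "'v::{real_inner, second_countable_topology} \<Rightarrow>\<^sub>L 'h::{real_inner, second_countable_topology}"
  assumes u: "has_time_deriv \<iota> T u y" and v: "has_time_deriv \<iota> T v z"
  shows "has_time_deriv \<iota> T (\<lambda>t. c *\<^sub>R u t + d *\<^sub>R v t) (\<lambda>t. c *\<^sub>R y t + d *\<^sub>R z t)"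
proof -
  note L = has_time_derivD[OF u] has_time_derivD[OF v]
  have in_L2: "(\<lambda>t. inner (f t) h) \<in> L2 T" if "f \<in> L2 T" for f :: "real \<Rightarrow> 'b::real_inner" and h
    using L2_bounded_linear[OF bounded_linear_inner_left that] .
  have i: "(\<lambda>t. inner (\<iota> (u t)) (\<iota> \<eta>)) \<in> L2 T" "(\<lambda>t. inner (\<iota> (v t)) (\<iota> \<eta>)) \<in> L2 T"
    "(\<lambda>t. inner (y t) \<eta>) \<in> L2 T" "(\<lambda>t. inner (z t) \<eta>) \<in> L2 T" for \<eta>
    using L by (auto intro!: in_L2 L2_blinfun_apply)
  show ?thesis
    unfolding has_time_deriv_def
  proof (intro conjI allI impI)
    fix \<phi> \<eta> assume \<phi>: "test_function T \<phi>"
    note int = test_function_mult_integrable[OF \<phi> i(1)] test_function_mult_integrable[OF \<phi> i(2)]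
      test_function_mult_integrable[OF \<phi> i(3)] test_function_mult_integrable[OF \<phi> i(4)]
    have "(LINT t|leb_on T. deriv \<phi> t * inner (\<iota> (c *\<^sub>R u t + d *\<^sub>R v t)) (\<iota> \<eta>))
      = (LINT t|leb_on T. c * (deriv \<phi> t * inner (\<iota> (u t)) (\<iota> \<eta>)) + d * (deriv \<phi> t * inner (\<iota> (v t)) (\<iota> \<eta>)))"
      by (simp add: blinfun.add_right blinfun.scaleR_right inner_simps algebra_simps)
    also have "\<dots> = c * (LINT t|leb_on T. deriv \<phi> t * inner (\<iota> (u t)) (\<iota> \<eta>)) + d * (LINT t|leb_on T. deriv \<phi> t * inner (\<iota> (v t)) (\<iota> \<eta>))"
      using int by simp
    also have "\<dots> = - (c * (LINT t|leb_on T. \<phi> t * inner (y t) \<eta>) + d * (LINT t|leb_on T. \<phi> t * inner (z t) \<eta>))"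
      using u v \<phi> by (simp add: has_time_deriv_def)
    also have "\<dots> = - (LINT t|leb_on T. c * (\<phi> t * inner (y t) \<eta>) + d * (\<phi> t * inner (z t) \<eta>))"
      using int by simp
    also have "\<dots> = - (LINT t|leb_on T. \<phi> t * inner (c *\<^sub>R y t + d *\<^sub>R z t) \<eta>)"
      by (simp add: inner_simps algebra_simps)
    finally show "(LINT t|leb_on T. deriv \<phi> t * inner (\<iota> (c *\<^sub>R u t + d *\<^sub>R v t)) (\<iota> \<eta>))
        = - (LINT t|leb_on T. \<phi> t * inner (c *\<^sub>R y t + d *\<^sub>R z t) \<eta>)" .
  qed (use L in \<open>auto intro: L2_add L2_scaleR\<close>)
qed

text \<open>The fundamental lemma of the calculus of variations: q is a weak derivative of 0, so its
  primitive is constant, and differentiation recovers q from the primitive almost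
  everywhere.\<close>

lemma zero_weak_derivative:
  assumes q: "integrable (leb_on T) q" and weak: "\<And>\<phi>. test_function T \<phi> \<Longrightarrow> (LINT t|leb_on T. \<phi> t * q t) = 0"
  shows "AE t in leb_on T. q t = 0"
proof (cases "T > 0")
  case False
  then show ?thesis by (auto intro!: AE_I2)
next
  case T: True
  obtain N where N: "N \<in> null_sets lebesgue" and zero: "\<And>s t. 0 < s \<Longrightarrow> s < t \<Longrightarrow> t < T \<Longrightarrow> s \<notin> N \<Longrightarrow> t \<notin> N \<Longrightarrow>
      0 = (LINT x|leb_on T. indicator {s<..t} x * q x)"
    using weak_derivative_imp_absolutely_continuous[of T "\<lambda>_. 0" q] q weak by auto
  obtain N' where N': "N' \<in> null_sets lebesgue" and diff: "\<And>s. s \<notin> N' \<Longrightarrow> 0 < s \<Longrightarrow> s < T \<Longrightarrow>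
      ((\<lambda>h. (LINT x|leb_on T. indicator {0<..<h} (x - s) * q x) / h) \<longlongrightarrow> q s) (at_right 0)"
    using Lebesgue_differentiation[OF q] by blast
  let ?Q = "primitive T q"
  have Qeq: "?Q t = ?Q s" if "s \<in> {0<..<T} - N" "t \<in> {0<..<T} - N" for s t
    using zero[of s t] zero[of t s] primitive_diff[OF q, of s t] primitive_diff[OF q, of t s] that
    by (cases s t rule: linorder_cases) auto
  have cl: "closure ({0<..<T} - N) = {0..T}"
    using good_set_dense[OF T N] by (intro antisym closure_minimal) auto
  then have "{0<..<T} - N \<noteq> {}" using T closure_empty by (metis atLeastatMost_empty_iff less_imp_le)
  then obtain s0 where s0: "s0 \<in> {0<..<T} - N" by blast
  have Qc: "?Q t = ?Q s0" if "t \<in> {0..T}" for t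
    by (rule continuous_constant_on_closure[of "{0<..<T} - N" ?Q])
       (use continuous_on_primitive[OF q] cl that Qeq[OF s0] in auto)
  have q0: "q s = 0" if s: "s \<notin> N'" "0 < s" "s < T" for s
  proof -
    have ev: "eventually (\<lambda>h. 0 = (LINT x|leb_on T. indicator {0<..<h} (x - s) * q x) / h) (at_right 0)"
    proof -
      have "eventually (\<lambda>h. h \<in> {0<..<T - s}) (at_right 0)" using s by (intro eventually_at_right_real) simp
      then show ?thesis
      proof eventually_elim
        case (elim h)
        have "(LINT x|leb_on T. indicator {0<..<h} (x - s) * q x) = (LINT x|leb_on T. indicator {s<..s + h} x * q x)"
        proof (rule integral_cong_AE)
          have "{s + h} \<in> null_sets lebesgue" by (simp add: negligible_iff_null_sets[symmetric])
          from AE_leb_on_not_in[OF this]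
          show "AE x in leb_on T. indicator {0<..<h} (x - s) * q x = indicator {s<..s + h} x * q x"
            by eventually_elim (auto simp: indicator_def)
        qed (use integrable_indicator_shift[OF q] integrable_indicator_mult[OF q] in auto)
        also have "\<dots> = ?Q (s + h) - ?Q s" using primitive_diff[OF q, of s "s + h"] s elim by simp
        also have "\<dots> = 0" using Qc[of s] Qc[of "s + h"] s elim by simp
        finally show ?case by simp
      qed
    qed
    have "((\<lambda>h. (LINT x|leb_on T. indicator {0<..<h} (x - s) * q x) / h) \<longlongrightarrow> 0) (at_right 0)"
      by (rule Lim_transform_eventually[OF tendsto_const ev])
    with diff[OF s] show ?thesis using tendsto_unique[OF trivial_limit_at_right_real] by blast
  qed
  from AE_leb_on_not_in[OF N'] show ?thesis by eventually_elim (use q0 in auto)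
qed

text \<open>Again a countable dense set of \<eta> reduces to scalar functions with one null set.
  This frees \<open>dt_op\<close> from the choice made in \<open>time_deriv\<close>.\<close>

lemma has_time_deriv_unique:
  fixes \<iota> :: "'v::{real_inner, banach, second_countable_topology} \<Rightarrow>\<^sub>L 'h::{real_inner, banach, second_countable_topology}"
  assumes u: "has_time_deriv \<iota> T u y" and v: "has_time_deriv \<iota> T u z"
  shows "AE t in leb_on T. y t = z t"
proof -
  note L = has_time_derivD[OF u] has_time_derivD[OF v]
  obtain D :: "'v set" where D: "countable D" "UNIV \<subseteq> closure D"
    using separable[of "UNIV :: 'v set"] by metis
  have "has_time_deriv \<iota> T (\<lambda>t. 1 *\<^sub>R u t + (-1) *\<^sub>R u t) (\<lambda>t. 1 *\<^sub>R y t + (-1) *\<^sub>R z t)"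
    by (rule has_time_deriv_combination[OF u v])
  then have d: "(LINT t|leb_on T. \<phi> t * inner (y t - z t) \<eta>) = 0" if "test_function T \<phi>" for \<phi> \<eta>
    using that by (simp add: has_time_deriv_def)
  have "AE t in leb_on T. inner (y t - z t) \<eta> = 0" for \<eta>
    by (rule zero_weak_derivative) (use d L2_inner_integrable[OF L2_diff[OF L(2,4)] L2_const] in auto)
  then have "AE t in leb_on T. \<forall>\<eta>\<in>D. inner (y t - z t) \<eta> = 0"
    using D(1) by (subst AE_ball_countable) auto
  then show ?thesis
  proof eventually_elim
    case (elim t)
    have "closed {\<eta>. inner (y t - z t) \<eta> = 0}" by (intro closed_Collect_eq continuous_intros)
    with elim D(2) have "UNIV \<subseteq> {\<eta>. inner (y t - z t) \<eta> = 0}"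
      by (intro order_trans[OF D(2)] closure_minimal) auto
    then have "inner (y t - z t) (y t - z t) = 0" by blast
    then show ?case by simp
  qed
qed

lemma dt_op_eq:
  fixes \<iota> :: "'v::{real_inner, banach, second_countable_topology} \<Rightarrow>\<^sub>L 'h::{real_inner, banach, second_countable_topology}"
  assumes uz: "has_time_deriv \<iota> T u z" and v: "v \<in> L2 T"
  shows "dt_op \<iota> T u v = (LINT t|leb_on T. inner (z t) (v t))"
proof -
  have u': "has_time_deriv \<iota> T u (\<lambda>t. riesz (time_deriv \<iota> T u t))"
    by (rule Xspace_has_time_deriv[OF has_time_deriv_Xspace[OF uz]])
  have "dt_op \<iota> T u v = (LINT t|leb_on T. inner (riesz (time_deriv \<iota> T u t)) (v t))"
    by (simp add: dt_op_def inner_riesz)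
  also have "\<dots> = (LINT t|leb_on T. inner (z t) (v t))"
  proof (rule integral_cong_AE)
    show "AE t in leb_on T. inner (riesz (time_deriv \<iota> T u t)) (v t) = inner (z t) (v t)"
      using has_time_deriv_unique[OF u' uz] by eventually_elim simp
  qed (use L2_inner_integrable[OF _ v] has_time_derivD[OF u'] has_time_derivD[OF uz] in auto)
  finally show ?thesis .
qed

section \<open>The bilinear form and the energy norm of Y\<close>

locale parabolic =
  fixes \<iota> :: "'v::{real_inner, banach, second_countable_topology} \<Rightarrow>\<^sub>L 'h::{real_inner, banach, second_countable_topology}"
    and T :: real and a :: "real \<Rightarrow> 'v \<Rightarrow> 'v \<Rightarrow> real"
  assumes T_pos: "T > 0"
    and form_bilinear: "AE t in leb_on T. bilinear (a t)"
    and form_measurable: "\<And>\<eta> \<zeta>. (\<lambda>t. a t \<eta> \<zeta>) \<in> borel_measurable (leb_on T)"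
    and form_bounded: "\<exists>M. AE t in leb_on T. \<forall>\<eta> \<zeta>. \<bar>a t \<eta> \<zeta>\<bar> \<le> M * norm \<eta> * norm \<zeta>"
    and form_coercive: "\<exists>m>0. AE t in leb_on T. \<forall>\<eta>. a t \<eta> \<eta> \<ge> m * (norm \<eta>)\<^sup>2"
begin

lemma form_bounded_bilinear: "AE t in leb_on T. bounded_bilinear (a t)"
proof -
  obtain M where "AE t in leb_on T. \<forall>\<eta> \<zeta>. \<bar>a t \<eta> \<zeta>\<bar> \<le> M * norm \<eta> * norm \<zeta>" using form_bounded by blast
  with form_bilinear show ?thesis
  proof eventually_elim
    case (elim t)
    show ?case
    proof
      show "\<exists>K. \<forall>x y. norm (a t x y) \<le> norm x * norm y * K"
        using elim(2) by (intro exI[of _ M]) (simp add: mult_ac)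
    qed (use elim(1) in \<open>simp_all add: bilinear_ladd bilinear_radd bilinear_lmul bilinear_rmul\<close>)
  qed
qed

text \<open>Measurability is given for fixed arguments, hence for simple functions by splitting
  according to their values. Continuity of \<open>a t\<close>, valid off a null set, carries it to
  the limit.\<close>

lemma form_apply_measurable:
  assumes w: "w \<in> borel_measurable (leb_on T)" and v: "v \<in> borel_measurable (leb_on T)"
  shows "(\<lambda>t. a t (w t) (v t)) \<in> borel_measurable (leb_on T)"
proof -
  let ?M = "leb_on T"
  obtain N where N: "N \<in> null_sets ?M" "{t \<in> space ?M. \<not> bounded_bilinear (a t)} \<subseteq> N"
    using form_bounded_bilinear by (auto simp: eventually_ae_filter)
  have N_meas: "N \<in> sets ?M" using N by blast
  obtain F where F: "\<And>i. simple_function ?M (F i)" "\<And>x. x \<in> space ?M \<Longrightarrow> (\<lambda>i. F i x) \<longlonglongrightarrow> w x"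
    using borel_measurable_implies_sequence_metric[OF w, of 0] by blast
  obtain G where G: "\<And>i. simple_function ?M (G i)" "\<And>x. x \<in> space ?M \<Longrightarrow> (\<lambda>i. G i x) \<longlonglongrightarrow> v x"
    using borel_measurable_implies_sequence_metric[OF v, of 0] by blast
  have simple: "(\<lambda>t. a t (f t) (g t)) \<in> borel_measurable ?M" if f: "simple_function ?M f" and g: "simple_function ?M g" for f g
  proof -
    have s: "f \<in> measurable ?M (count_space (f ` space ?M))" if f: "simple_function ?M f" for f :: "real \<Rightarrow> 'v"
      using simple_functionD[OF f] by (subst measurable_count_space_eq2) auto
    show ?thesis
      by (rule measurable_compose_countable'[OF _ s[OF f]], rule measurable_compose_countable'[OF _ s[OF g]])
         (use form_measurable simple_functionD[OF f] simple_functionD[OF g] in \<open>auto intro: countable_finite\<close>)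
  qed
  have lim: "(\<lambda>i. if t \<in> N then 0 else a t (F i t) (G i t)) \<longlonglongrightarrow> (if t \<in> N then 0 else a t (w t) (v t))" if "t \<in> space ?M" for t
  proof (cases "t \<in> N")
    case False
    with N that have "bounded_bilinear (a t)" by blast
    from bounded_bilinear.tendsto[OF this F(2)[OF that] G(2)[OF that]] False show ?thesis by simp
  qed simp
  have "(\<lambda>t. if t \<in> N then 0 else a t (w t) (v t)) \<in> borel_measurable ?M"
  proof (rule borel_measurable_LIMSEQ_real[OF lim])
    show "(\<lambda>t. if t \<in> N then 0 else a t (F i t) (G i t)) \<in> borel_measurable ?M" for i
      using simple[OF F(1) G(1)] N_meas by (intro measurable_If_set) auto
  qed
  moreover have "AE t in ?M. (if t \<in> N then 0 else a t (w t) (v t)) = a t (w t) (v t)"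
    using AE_not_in[OF N(1)] by eventually_elim simp
  ultimately show ?thesis by (rule complete_measure.borel_measurable_cong_AE[OF complete_measure_leb_on])
qed

lemma form_integrable:
  assumes w: "w \<in> L2 T" and v: "v \<in> L2 T"
  shows "integrable (leb_on T) (\<lambda>t. a t (w t) (v t))"
proof -
  obtain M where M: "AE t in leb_on T. \<forall>\<eta> \<zeta>. \<bar>a t \<eta> \<zeta>\<bar> \<le> M * norm \<eta> * norm \<zeta>" using form_bounded by blast
  show ?thesis
  proof (rule Bochner_Integration.integrable_bound)
    show "integrable (leb_on T) (\<lambda>t. M * (norm (w t) * norm (v t)))" using L2_norm_mult_integrable[OF w v] by simp
    show "AE t in leb_on T. norm (a t (w t) (v t)) \<le> norm (M * (norm (w t) * norm (v t)))"
      using M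
    proof eventually_elim
      case (elim t)
      then have "\<bar>a t (w t) (v t)\<bar> \<le> M * norm (w t) * norm (v t)" by blast
      then show ?case by (simp add: mult.assoc abs_le_D1)
    qed
  qed (rule form_apply_measurable[OF L2_measurable[OF w] L2_measurable[OF v]])
qed

lemma A_op_add_left:
  assumes "w \<in> L2 T" "x \<in> L2 T" "v \<in> L2 T"
  shows "A_op T a (\<lambda>t. w t + x t) v = A_op T a w v + A_op T a x v"
proof -
  have "A_op T a (\<lambda>t. w t + x t) v = (LINT t|leb_on T. a t (w t) (v t) + a t (x t) (v t))"
    unfolding A_op_def
  proof (rule integral_cong_AE)
    show "AE t in leb_on T. a t (w t + x t) (v t) = a t (w t) (v t) + a t (x t) (v t)"
      using form_bilinear by eventually_elim (simp add: bilinear_ladd)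
  qed (use form_integrable[OF L2_add[OF assms(1,2)] assms(3)] form_integrable assms in auto)
  also have "\<dots> = A_op T a w v + A_op T a x v" unfolding A_op_def using form_integrable assms by simp
  finally show ?thesis .
qed

lemma A_op_add_right:
  assumes "w \<in> L2 T" "x \<in> L2 T" "v \<in> L2 T"
  shows "A_op T a v (\<lambda>t. w t + x t) = A_op T a v w + A_op T a v x"
proof -
  have "A_op T a v (\<lambda>t. w t + x t) = (LINT t|leb_on T. a t (v t) (w t) + a t (v t) (x t))"
    unfolding A_op_def
  proof (rule integral_cong_AE)
    show "AE t in leb_on T. a t (v t) (w t + x t) = a t (v t) (w t) + a t (v t) (x t)"
      using form_bilinear by eventually_elim (simp add: bilinear_radd)
  qed (use form_integrable[OF assms(3) L2_add[OF assms(1,2)]] form_integrable assms in auto)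
  also have "\<dots> = A_op T a v w + A_op T a v x" unfolding A_op_def using form_integrable assms by simp
  finally show ?thesis .
qed

lemma A_op_scale:
  assumes "w \<in> L2 T" "v \<in> L2 T"
  shows "A_op T a (\<lambda>t. c *\<^sub>R w t) v = c * A_op T a w v" "A_op T a v (\<lambda>t. c *\<^sub>R w t) = c * A_op T a v w"
proof -
  have "A_op T a (\<lambda>t. c *\<^sub>R w t) v = (LINT t|leb_on T. c * a t (w t) (v t))"
    unfolding A_op_def
  proof (rule integral_cong_AE)
    show "AE t in leb_on T. a t (c *\<^sub>R w t) (v t) = c * a t (w t) (v t)"
      using form_bilinear by eventually_elim (simp add: bilinear_lmul)
  qed (use form_integrable[OF L2_scaleR[OF assms(1)] assms(2)] form_integrable[OF assms] in auto)
  then show "A_op T a (\<lambda>t. c *\<^sub>R w t) v = c * A_op T a w v" by (simp add: A_op_def)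
  have "A_op T a v (\<lambda>t. c *\<^sub>R w t) = (LINT t|leb_on T. c * a t (v t) (w t))"
    unfolding A_op_def
  proof (rule integral_cong_AE)
    show "AE t in leb_on T. a t (v t) (c *\<^sub>R w t) = c * a t (v t) (w t)"
      using form_bilinear by eventually_elim (simp add: bilinear_rmul)
  qed (use form_integrable[OF assms(2) L2_scaleR[OF assms(1)]] form_integrable[OF assms(2,1)] in auto)
  then show "A_op T a v (\<lambda>t. c *\<^sub>R w t) = c * A_op T a v w" by (simp add: A_op_def)
qed

lemma A_op_bounded:
  "\<exists>M\<ge>0. \<forall>w\<in>L2 T. \<forall>v\<in>L2 T. \<bar>A_op T a w v\<bar>
    \<le> M * (sqrt (sqint T w) * sqrt (sqint T v))"
proof -
  obtain M where M: "AE t in leb_on T. \<forall>\<eta> \<zeta>. \<bar>a t \<eta> \<zeta>\<bar> \<le> M * norm \<eta> * norm \<zeta>" using form_bounded by blast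
  have "\<bar>A_op T a w v\<bar> \<le> \<bar>M\<bar> * (sqrt (sqint T w) * sqrt (sqint T v))"
    if w: "w \<in> L2 T" and v: "v \<in> L2 T" for w v
  proof -
    have "\<bar>A_op T a w v\<bar> \<le> (LINT t|leb_on T. \<bar>a t (w t) (v t)\<bar>)" unfolding A_op_def by (rule integral_abs_bound)
    also have "\<dots> \<le> (LINT t|leb_on T. \<bar>M\<bar> * (norm (w t) * norm (v t)))"
    proof (rule integral_mono_AE)
      show "AE t in leb_on T. \<bar>a t (w t) (v t)\<bar> \<le> \<bar>M\<bar> * (norm (w t) * norm (v t))"
        using M
      proof eventually_elim
        case (elim t)
        then have "\<bar>a t (w t) (v t)\<bar> \<le> M * (norm (w t) * norm (v t))" by (simp add: mult.assoc)
        also have "\<dots> \<le> \<bar>M\<bar> * (norm (w t) * norm (v t))" by (intro mult_right_mono) auto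
        finally show ?case .
      qed
    qed (use form_integrable[OF w v] L2_norm_mult_integrable[OF w v] in auto)
    also have "\<dots> \<le> \<bar>M\<bar> * (sqrt (sqint T w) * sqrt (sqint T v))"
      using L2_norm_mult_le_sqrt[OF w v] by (simp add: mult_left_mono)
    finally show ?thesis .
  qed
  then show ?thesis by (intro exI[of _ "\<bar>M\<bar>"]) auto
qed

lemma A_op_coercive: "\<exists>m>0. \<forall>w\<in>L2 T. m * (sqint T w) \<le> A_op T a w w"
proof -
  obtain m where m: "m > 0" "AE t in leb_on T. \<forall>\<eta>. a t \<eta> \<eta> \<ge> m * (norm \<eta>)\<^sup>2" using form_coercive by blast
  have "m * (sqint T w) \<le> A_op T a w w" if w: "w \<in> L2 T" for w
  proof -
    have "m * (sqint T w) = (LINT t|leb_on T. m * (norm (w t))\<^sup>2)" by simp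
    also have "\<dots> \<le> A_op T a w w" unfolding A_op_def
      by (rule integral_mono_AE) (use m(2) form_integrable[OF w w] L2_square_integrable[OF w] in \<open>auto elim: eventually_mono\<close>)
    finally show ?thesis .
  qed
  with m(1) show ?thesis by blast
qed

sublocale Y: semi_inner_product "L2 T" "\<lambda>v w t. v t + w t" "\<lambda>c v t. c *\<^sub>R v t" "As_op T a"
proof
  fix x :: "real \<Rightarrow> 'v" assume x: "x \<in> L2 T"
  obtain m where m: "m > 0" "\<forall>w\<in>L2 T. m * (sqint T w) \<le> A_op T a w w" using A_op_coercive by blast
  have "0 \<le> m * (sqint T x)" using m(1) by simp
  also have "\<dots> \<le> As_op T a x x" using m(2) x by (simp add: As_op_def)
  finally show "0 \<le> As_op T a x x" .
qed (auto simp: As_op_def L2_add L2_scaleR A_op_add_left A_op_add_right A_op_scale field_simps)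

abbreviation nY :: "(real \<Rightarrow> 'v) \<Rightarrow> real" where "nY \<equiv> Ynorm T a"

lemma Ynorm_power2: "v \<in> L2 T \<Longrightarrow> (nY v)\<^sup>2 = As_op T a v v"
  by (simp add: Ynorm_def Y.form_nonneg)

lemma Ynorm_nonneg: "v \<in> L2 T \<Longrightarrow> 0 \<le> nY v"
  by (simp add: Ynorm_def Y.form_nonneg)

lemma As_op_le: "v \<in> L2 T \<Longrightarrow> w \<in> L2 T \<Longrightarrow> \<bar>As_op T a v w\<bar> \<le> nY v * nY w"
  using Y.form_le_sqrt[of v w] by (simp add: Ynorm_def)

lemma Ynorm_scale: "v \<in> L2 T \<Longrightarrow> nY (\<lambda>t. c *\<^sub>R v t) = \<bar>c\<bar> * nY v"
  unfolding Ynorm_def by (simp add: Y.form_simps real_sqrt_mult)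

lemma Ynorm_zero [simp]: "nY (\<lambda>t. 0) = 0"
  using Ynorm_scale[of "\<lambda>t. 0" 0] by simp

lemma Ynorm_diff: "v \<in> L2 T \<Longrightarrow> w \<in> L2 T \<Longrightarrow> (nY (\<lambda>t. v t - w t))\<^sup>2 = As_op T a v v - 2 * As_op T a v w + As_op T a w w"
  using Y.form_sub[of v w] Ynorm_power2[of "\<lambda>t. v t - w t"] by (simp add: L2_diff)

lemma Ynorm_equiv:
  obtains k M where "k > 0" "M > 0" "\<And>v. v \<in> L2 T \<Longrightarrow> sqrt (sqint T v) \<le> k * nY v"
    "\<And>v. v \<in> L2 T \<Longrightarrow> nY v \<le> M * sqrt (sqint T v)"
    "\<And>v. v \<in> L2 T \<Longrightarrow> (nY v)\<^sup>2 \<le> M\<^sup>2 * (sqint T v)"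
    "\<And>v. v \<in> L2 T \<Longrightarrow> (sqint T v) \<le> k\<^sup>2 * (nY v)\<^sup>2"
proof -
  obtain m where m: "m > 0" "\<forall>w\<in>L2 T. m * (sqint T w) \<le> A_op T a w w" using A_op_coercive by blast
  obtain M where M: "M \<ge> 0" "\<forall>w\<in>L2 T. \<forall>v\<in>L2 T. \<bar>A_op T a w v\<bar>
    \<le> M * (sqrt (sqint T w) * sqrt (sqint T v))" using A_op_bounded by blast
  define k where "k = sqrt (1 / m)"
  \<comment> \<open>The added 1 keeps the constant positive in case M = 0.\<close>
  define M' where "M' = sqrt (M + 1)"
  have k2: "(sqint T v) \<le> k\<^sup>2 * (nY v)\<^sup>2" if v: "v \<in> L2 T" for v
    using m v Ynorm_power2[OF v] by (simp add: k_def As_op_def field_simps)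
  have M2: "(nY v)\<^sup>2 \<le> M'\<^sup>2 * (sqint T v)" if v: "v \<in> L2 T" for v
  proof -
    have "A_op T a v v \<le> M * (sqint T v)"
      using M(2)[rule_format, OF v v] by simp
    also have "\<dots> \<le> (M + 1) * (sqint T v)" by (intro mult_right_mono) auto
    finally show ?thesis using Ynorm_power2[OF v] M(1) by (simp add: M'_def As_op_def)
  qed
  show thesis
  proof (rule that)
    show "k > 0" "M' > 0" using m M by (auto simp: k_def M'_def)
    show "sqrt (sqint T v) \<le> k * nY v" if v: "v \<in> L2 T" for v
      using k2[OF v] \<open>k > 0\<close> Ynorm_nonneg[OF v] by (intro real_le_lsqrt) (auto simp: power_mult_distrib)
    show "nY v \<le> M' * sqrt (sqint T v)" if v: "v \<in> L2 T" for v
    proof (rule power2_le_imp_le)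
      show "(nY v)\<^sup>2 \<le> (M' * sqrt (sqint T v))\<^sup>2"
        using M2[OF v] by (simp add: power_mult_distrib)
    qed (use \<open>M' > 0\<close> in simp)
  qed (use k2 M2 in auto)
qed

lemma Ynorm_eq_0_iff:
  assumes v: "v \<in> L2 T" and w: "w \<in> L2 T"
  shows "nY (\<lambda>t. v t - w t) = 0 \<longleftrightarrow> ae_eq T v w"
proof -
  obtain k M where kM: "k > 0" "M > 0" "\<And>v. v \<in> L2 T \<Longrightarrow> (nY v)\<^sup>2 \<le> M\<^sup>2 * (sqint T v)"
    "\<And>v. v \<in> L2 T \<Longrightarrow> (sqint T v) \<le> k\<^sup>2 * (nY v)\<^sup>2"
    using Ynorm_equiv by metis
  note d = L2_diff[OF v w]
  have "nY (\<lambda>t. v t - w t) = 0 \<longleftrightarrow> (sqint T (\<lambda>t. v t - w t)) = 0"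
  proof
    assume "nY (\<lambda>t. v t - w t) = 0"
    with kM(4)[OF d] have "(sqint T (\<lambda>t. v t - w t)) \<le> 0" by simp
    moreover have "0 \<le> (sqint T (\<lambda>t. v t - w t))" by simp
    ultimately show "(sqint T (\<lambda>t. v t - w t)) = 0" by linarith
  next
    assume "(sqint T (\<lambda>t. v t - w t)) = 0"
    with kM(3)[OF d] show "nY (\<lambda>t. v t - w t) = 0" by simp
  qed
  also have "\<dots> \<longleftrightarrow> (AE t in leb_on T. (norm (v t - w t))\<^sup>2 = 0)"
    by (rule integral_nonneg_eq_0_iff_AE) (use L2_square_integrable[OF d] in auto)
  finally show ?thesis by (simp add: ae_eq_def)
qed

section \<open>Dual norms on subspaces of Y\<close>

definition subspace_Y :: "(real \<Rightarrow> 'v) set \<Rightarrow> bool" where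
  "subspace_Y S \<longleftrightarrow> S \<subseteq> L2 T \<and> (\<lambda>t. 0) \<in> S \<and> (\<forall>v\<in>S. \<forall>w\<in>S. (\<lambda>t. v t + w t) \<in> S) \<and> (\<forall>c. \<forall>v\<in>S. (\<lambda>t. c *\<^sub>R v t) \<in> S)"

lemma subspace_Y_L2 [simp]: "subspace_Y (L2 T)"
  by (auto simp: subspace_Y_def L2_add L2_scaleR)

lemma closed_subspace_imp_subspace_Y: "closed_subspace_in nY (Yspace T) S \<Longrightarrow> subspace_Y S"
  by (auto simp: closed_subspace_in_def subspace_Y_def Yspace_def)

context
  fixes S :: "(real \<Rightarrow> 'v) set"
  assumes S: "subspace_Y S"
begin

lemma subspace_YD:
  "v \<in> S \<Longrightarrow> v \<in> L2 T" "(\<lambda>t. 0) \<in> S" "v \<in> S \<Longrightarrow> w \<in> S \<Longrightarrow> (\<lambda>t. v t + w t) \<in> S" "v \<in> S \<Longrightarrow> (\<lambda>t. c *\<^sub>R v t) \<in> S"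
  using S by (auto simp: subspace_Y_def)

lemma subspace_Y_diff: "v \<in> S \<Longrightarrow> w \<in> S \<Longrightarrow> (\<lambda>t. v t - w t) \<in> S"
  using subspace_YD(3)[OF _ subspace_YD(4)[of w "-1"], of v] by simp

lemma dual_spaceD:
  assumes "f \<in> dual_space T a S"
  shows "v \<in> S \<Longrightarrow> w \<in> S \<Longrightarrow> f (\<lambda>t. v t + w t) = f v + f w" "v \<in> S \<Longrightarrow> f (\<lambda>t. c *\<^sub>R v t) = c * f v"
    "\<exists>C. \<forall>v\<in>S. \<bar>f v\<bar> \<le> C * nY v"
  using assms by (auto simp: dual_space_def)

lemma dual_space_diff:
  assumes "f \<in> dual_space T a S" "v \<in> S" "w \<in> S"
  shows "f (\<lambda>t. v t - w t) = f v - f w"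
  using dual_spaceD(1)[OF assms(1,2) subspace_YD(4)[OF assms(3)], of "-1"] dual_spaceD(2)[OF assms(1,3), of "-1"] by simp

lemma dual_norm_bdd: "f \<in> dual_space T a S \<Longrightarrow> bdd_above ((\<lambda>v. \<bar>f v\<bar>) ` {v\<in>S. nY v \<le> 1})"
proof -
  assume "f \<in> dual_space T a S"
  then obtain C where C: "\<forall>v\<in>S. \<bar>f v\<bar> \<le> C * nY v" using dual_spaceD(3) by blast
  have "\<bar>f v\<bar> \<le> \<bar>C\<bar>" if "v \<in> S" "nY v \<le> 1" for v
  proof -
    have "\<bar>f v\<bar> \<le> C * nY v" using C that by blast
    also have "\<dots> \<le> \<bar>C\<bar> * nY v" using Ynorm_nonneg[OF subspace_YD(1)] that by (intro mult_right_mono) auto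
    also have "\<dots> \<le> \<bar>C\<bar> * 1" using that by (intro mult_left_mono) auto
    finally show ?thesis by simp
  qed
  then show ?thesis by (intro bdd_aboveI[of _ "\<bar>C\<bar>"]) auto
qed

lemma dual_norm_nonneg:
  assumes "f \<in> dual_space T a S" shows "0 \<le> dual_norm T a S f"
proof -
  have "\<bar>f (\<lambda>t. 0)\<bar> \<le> dual_norm T a S f"
    unfolding dual_norm_def using subspace_YD(2) by (intro cSUP_upper dual_norm_bdd assms) auto
  then show ?thesis by linarith
qed

lemma dual_norm_ge:
  assumes f: "f \<in> dual_space T a S" and v: "v \<in> S"
  shows "\<bar>f v\<bar> \<le> dual_norm T a S f * nY v"
proof (cases "nY v = 0")
  case True
  obtain C where "\<forall>v\<in>S. \<bar>f v\<bar> \<le> C * nY v" using dual_spaceD(3)[OF f] by blast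
  with v have "\<bar>f v\<bar> \<le> C * nY v" by blast
  with True show ?thesis by simp
next
  case False
  then have pos: "nY v > 0" using Ynorm_nonneg[OF subspace_YD(1)[OF v]] by simp
  have "nY (\<lambda>t. (1 / nY v) *\<^sub>R v t) = 1" using Ynorm_scale[OF subspace_YD(1)[OF v], of "1 / nY v"] pos by simp
  then have "\<bar>f (\<lambda>t. (1 / nY v) *\<^sub>R v t)\<bar> \<le> dual_norm T a S f"
    unfolding dual_norm_def using subspace_YD(4)[OF v] by (intro cSUP_upper dual_norm_bdd f) auto
  moreover have "\<bar>f (\<lambda>t. (1 / nY v) *\<^sub>R v t)\<bar> = \<bar>f v\<bar> / nY v"
    using dual_spaceD(2)[OF f v, of "1 / nY v"] pos by (simp add: abs_mult)
  ultimately show ?thesis using pos by (simp add: pos_divide_le_eq)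
qed

lemma dual_norm_le:
  assumes c: "c \<ge> 0" and le: "\<And>v. v \<in> S \<Longrightarrow> \<bar>f v\<bar> \<le> c * nY v"
  shows "dual_norm T a S f \<le> c"
  unfolding dual_norm_def
proof (rule cSUP_least)
  show "{v \<in> S. nY v \<le> 1} \<noteq> {}" using subspace_YD(2) by force
  fix v assume v: "v \<in> {v \<in> S. nY v \<le> 1}"
  then have "\<bar>f v\<bar> \<le> c * nY v" using le by blast
  also have "\<dots> \<le> c * 1" using v c by (intro mult_left_mono) auto
  finally show "\<bar>f v\<bar> \<le> c" by simp
qed

text \<open>\<open>\<parallel>f\<parallel>\<^sup>2\<close> is the supremum of \<open>2 f(v) - \<parallel>v\<parallel>\<^sup>2\<close>, which turns the shift below into a substitution.\<close>

lemma dual_norm_power2_ge: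
  assumes f: "f \<in> dual_space T a S" and v: "v \<in> S"
  shows "2 * f v - (nY v)\<^sup>2 \<le> (dual_norm T a S f)\<^sup>2"
  using dual_norm_ge[OF f v] zero_le_power2[of "dual_norm T a S f - nY v"] unfolding power2_diff by linarith

text \<open>Inserting the multiples -t v turns the assumed bound into a nonnegative quadratic in t,
  whose discriminant gives \<open>(f v)\<^sup>2 \<le> c * (nY v)\<^sup>2\<close>.\<close>

lemma dual_norm_power2_le:
  assumes f: "f \<in> dual_space T a S" and le: "\<And>v. v \<in> S \<Longrightarrow> 2 * f v - (nY v)\<^sup>2 \<le> c"
  shows "(dual_norm T a S f)\<^sup>2 \<le> c"
proof -
  have f0: "f (\<lambda>t. 0) = 0" using dual_spaceD(2)[OF f subspace_YD(2), of 0] by simp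
  have c: "0 \<le> c" using le[OF subspace_YD(2)] f0 by simp
  have "dual_norm T a S f \<le> sqrt c"
  proof (rule dual_norm_le)
    fix v assume v: "v \<in> S"
    have v2: "v \<in> L2 T" by (rule subspace_YD(1)[OF v])
    have "(f v)\<^sup>2 \<le> c * (nY v)\<^sup>2"
    proof (rule quadratic_nonneg_imp_Cauchy_Schwarz)
      fix t :: real
      have "2 * f (\<lambda>s. (- t) *\<^sub>R v s) - (nY (\<lambda>s. (- t) *\<^sub>R v s))\<^sup>2 \<le> c"
        by (rule le) (rule subspace_YD(4)[OF v])
      then show "0 \<le> c + 2 * f v * t + (nY v)\<^sup>2 * t\<^sup>2"
        unfolding dual_spaceD(2)[OF f v] Ynorm_scale[OF v2] power_mult_distrib by (simp add: algebra_simps)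
    qed
    then have "\<bar>f v\<bar> \<le> sqrt (c * (nY v)\<^sup>2)" by (simp add: real_le_rsqrt)
    then show "\<bar>f v\<bar> \<le> sqrt c * nY v" using Ynorm_nonneg[OF v2] by (simp add: real_sqrt_mult)
  qed (use c in simp)
  then have "(dual_norm T a S f)\<^sup>2 \<le> (sqrt c)\<^sup>2" by (rule power_mono) (rule dual_norm_nonneg[OF f])
  then show ?thesis using c by simp
qed

lemma dual_space_combination:
  assumes f: "f \<in> dual_space T a S" and h: "h \<in> dual_space T a S"
  shows "(\<lambda>v. c * f v + d * h v) \<in> dual_space T a S"
proof -
  have "\<bar>c * f v + d * h v\<bar> \<le> (\<bar>c\<bar> * dual_norm T a S f + \<bar>d\<bar> * dual_norm T a S h) * nY v" if v: "v \<in> S" for v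
  proof -
    have "\<bar>c * f v + d * h v\<bar> \<le> \<bar>c\<bar> * \<bar>f v\<bar> + \<bar>d\<bar> * \<bar>h v\<bar>" by (metis abs_mult abs_triangle_ineq)
    also have "\<dots> \<le> \<bar>c\<bar> * (dual_norm T a S f * nY v) + \<bar>d\<bar> * (dual_norm T a S h * nY v)"
      by (intro add_mono mult_left_mono dual_norm_ge f h v) auto
    finally show ?thesis by (simp add: algebra_simps)
  qed
  then have "\<exists>C. \<forall>v\<in>S. \<bar>c * f v + d * h v\<bar> \<le> C * nY v" by blast
  then show ?thesis unfolding dual_space_def
    using dual_spaceD(1,2)[OF f] dual_spaceD(1,2)[OF h] by (simp add: algebra_simps)
qed

lemma dual_space_add: "f \<in> dual_space T a S \<Longrightarrow> h \<in> dual_space T a S \<Longrightarrow> (\<lambda>v. f v + h v) \<in> dual_space T a S"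
  using dual_space_combination[of f h 1 1] by simp

lemma dual_space_scale: "f \<in> dual_space T a S \<Longrightarrow> (\<lambda>v. c * f v) \<in> dual_space T a S"
  using dual_space_combination[of f f c 0] by simp

lemma dual_space_As_op:
  assumes "w \<in> L2 T" shows "As_op T a w \<in> dual_space T a S"
proof -
  have "\<forall>v\<in>S. \<bar>As_op T a w v\<bar> \<le> nY w * nY v" using As_op_le assms subspace_YD(1) by blast
  then show ?thesis unfolding dual_space_def using assms subspace_YD by (auto simp: Y.form_simps)
qed

text \<open>In the variational formula for the squared dual norm, replacing v by v - w completes the
  square. The substitution maps S onto itself because w lies in S; in the lower bound this is where
  the inclusion of \<open>X\<^sup>\<delta>\<close> in \<open>Y\<^sup>\<delta>\<close>
  enters.\<close>

lemma dual_norm_shift: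
  assumes f: "f \<in> dual_space T a S" and w: "w \<in> S"
  shows "(dual_norm T a S (\<lambda>v. f v + As_op T a w v))\<^sup>2 = (dual_norm T a S f)\<^sup>2 + 2 * f w + (nY w)\<^sup>2"
proof (rule antisym)
  have w2: "w \<in> L2 T" using subspace_YD(1)[OF w] .
  have fw: "(\<lambda>v. f v + As_op T a w v) \<in> dual_space T a S"
    by (intro dual_space_add f dual_space_As_op w2)
  show "(dual_norm T a S (\<lambda>v. f v + As_op T a w v))\<^sup>2 \<le> (dual_norm T a S f)\<^sup>2 + 2 * f w + (nY w)\<^sup>2"
  proof (rule dual_norm_power2_le[OF fw])
    fix v assume v: "v \<in> S"
    have v2: "v \<in> L2 T" using subspace_YD(1)[OF v] .
    show "2 * (f v + As_op T a w v) - (nY v)\<^sup>2 \<le> (dual_norm T a S f)\<^sup>2 + 2 * f w + (nY w)\<^sup>2"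
      using dual_norm_power2_ge[OF f subspace_Y_diff[OF v w]] dual_space_diff[OF f v w]
        Ynorm_diff[OF v2 w2] Ynorm_power2[OF v2] Ynorm_power2[OF w2] Y.form_sym[OF v2 w2] by simp
  qed
  have "(dual_norm T a S f)\<^sup>2 \<le> (dual_norm T a S (\<lambda>v. f v + As_op T a w v))\<^sup>2 - 2 * f w - (nY w)\<^sup>2"
  proof (rule dual_norm_power2_le[OF f])
    fix v assume v: "v \<in> S"
    have v2: "v \<in> L2 T" using subspace_YD(1)[OF v] .
    note vw = subspace_YD(3)[OF v w]
    have "(nY (\<lambda>t. v t + w t))\<^sup>2 = As_op T a v v + 2 * As_op T a v w + As_op T a w w"
      using Y.form_combination[OF v2 w2, of 1 1] Ynorm_power2[OF subspace_YD(1)[OF vw]] by simp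
    then show "2 * f v - (nY v)\<^sup>2 \<le> (dual_norm T a S (\<lambda>v. f v + As_op T a w v))\<^sup>2 - 2 * f w - (nY w)\<^sup>2"
      using dual_norm_power2_ge[OF fw vw] dual_spaceD(1)[OF f v w] Y.form_add_right[OF v2 w2 w2]
        Ynorm_power2[OF v2] Ynorm_power2[OF w2] Y.form_sym[OF v2 w2] by simp
  qed
  then show "(dual_norm T a S f)\<^sup>2 + 2 * f w + (nY w)\<^sup>2 \<le> (dual_norm T a S (\<lambda>v. f v + As_op T a w v))\<^sup>2" by simp
qed

lemma dual_norm_triangle:
  assumes f: "f \<in> dual_space T a S" and h: "h \<in> dual_space T a S"
  shows "dual_norm T a S (\<lambda>v. f v + h v) \<le> dual_norm T a S f + dual_norm T a S h"
proof (rule dual_norm_le)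
  fix v assume v: "v \<in> S"
  show "\<bar>f v + h v\<bar> \<le> (dual_norm T a S f + dual_norm T a S h) * nY v"
    using dual_norm_ge[OF f v] dual_norm_ge[OF h v] by (simp add: distrib_right)
qed (simp add: dual_norm_nonneg f h)

text \<open>Functionals act on functions, and it is boundedness in the seminorm that makes them
  blind to null sets. This absorbs the almost-everywhere equalities in the properties of K.\<close>

lemma dual_space_cong_AE:
  assumes f: "f \<in> dual_space T a S" and v: "v \<in> S" and w: "w \<in> S" and vw: "ae_eq T v w"
  shows "f v = f w"
proof -
  have "nY (\<lambda>t. v t - w t) = 0" using Ynorm_eq_0_iff[OF subspace_YD(1)[OF v] subspace_YD(1)[OF w]] vw by blast
  with dual_norm_ge[OF f subspace_Y_diff[OF v w]] dual_space_diff[OF f v w] show ?thesis by simp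
qed

lemma dual_space_restrict: "f \<in> dual_space T a (L2 T) \<Longrightarrow> f \<in> dual_space T a S"
  unfolding dual_space_def using subspace_YD(1) by blast

end

end

section \<open>The discrete minimal residual method\<close>

text \<open>
  \<open>m\<close> is the \<open>E\<close>-orthogonal projection of \<open>u\<close> on \<open>W\<close>.  With \<open>x = m - w\<close> and \<open>y = u - m\<close>, exchanging the
  \<open>G\<close>-lengths of \<open>x\<close> and \<open>y\<close> does not change the \<open>G\<close>-norm of their sum, which is how the norm
  of the complementary projection is bounded by that of the projection (Kato, Xu--Zikatanov).
\<close>

lemma projection_quasi_optimal:
  fixes Z :: "'x set" and add :: "'x \<Rightarrow> 'x \<Rightarrow> 'x" and scale :: "real \<Rightarrow> 'x \<Rightarrow> 'x" and E G :: "'x \<Rightarrow> 'x \<Rightarrow> real"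
  assumes E: "semi_inner_product Z add scale E" and G: "semi_inner_product Z add scale G"
    and W: "W \<subseteq> Z" "\<And>x y. x \<in> W \<Longrightarrow> y \<in> W \<Longrightarrow> add x y \<in> W" "\<And>c x. x \<in> W \<Longrightarrow> scale c x \<in> W"
    and lower: "\<And>w. w \<in> W \<Longrightarrow> l * G w w \<le> E w w" and upper: "\<And>w. w \<in> Z \<Longrightarrow> E w w \<le> c * G w w"
    and c: "0 < l" "l \<le> c" and u: "u \<in> Z" and m: "m \<in> W" "\<And>w. w \<in> W \<Longrightarrow> E m w = E u w" and w: "w \<in> W"
  shows "l * G (add u (scale (- 1) m)) (add u (scale (- 1) m)) \<le> c * G (add u (scale (- 1) w)) (add u (scale (- 1) w))"
proof -
  interpret E: semi_inner_product Z add scale E by (rule E)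
  interpret G: semi_inner_product Z add scale G by (rule G)
  define x where "x = E.sub m w"
  define y where "y = E.sub u m"
  have mw: "m \<in> Z" "w \<in> Z" using m(1) w W(1) by auto
  have xW: "x \<in> W" unfolding x_def using m(1) w W by blast
  have x: "x \<in> Z" and y: "y \<in> Z" using xW W(1) u mw by (auto simp: y_def E.form_simps)
  have Exy: "E x y = 0"
    using m(2)[OF xW] E.form_sym[OF x y] by (simp add: y_def E.form_simps x u mw E.form_sym[OF x u] E.form_sym[OF x mw(1)])
  have Guw: "G (E.sub u w) (E.sub u w) = G x x + 2 * G x y + G y y"
    unfolding x_def y_def using u mw G.form_sym[OF u mw(1)] G.form_sym[OF u mw(2)] G.form_sym[OF mw]
    by (simp add: G.form_simps algebra_simps)
  have nn: "0 \<le> G x x" "0 \<le> G y y" "0 \<le> G (E.sub u w) (E.sub u w)"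
    using u mw by (intro G.form_nonneg x y G.add_closed G.scale_closed; simp)+
  have "l * G y y \<le> c * G (E.sub u w) (E.sub u w)"
  \<comment> \<open>Exchanging the two lengths divides by both of them; if one vanishes, the claim
    is direct.\<close>
  proof (cases "G x x = 0 \<or> G y y = 0")
    case True
    then show ?thesis
    proof
      assume 0: "G x x = 0"
      then have "G x y = 0" using G.form_Cauchy_Schwarz[OF x y] by simp
      with 0 Guw nn c show ?thesis by (simp add: mult_right_mono)
    next
      assume "G y y = 0"
      with nn c show ?thesis by simp
    qed
  next
    case False
    with nn have pos: "0 < G x x" "0 < G y y" by auto
    define s where "s = sqrt (G y y / G x x)"
    have s: "s > 0" "s\<^sup>2 = G y y / G x x" using pos by (auto simp: s_def)
    define z where "z = add (scale s x) (scale (1 / s) y)"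
    have z: "z \<in> Z" unfolding z_def using x y by (simp add: G.form_simps)
    have "(1 / s)\<^sup>2 = G x x / G y y" using s by (simp add: power_divide)
    then have Gz: "G z z = G (E.sub u w) (E.sub u w)"
      unfolding z_def G.form_combination[OF x y] Guw using s pos by simp
    \<comment> \<open>The lower bound is applied to x, which lies in W; orthogonality then allows
      the y part to be added, and the upper bound is applied to z.\<close>
    have "l * G y y = s\<^sup>2 * (l * G x x)" using s pos by simp
    also have "\<dots> \<le> s\<^sup>2 * E x x" using lower[OF xW] by (intro mult_left_mono) auto
    also have "\<dots> \<le> E z z"
      unfolding z_def E.form_combination[OF x y] Exy using E.form_nonneg[OF y] by simp
    also have "\<dots> \<le> c * G z z" by (rule upper[OF z])
    finally show ?thesis by (simp add: Gz)
  qed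
  then show ?thesis by (simp add: y_def)
qed

lemma weighted_square_le:
  fixes p q b x y :: real
  assumes "0 \<le> p" "0 \<le> q" "b\<^sup>2 = p * q" "0 \<le> b" "0 \<le> x" "0 \<le> y"
  shows "2 * b * x * y \<le> p * x\<^sup>2 + q * y\<^sup>2"
proof -
  have "b = sqrt p * sqrt q" using assms by (metis real_sqrt_abs abs_of_nonneg real_sqrt_mult)
  then have "p * x\<^sup>2 + q * y\<^sup>2 - 2 * b * x * y = (sqrt p * x - sqrt q * y)\<^sup>2"
    using assms by (simp add: power2_diff power_mult_distrib)
  then show ?thesis using zero_le_power2[of "sqrt p * x - sqrt q * y"] by linarith
qed

definition upper_const :: "real \<Rightarrow> real" where
  "upper_const \<alpha> = 1 + (\<alpha>\<^sup>2 + \<alpha> * sqrt (\<alpha>\<^sup>2 + 4)) / 2"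

definition lower_const :: "real \<Rightarrow> real \<Rightarrow> real" where
  "lower_const \<alpha> \<gamma> = (\<gamma>\<^sup>2 + \<alpha>\<^sup>2 + 1 - sqrt ((\<gamma>\<^sup>2 + \<alpha>\<^sup>2 + 1)\<^sup>2 - 4 * \<gamma>\<^sup>2)) / 2"

text \<open>\<open>upper_const \<alpha>\<close> is the largest eigenvalue of \<open>((1, \<alpha>), (\<alpha>, \<alpha>\<^sup>2 + 1))\<close>.\<close>

lemma upper_const_ge_1: "\<alpha> \<ge> 0 \<Longrightarrow> 1 \<le> upper_const \<alpha>"
  by (simp add: upper_const_def)

text \<open>Subtracting the matrix from \<open>upper_const \<alpha>\<close> times the identity
  leaves ((p, -\<alpha>), (-\<alpha>, q)). It is singular because p q = \<alpha>^2, so its quadratic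
  form is a perfect square.\<close>

lemma upper_const_bound:
  assumes "\<alpha> \<ge> 0" "d \<ge> 0" "b \<ge> 0"
  shows "(d + \<alpha> * b)\<^sup>2 + b\<^sup>2 \<le> upper_const \<alpha> * (d\<^sup>2 + b\<^sup>2)"
proof -
  define p where "p = (\<alpha>\<^sup>2 + \<alpha> * sqrt (\<alpha>\<^sup>2 + 4)) / 2"
  define q where "q = (\<alpha> * sqrt (\<alpha>\<^sup>2 + 4) - \<alpha>\<^sup>2) / 2"
  have "\<alpha> \<le> sqrt (\<alpha>\<^sup>2 + 4)" by (rule real_le_rsqrt) simp
  then have "\<alpha>\<^sup>2 \<le> \<alpha> * sqrt (\<alpha>\<^sup>2 + 4)" using assms by (simp add: power2_eq_square mult_left_mono)
  then have pq: "0 \<le> p" "0 \<le> q" using assms by (auto simp: p_def q_def)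
  have "4 * (p * q) = (\<alpha> * sqrt (\<alpha>\<^sup>2 + 4))\<^sup>2 - (\<alpha>\<^sup>2)\<^sup>2"
    unfolding p_def q_def by (simp add: power2_eq_square algebra_simps)
  also have "\<dots> = 4 * \<alpha>\<^sup>2" unfolding power_mult_distrib by (simp add: power2_eq_square[of "\<alpha>\<^sup>2"] algebra_simps)
  finally have "\<alpha>\<^sup>2 = p * q" by simp
  from weighted_square_le[OF pq this assms] have "2 * \<alpha> * d * b \<le> p * d\<^sup>2 + q * b\<^sup>2" .
  moreover have "upper_const \<alpha> = 1 + p" "p = q + \<alpha>\<^sup>2" by (auto simp: upper_const_def p_def q_def field_simps)
  ultimately show ?thesis by (simp add: power2_sum power_mult_distrib algebra_simps)
qed

text \<open>\<open>lower_const \<alpha> \<gamma>\<close> is the smallest eigenvalue of \<open>((\<gamma>\<^sup>2, -\<gamma>\<alpha>), (-\<gamma>\<alpha>, \<alpha>\<^sup>2 + 1))\<close>.\<close>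

lemma lower_const_props:
  assumes "\<alpha> \<ge> 0" "0 < \<gamma>" "\<gamma> \<le> 1"
  shows "0 < lower_const \<alpha> \<gamma>" "lower_const \<alpha> \<gamma> \<le> \<gamma>\<^sup>2" "lower_const \<alpha> \<gamma> \<le> 1"
    "(\<gamma>\<^sup>2 - lower_const \<alpha> \<gamma>) * (\<alpha>\<^sup>2 + 1 - lower_const \<alpha> \<gamma>) = (\<gamma> * \<alpha>)\<^sup>2"
proof -
  define S where "S = \<gamma>\<^sup>2 + \<alpha>\<^sup>2 + 1"
  define D where "D = sqrt (S\<^sup>2 - 4 * \<gamma>\<^sup>2)"
  have \<gamma>1: "\<gamma>\<^sup>2 \<le> 1" using assms by (simp add: power_le_one)
  \<comment> \<open>Written as a sum of squares, the discriminant is at least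
    \<open>(\<alpha>\<^sup>2 + 1 - \<gamma>\<^sup>2)\<^sup>2\<close>; hence the smaller root is at
    most \<open>\<gamma>\<^sup>2\<close>, the smaller diagonal entry.\<close>
  have "S\<^sup>2 - 4 * \<gamma>\<^sup>2 = (\<alpha>\<^sup>2 + 1 - \<gamma>\<^sup>2)\<^sup>2 + 4 * \<gamma>\<^sup>2 * \<alpha>\<^sup>2"
    unfolding S_def by (simp add: power2_eq_square algebra_simps)
  then have disc: "(\<alpha>\<^sup>2 + 1 - \<gamma>\<^sup>2)\<^sup>2 \<le> S\<^sup>2 - 4 * \<gamma>\<^sup>2" by simp
  have D_ge: "\<alpha>\<^sup>2 + 1 - \<gamma>\<^sup>2 \<le> D" unfolding D_def by (rule real_le_rsqrt) (rule disc)
  have D2: "D\<^sup>2 = S\<^sup>2 - 4 * \<gamma>\<^sup>2" unfolding D_def using order_trans[OF zero_le_power2 disc] by (rule real_sqrt_pow2)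
  have D0: "0 \<le> D" unfolding D_def using order_trans[OF zero_le_power2 disc] by simp
  have S0: "0 < S" unfolding S_def using zero_le_power2[of \<gamma>] zero_le_power2[of \<alpha>] by linarith
  have L: "lower_const \<alpha> \<gamma> = (S - D) / 2" by (simp add: lower_const_def S_def D_def)
  have "D\<^sup>2 < S\<^sup>2" using D2 assms by simp
  then have "D < S" using S0 by (rule power_less_imp_less_base[OF _ less_imp_le])
  then show "0 < lower_const \<alpha> \<gamma>" by (simp add: L)
  show le: "lower_const \<alpha> \<gamma> \<le> \<gamma>\<^sup>2" using D_ge by (simp add: L S_def)
  then show "lower_const \<alpha> \<gamma> \<le> 1" using \<gamma>1 by simp
  have "4 * ((\<gamma>\<^sup>2 - (S - D) / 2) * (\<alpha>\<^sup>2 + 1 - (S - D) / 2)) = D\<^sup>2 - (\<alpha>\<^sup>2 + 1 - \<gamma>\<^sup>2)\<^sup>2"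
  proof -
    define P where "P = \<alpha>\<^sup>2 + 1 - \<gamma>\<^sup>2"
    have "\<gamma>\<^sup>2 - (S - D) / 2 = (D - P) / 2" "\<alpha>\<^sup>2 + 1 - (S - D) / 2 = (D + P) / 2"
      by (auto simp: S_def P_def field_simps)
    moreover have "4 * ((D - P) / 2 * ((D + P) / 2)) = D\<^sup>2 - P\<^sup>2"
      by (simp add: power2_eq_square field_simps)
    ultimately show ?thesis by (simp only: P_def)
  qed
  also have "\<dots> = 4 * (\<gamma> * \<alpha>)\<^sup>2" unfolding D2 S_def by (simp add: power2_eq_square algebra_simps)
  finally show "(\<gamma>\<^sup>2 - lower_const \<alpha> \<gamma>) * (\<alpha>\<^sup>2 + 1 - lower_const \<alpha> \<gamma>) = (\<gamma> * \<alpha>)\<^sup>2" by (simp add: L)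
qed

text \<open>Where \<open>\<gamma> * d - \<alpha> * b\<close> is nonnegative, it may be squared and
  the eigenvalue estimate applies. Where it is negative, its square says nothing about f, and d is
  enlarged instead.\<close>

lemma lower_const_bound:
  assumes \<alpha>: "\<alpha> \<ge> 0" and \<gamma>: "0 < \<gamma>" "\<gamma> \<le> 1" and d: "d \<ge> 0" and b: "b \<ge> 0" and f: "f \<ge> 0" "\<gamma> * d - \<alpha> * b \<le> f"
  shows "lower_const \<alpha> \<gamma> * (d\<^sup>2 + b\<^sup>2) \<le> f\<^sup>2 + b\<^sup>2"
proof -
  let ?l = "lower_const \<alpha> \<gamma>"
  note props = lower_const_props[OF \<alpha> \<gamma>]
  have quad: "?l * (x\<^sup>2 + b\<^sup>2) \<le> (\<gamma> * x - \<alpha> * b)\<^sup>2 + b\<^sup>2" if x: "x \<ge> 0" for x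
  proof -
    have "?l \<le> \<alpha>\<^sup>2 + 1" using props(3) zero_le_power2[of \<alpha>] by linarith
    then have "2 * (\<gamma> * \<alpha>) * x * b \<le> (\<gamma>\<^sup>2 - ?l) * x\<^sup>2 + (\<alpha>\<^sup>2 + 1 - ?l) * b\<^sup>2"
      by (intro weighted_square_le) (use props \<alpha> \<gamma> x b in auto)
    then show ?thesis by (simp add: power2_diff power_mult_distrib algebra_simps)
  qed
  show ?thesis
  proof (cases "\<alpha> * b \<le> \<gamma> * d")
    case True
    then have "(\<gamma> * d - \<alpha> * b)\<^sup>2 \<le> f\<^sup>2" using f by (intro power_mono) auto
    with quad[OF d] show ?thesis by simp
  next
    case False
    \<comment> \<open>At x the difference vanishes, so the quadratic form reduces to b^2; passing
      from d to x only increases the left-hand side.\<close>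
    define x where "x = \<alpha> * b / \<gamma>"
    have x: "d \<le> x" "0 \<le> x" "\<gamma> * x = \<alpha> * b" using False \<gamma> \<alpha> b by (auto simp: x_def pos_le_divide_eq mult.commute)
    have "?l * (d\<^sup>2 + b\<^sup>2) \<le> ?l * (x\<^sup>2 + b\<^sup>2)"
      using x d props(1) by (intro mult_left_mono add_right_mono power_mono) auto
    also have "\<dots> \<le> b\<^sup>2" using quad[OF x(2)] x(3) by simp
    finally show ?thesis using zero_le_power2[of f] by linarith
  qed
qed

lemma L2_limit_inner:
  fixes f g :: "real \<Rightarrow> 'b::{real_inner, banach, second_countable_topology}"
  assumes s: "\<And>n. s n \<in> L2 T" and f: "f \<in> L2 T" and lim: "(\<lambda>n. LINT t|leb_on T. (norm (s n t - f t))\<^sup>2) \<longlonglongrightarrow> 0" and g: "g \<in> L2 T"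
  shows "(\<lambda>n. LINT t|leb_on T. inner (s n t) (g t)) \<longlonglongrightarrow> (LINT t|leb_on T. inner (f t) (g t))"
proof -
  have "(\<lambda>n. (LINT t|leb_on T. inner (s n t) (g t)) - (LINT t|leb_on T. inner (f t) (g t))) \<longlonglongrightarrow> 0"
  proof (rule Lim_null_comparison)
    let ?b = "\<lambda>n. sqrt (sqint T (\<lambda>t. s n t - f t)) * sqrt (sqint T g)"
    show "\<forall>\<^sub>F n in sequentially. norm ((LINT t|leb_on T. inner (s n t) (g t)) - (LINT t|leb_on T. inner (f t) (g t))) \<le> ?b n"
    proof (intro always_eventually allI)
      fix n
      note d = L2_diff[OF s[of n] f]
      have "(LINT t|leb_on T. inner (s n t) (g t)) - (LINT t|leb_on T. inner (f t) (g t)) = (LINT t|leb_on T. inner (s n t - f t) (g t))"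
        using L2_inner_integrable[OF s[of n] g] L2_inner_integrable[OF f g] by (simp add: inner_diff_left)
      also have "norm \<dots> \<le> (LINT t|leb_on T. norm (s n t - f t) * norm (g t))"
        by (rule order_trans[OF integral_norm_bound], rule integral_mono)
           (use L2_inner_integrable[OF d g] L2_norm_mult_integrable[OF d g] in \<open>auto simp: Cauchy_Schwarz_ineq2\<close>)
      also have "\<dots> \<le> ?b n" by (rule L2_norm_mult_le_sqrt[OF d g])
      finally show "norm ((LINT t|leb_on T. inner (s n t) (g t)) - (LINT t|leb_on T. inner (f t) (g t))) \<le> ?b n" .
    qed
    show "?b \<longlonglongrightarrow> 0" using tendsto_mult[OF tendsto_real_sqrt[OF lim] tendsto_const] by simp
  qed
  then show ?thesis by (rule LIM_zero_cancel)
qed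

section \<open>The operators and the traces on X\<close>

context parabolic
begin

lemma A_op_split: "A_op T a w v = As_op T a w v + Aa_op T a w v"
  by (simp add: As_op_def Aa_op_def field_simps)

lemma Aa_op_self [simp]: "Aa_op T a w w = 0"
  by (simp add: Aa_op_def)

lemma Aa_op_simps:
  assumes "w \<in> L2 T" "x \<in> L2 T" "v \<in> L2 T"
  shows "Aa_op T a (\<lambda>t. w t + x t) v = Aa_op T a w v + Aa_op T a x v"
    "Aa_op T a v (\<lambda>t. w t + x t) = Aa_op T a v w + Aa_op T a v x"
    "Aa_op T a (\<lambda>t. c *\<^sub>R w t) v = c * Aa_op T a w v" "Aa_op T a v (\<lambda>t. c *\<^sub>R w t) = c * Aa_op T a v w"
  using assms by (auto simp: Aa_op_def A_op_add_left A_op_add_right A_op_scale field_simps)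

lemma Aa_op_bounded: "\<exists>C\<ge>0. \<forall>w\<in>L2 T. \<forall>v\<in>L2 T. \<bar>Aa_op T a w v\<bar> \<le> C * nY w * nY v"
proof -
  obtain M where M: "M \<ge> 0" "\<And>w v. w \<in> L2 T \<Longrightarrow> v \<in> L2 T \<Longrightarrow> \<bar>A_op T a w v\<bar>
    \<le> M * (sqrt (sqint T w) * sqrt (sqint T v))" using A_op_bounded by blast
  obtain k where k: "k > 0" "\<And>v. v \<in> L2 T \<Longrightarrow> sqrt (sqint T v) \<le> k * nY v"
    using Ynorm_equiv by metis
  have A: "\<bar>A_op T a w v\<bar> \<le> M * k\<^sup>2 * nY w * nY v" if "w \<in> L2 T" "v \<in> L2 T" for w v
  proof -
    have "sqrt (sqint T w) * sqrt (sqint T v) \<le> (k * nY w) * (k * nY v)"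
      using k that Ynorm_nonneg by (intro mult_mono) auto
    from mult_left_mono[OF this M(1)] M(2)[OF that] show ?thesis by (simp add: power2_eq_square mult_ac)
  qed
  have "\<bar>Aa_op T a w v\<bar> \<le> M * k\<^sup>2 * nY w * nY v" if "w \<in> L2 T" "v \<in> L2 T" for w v
    using A[OF that] A[OF that(2,1)] by (simp add: Aa_op_def mult_ac)
  then show ?thesis using M(1) by (intro exI[of _ "M * k\<^sup>2"]) auto
qed

lemma Aa_op_dual: "w \<in> L2 T \<Longrightarrow> Aa_op T a w \<in> dual_space T a (L2 T)"
  using Aa_op_bounded unfolding dual_space_def by (fastforce simp: Aa_op_simps)

text \<open>A real supremum is informative only over a bounded set, so a crude bound from the
  equivalence of norms comes before the operator norm can be used.\<close>

lemma Aa_norm_properties: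
  fixes w v :: "real \<Rightarrow> 'v"
  shows Aa_norm_nonneg: "0 \<le> Aa_norm T a"
    and Aa_op_le: "w \<in> L2 T \<Longrightarrow> v \<in> L2 T \<Longrightarrow> \<bar>Aa_op T a w v\<bar> \<le> Aa_norm T a * nY w * nY v"
proof -
  obtain C where C: "C \<ge> 0" "\<And>w v. w \<in> L2 T \<Longrightarrow> v \<in> L2 T \<Longrightarrow> \<bar>Aa_op T a w v\<bar> \<le> C * nY w * nY v"
    using Aa_op_bounded by blast
  have bdd: "bdd_above ((\<lambda>w. dual_norm T a (L2 T) (Aa_op T a w)) ` {w\<in>L2 T. nY w \<le> 1})"
  proof (rule bdd_aboveI2)
    fix w assume w: "w \<in> {w\<in>L2 T. nY w \<le> 1}"
    show "dual_norm T a (L2 T) (Aa_op T a w) \<le> C"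
    proof (rule dual_norm_le[OF subspace_Y_L2 C(1)])
      fix v :: "real \<Rightarrow> 'v" assume v: "v \<in> L2 T"
      have "\<bar>Aa_op T a w v\<bar> \<le> C * nY w * nY v" using C(2) w v by blast
      also have "\<dots> \<le> C * 1 * nY v" using w v C(1) Ynorm_nonneg by (intro mult_right_mono mult_left_mono) auto
      finally show "\<bar>Aa_op T a w v\<bar> \<le> C * nY v" by simp
    qed
  qed
  have up: "dual_norm T a (L2 T) (Aa_op T a w) \<le> Aa_norm T a" if "w \<in> L2 T" "nY w \<le> 1" for w
    unfolding Aa_norm_def Yspace_def using that by (intro cSUP_upper bdd) auto
  show nn: "0 \<le> Aa_norm T a"
    using up[of "\<lambda>t. 0"] dual_norm_nonneg[OF subspace_Y_L2 Aa_op_dual[of "\<lambda>t. 0"]] by simp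
  show "\<bar>Aa_op T a w v\<bar> \<le> Aa_norm T a * nY w * nY v" if w: "w \<in> L2 T" and v: "v \<in> L2 T"
  proof (cases "nY w = 0")
    case True
    with C(2)[OF w v] show ?thesis by simp
  next
    case False
    then have pos: "nY w > 0" using Ynorm_nonneg[OF w] by simp
    let ?w = "\<lambda>t. (1 / nY w) *\<^sub>R w t"
    have w': "?w \<in> L2 T" "nY ?w = 1" using w Ynorm_scale[OF w, of "1 / nY w"] pos by (auto intro: L2_scaleR)
    have "\<bar>Aa_op T a ?w v\<bar> \<le> dual_norm T a (L2 T) (Aa_op T a ?w) * nY v"
      by (rule dual_norm_ge[OF subspace_Y_L2 Aa_op_dual[OF w'(1)] v])
    also have "\<dots> \<le> Aa_norm T a * nY v" using up[OF w'(1)] w'(2) Ynorm_nonneg[OF v] by (intro mult_right_mono) auto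
    finally have "\<bar>Aa_op T a w v\<bar> / nY w \<le> Aa_norm T a * nY v"
      using pos by (simp add: Aa_op_simps(3)[OF w w v] abs_mult)
    then show ?thesis using pos by (simp add: pos_divide_le_eq mult_ac)
  qed
qed

abbreviation XX :: "(real \<Rightarrow> 'v) set" where "XX \<equiv> Xspace \<iota> T"
abbreviation dY :: "((real \<Rightarrow> 'v) \<Rightarrow> real) \<Rightarrow> real" where "dY \<equiv> dual_norm T a (L2 T)"
abbreviation dt :: "(real \<Rightarrow> 'v) \<Rightarrow> (real \<Rightarrow> 'v) \<Rightarrow> real" where "dt \<equiv> dt_op \<iota> T"
abbreviation B :: "(real \<Rightarrow> 'v) \<Rightarrow> (real \<Rightarrow> 'v) \<Rightarrow> real" where "B \<equiv> B_op \<iota> T a"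
abbreviation tr :: "real \<Rightarrow> (real \<Rightarrow> 'v) \<Rightarrow> 'h" where "tr \<equiv> trace_at \<iota> T"

lemma Xspace_L2: "w \<in> XX \<Longrightarrow> w \<in> L2 T"
  by (simp add: Xspace_def)

lemma Xspace_obtain:
  assumes "w \<in> XX" obtains z where "has_time_deriv \<iota> T w z"
  using Xspace_has_time_deriv[OF assms] by blast

lemma Xspace_combination:
  assumes "w \<in> XX" "v \<in> XX" shows "(\<lambda>t. c *\<^sub>R w t + d *\<^sub>R v t) \<in> XX"
  using has_time_deriv_combination[OF Xspace_has_time_deriv[OF assms(1)] Xspace_has_time_deriv[OF assms(2)]]
  by (rule has_time_deriv_Xspace)

lemma Xspace_add: "w \<in> XX \<Longrightarrow> v \<in> XX \<Longrightarrow> (\<lambda>t. w t + v t) \<in> XX"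
  using Xspace_combination[of w v 1 1] by simp

lemma Xspace_scale: "w \<in> XX \<Longrightarrow> (\<lambda>t. c *\<^sub>R w t) \<in> XX"
  using Xspace_combination[of w w c 0] by simp

lemma Xspace_diff: "w \<in> XX \<Longrightarrow> v \<in> XX \<Longrightarrow> (\<lambda>t. w t - v t) \<in> XX"
  using Xspace_combination[of w v 1 "-1"] by simp

lemma dt_combination:
  assumes w: "w \<in> XX" and x: "x \<in> XX" and v: "v \<in> L2 T"
  shows "dt (\<lambda>t. c *\<^sub>R w t + d *\<^sub>R x t) v = c * dt w v + d * dt x v"
proof -
  obtain y where y: "has_time_deriv \<iota> T w y" using Xspace_obtain[OF w] .
  obtain z where z: "has_time_deriv \<iota> T x z" using Xspace_obtain[OF x] .
  show ?thesis
    unfolding dt_op_eq[OF y v] dt_op_eq[OF z v] dt_op_eq[OF has_time_deriv_combination[OF y z] v]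
    using L2_inner_integrable[OF has_time_derivD(2)[OF y] v] L2_inner_integrable[OF has_time_derivD(2)[OF z] v]
    by (simp add: inner_add_left)
qed

lemma dt_add: "w \<in> XX \<Longrightarrow> x \<in> XX \<Longrightarrow> v \<in> L2 T \<Longrightarrow> dt (\<lambda>t. w t + x t) v = dt w v + dt x v"
  using dt_combination[of w x v 1 1] by simp

lemma dt_scale: "w \<in> XX \<Longrightarrow> v \<in> L2 T \<Longrightarrow> dt (\<lambda>t. c *\<^sub>R w t) v = c * dt w v"
  using dt_combination[of w w v c 0] by simp

lemma trace_combination:
  assumes w: "w \<in> XX" and x: "x \<in> XX" and t: "t \<in> {0..T}"
  shows "tr t (\<lambda>s. c *\<^sub>R w s + d *\<^sub>R x s) = c *\<^sub>R tr t w + d *\<^sub>R tr t x"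
proof -
  obtain y where y: "has_time_deriv \<iota> T w y" using Xspace_obtain[OF w] .
  obtain z where z: "has_time_deriv \<iota> T x z" using Xspace_obtain[OF x] .
  note cy = trace_continuous_ae[OF T_pos y] and cz = trace_continuous_ae[OF T_pos z]
  show ?thesis
  proof (rule trace_at_eqI[OF T_pos _ _ t])
    show "continuous_on {0..T} (\<lambda>t. c *\<^sub>R tr t w + d *\<^sub>R tr t x)"
      by (intro continuous_intros cy(1) cz(1))
    show "ae_eq T (\<lambda>t. c *\<^sub>R tr t w + d *\<^sub>R tr t x) (\<lambda>s. \<iota> (c *\<^sub>R w s + d *\<^sub>R x s))"
      using cy(2) cz(2) unfolding ae_eq_def
      by eventually_elim (simp add: blinfun.add_right blinfun.scaleR_right)
  qed
qed

lemma trace_add: "w \<in> XX \<Longrightarrow> x \<in> XX \<Longrightarrow> t \<in> {0..T} \<Longrightarrow> tr t (\<lambda>s. w s + x s) = tr t w + tr t x"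
  using trace_combination[of w x t 1 1] by simp

lemma trace_scale: "w \<in> XX \<Longrightarrow> t \<in> {0..T} \<Longrightarrow> tr t (\<lambda>s. c *\<^sub>R w s) = c *\<^sub>R tr t w"
  using trace_combination[of w w t c 0] by simp

lemma dt_energy:
  assumes w: "w \<in> XX" shows "2 * dt w w = (norm (tr T w))\<^sup>2 - (norm (tr 0 w))\<^sup>2"
proof -
  obtain z where z: "has_time_deriv \<iota> T w z" using Xspace_obtain[OF w] .
  show ?thesis
    using trace_energy[OF T_pos z, of 0 T] T_pos by (simp add: dt_op_eq[OF z Xspace_L2[OF w]] primitive_T)
qed

lemma dt_le:
  assumes z: "has_time_deriv \<iota> T w z" and v: "v \<in> L2 T"
  shows "\<bar>dt w v\<bar> \<le> sqrt (sqint T z) * sqrt (sqint T v)"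
proof -
  note z2 = has_time_derivD(2)[OF z]
  have "\<bar>dt w v\<bar> \<le> (LINT t|leb_on T. \<bar>inner (z t) (v t)\<bar>)" unfolding dt_op_eq[OF z v] by (rule integral_abs_bound)
  also have "\<dots> \<le> (LINT t|leb_on T. norm (z t) * norm (v t))"
    by (rule integral_mono) (use L2_inner_integrable[OF z2 v] L2_norm_mult_integrable[OF z2 v] in \<open>auto simp: Cauchy_Schwarz_ineq2\<close>)
  also have "\<dots> \<le> sqrt (sqint T z) * sqrt (sqint T v)"
    by (rule L2_norm_mult_le_sqrt[OF z2 v])
  finally show ?thesis .
qed

lemma dt_dual: assumes w: "w \<in> XX" shows "dt w \<in> dual_space T a (L2 T)"
proof -
  obtain z where z: "has_time_deriv \<iota> T w z" using Xspace_obtain[OF w] .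
  note z2 = has_time_derivD(2)[OF z]
  obtain k where k: "k > 0" "\<And>v. v \<in> L2 T \<Longrightarrow> sqrt (sqint T v) \<le> k * nY v"
    using Ynorm_equiv by metis
  have "\<bar>dt w v\<bar> \<le> sqrt (sqint T z) * k * nY v" if v: "v \<in> L2 T" for v
    using dt_le[OF z v] mult_left_mono[OF k(2)[OF v], of "sqrt (sqint T z)"] by (simp add: mult.assoc)
  then have "\<exists>C. \<forall>v\<in>L2 T. \<bar>dt w v\<bar> \<le> C * nY v" by blast
  moreover have "dt w (\<lambda>t. v t + x t) = dt w v + dt w x" if "v \<in> L2 T" "x \<in> L2 T" for v x
    unfolding dt_op_eq[OF z that(1)] dt_op_eq[OF z that(2)] dt_op_eq[OF z L2_add[OF that]]
    using L2_inner_integrable[OF z2] that by (simp add: inner_add_right)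
  moreover have "dt w (\<lambda>t. c *\<^sub>R v t) = c * dt w v" if "v \<in> L2 T" for c v
    unfolding dt_op_eq[OF z that] dt_op_eq[OF z L2_scaleR[OF that]] by simp
  ultimately show ?thesis unfolding dual_space_def by blast
qed

text \<open>The symmetric part is set apart because it is the Riesz map of Y and acts as the shift
  in \<open>dual_norm_shift\<close>.\<close>

lemma B_op_split: "B w = (\<lambda>v. (dt w v + Aa_op T a w v) + As_op T a w v)"
  by (simp add: B_op_def A_op_split fun_eq_iff)

lemma B_dual: "w \<in> XX \<Longrightarrow> B w \<in> dual_space T a (L2 T)"
  unfolding B_op_split
  by (intro dual_space_add subspace_Y_L2 dual_space_As_op dt_dual Aa_op_dual Xspace_L2)

lemma B_add: "w \<in> XX \<Longrightarrow> x \<in> XX \<Longrightarrow> v \<in> L2 T \<Longrightarrow> B (\<lambda>t. w t + x t) v = B w v + B x v"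
  by (simp add: B_op_def dt_add A_op_add_left Xspace_L2)

lemma B_scale: "w \<in> XX \<Longrightarrow> v \<in> L2 T \<Longrightarrow> B (\<lambda>t. c *\<^sub>R w t) v = c * B w v"
  by (simp add: B_op_def dt_scale A_op_scale Xspace_L2 distrib_left)

section \<open>Completeness of Y and X\<close>

lemma Y_complete:
  assumes s: "\<And>n. s n \<in> L2 T" and C: "\<forall>e>0. \<exists>N. \<forall>m\<ge>N. \<forall>n\<ge>N. (nY (\<lambda>t. s m t - s n t))\<^sup>2 < e"
  shows "\<exists>w\<in>L2 T. (\<lambda>n. LINT t|leb_on T. (norm (s n t - w t))\<^sup>2) \<longlonglongrightarrow> 0"
proof (rule L2_complete[OF s])
  obtain k where k: "k > 0" "\<And>v. v \<in> L2 T \<Longrightarrow> (sqint T v) \<le> k\<^sup>2 * (nY v)\<^sup>2"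
    using Ynorm_equiv by metis
  show "\<forall>e>0. \<exists>N. \<forall>m\<ge>N. \<forall>n\<ge>N. (sqint T (\<lambda>t. s m t - s n t)) < e"
  proof (intro allI impI)
    fix e :: real assume "e > 0"
    then have "e / k\<^sup>2 > 0" using k(1) by simp
    with C obtain N where N: "\<forall>m\<ge>N. \<forall>n\<ge>N. (nY (\<lambda>t. s m t - s n t))\<^sup>2 < e / k\<^sup>2" by blast
    have "(sqint T (\<lambda>t. s m t - s n t)) < e" if "m \<ge> N" "n \<ge> N" for m n
      using N that k(1) k(2)[OF L2_diff[OF s s], of m n] by (auto simp: pos_less_divide_eq mult.commute intro: le_less_trans)
    then show "\<exists>N. \<forall>m\<ge>N. \<forall>n\<ge>N. (sqint T (\<lambda>t. s m t - s n t)) < e" by blast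
  qed
qed

lemma Y_Riesz:
  assumes f: "f \<in> dual_space T a (L2 T)"
  shows "\<exists>y\<in>L2 T. \<forall>v\<in>L2 T. As_op T a y v = f v"
proof (rule Y.Riesz)
  show "\<bar>f v\<bar> \<le> dY f * sqrt (As_op T a v v)" if "v \<in> L2 T" for v
    using dual_norm_ge[OF subspace_Y_L2 f that] by (simp add: Ynorm_def)
  fix s :: "nat \<Rightarrow> real \<Rightarrow> 'v"
  assume s: "\<And>n. s n \<in> L2 T" and C: "\<forall>e>0. \<exists>N. \<forall>m\<ge>N. \<forall>n\<ge>N. As_op T a (\<lambda>t. s m t + - 1 *\<^sub>R s n t) (\<lambda>t. s m t + - 1 *\<^sub>R s n t) < e"
  have nY2: "(nY (\<lambda>t. v t - w t))\<^sup>2 = As_op T a (\<lambda>t. v t + - 1 *\<^sub>R w t) (\<lambda>t. v t + - 1 *\<^sub>R w t)" if "v \<in> L2 T" "w \<in> L2 T" for v w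
    using Ynorm_power2[OF L2_diff[OF that]] by simp
  have C': "\<forall>e>0. \<exists>N. \<forall>m\<ge>N. \<forall>n\<ge>N. (nY (\<lambda>t. s m t - s n t))\<^sup>2 < e"
    unfolding nY2[OF s s] by (rule C)
  obtain w where w: "w \<in> L2 T" and lim: "(\<lambda>n. LINT t|leb_on T. (norm (s n t - w t))\<^sup>2) \<longlonglongrightarrow> 0"
    using Y_complete[OF s C'] by blast
  obtain M where M: "\<And>v. v \<in> L2 T \<Longrightarrow> (nY v)\<^sup>2 \<le> M\<^sup>2 * (sqint T v)"
    using Ynorm_equiv by metis
  have "(\<lambda>n. (nY (\<lambda>t. s n t - w t))\<^sup>2) \<longlonglongrightarrow> 0"
  proof (rule Lim_null_comparison)
    show "\<forall>\<^sub>F n in sequentially. norm ((nY (\<lambda>t. s n t - w t))\<^sup>2) \<le> M\<^sup>2 * (sqint T (\<lambda>t. s n t - w t))"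
      using M[OF L2_diff[OF s w]] by simp
    show "(\<lambda>n. M\<^sup>2 * (sqint T (\<lambda>t. s n t - w t))) \<longlonglongrightarrow> 0"
      using tendsto_mult[OF tendsto_const lim, of "M\<^sup>2"] by simp
  qed
  then show "\<exists>w\<in>L2 T. (\<lambda>n. As_op T a (\<lambda>t. s n t + - 1 *\<^sub>R w t) (\<lambda>t. s n t + - 1 *\<^sub>R w t)) \<longlonglongrightarrow> 0"
    using w nY2[OF s w] by auto
next
  show "L2 T \<noteq> {}" using L2_zero by blast
qed (use dual_spaceD[OF subspace_Y_L2 f] in \<open>auto simp: L2_add L2_scaleR\<close>)

text \<open>The representer polarizes the squared dual norm of \<open>dt w\<close>. Through it the
  norm of X comes from a semi-inner product, as \<open>projection_quasi_optimal\<close>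
  demands.\<close>

definition dt_riesz :: "(real \<Rightarrow> 'v) \<Rightarrow> (real \<Rightarrow> 'v)" where
  "dt_riesz w = (SOME y. y \<in> L2 T \<and> (\<forall>v\<in>L2 T. As_op T a y v = dt w v))"

lemma dt_riesz:
  assumes "w \<in> XX" shows "dt_riesz w \<in> L2 T" "v \<in> L2 T \<Longrightarrow> As_op T a (dt_riesz w) v = dt w v"
  using someI_ex[of "\<lambda>y. y \<in> L2 T \<and> (\<forall>v\<in>L2 T. As_op T a y v = dt w v)"] Y_Riesz[OF dt_dual[OF assms]]
  unfolding dt_riesz_def by blast+

lemma dual_norm_dt:
  assumes w: "w \<in> XX" shows "(dY (dt w))\<^sup>2 = dt w (dt_riesz w)"
proof -
  note y = dt_riesz[OF w]
  have "dY (dt w) = nY (dt_riesz w)"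
  proof (rule antisym)
    show "dY (dt w) \<le> nY (dt_riesz w)"
      by (rule dual_norm_le[OF subspace_Y_L2 Ynorm_nonneg[OF y(1)]]) (use As_op_le[OF y(1)] y(2) in simp)
    show "nY (dt_riesz w) \<le> dY (dt w)"
    proof (cases "nY (dt_riesz w) = 0")
      case True
      then show ?thesis using dual_norm_nonneg[OF subspace_Y_L2 dt_dual[OF w]] by simp
    next
      case False
      then have "nY (dt_riesz w) > 0" using Ynorm_nonneg[OF y(1)] by simp
      moreover have "nY (dt_riesz w) * nY (dt_riesz w) \<le> dY (dt w) * nY (dt_riesz w)"
        using dual_norm_ge[OF subspace_Y_L2 dt_dual[OF w] y(1)] y(2)[OF y(1)] Ynorm_power2[OF y(1)]
        by (simp add: power2_eq_square)
      ultimately show ?thesis by simp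
    qed
  qed
  then show ?thesis using Ynorm_power2[OF y(1)] y(2)[OF y(1)] by simp
qed

definition inner_X :: "real \<Rightarrow> (real \<Rightarrow> 'v) \<Rightarrow> (real \<Rightarrow> 'v) \<Rightarrow> real" where
  "inner_X \<beta> w v = As_op T a w v + dt w (dt_riesz v) + inner (tr T w) (tr T v) + (\<beta> - 1) * inner (tr 0 w) (tr 0 v)"

lemma inner_X_self:
  assumes "w \<in> XX" shows "inner_X \<beta> w w = (nY w)\<^sup>2 + (dY (dt w))\<^sup>2 + (norm (tr T w))\<^sup>2 + (\<beta> - 1) * (norm (tr 0 w))\<^sup>2"
  using assms by (simp add: inner_X_def dual_norm_dt Ynorm_power2 Xspace_L2 power2_norm_eq_inner)

lemma Xnorm_eq: "w \<in> XX \<Longrightarrow> Xnorm \<iota> T a \<beta> w = sqrt (inner_X \<beta> w w)"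
  by (simp add: Xnorm_def inner_X_self Yspace_def)

lemma inner_X_semi_inner_product:
  assumes \<beta>: "\<beta> \<ge> 1"
  shows "semi_inner_product XX (\<lambda>v w t. v t + w t) (\<lambda>c v t. c *\<^sub>R v t) (inner_X \<beta>)"
proof
  have T0: "0 \<in> {0..T}" "T \<in> {0..T}" using T_pos by auto
  fix x y z c
  assume x: "x \<in> XX"
  show "(\<lambda>t. c *\<^sub>R x t) \<in> XX" using x by (rule Xspace_scale)
  show "0 \<le> inner_X \<beta> x x" using \<beta> x by (simp add: inner_X_self)
  assume y: "y \<in> XX"
  have "dt x (dt_riesz y) = dt y (dt_riesz x)"
    using dt_riesz[OF x] dt_riesz[OF y] Y.form_sym[of "dt_riesz x" "dt_riesz y"] by simp
  then show "inner_X \<beta> x y = inner_X \<beta> y x"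
    using x y Y.form_sym[OF Xspace_L2 Xspace_L2] by (simp add: inner_X_def inner_commute)
  show "(\<lambda>t. x t + y t) \<in> XX" using x y by (rule Xspace_add)
  show "inner_X \<beta> (\<lambda>t. c *\<^sub>R x t) y = c * inner_X \<beta> x y"
    using x y T0 dt_riesz(1)[OF y] by (simp add: inner_X_def Y.form_simps Xspace_L2 dt_scale trace_scale algebra_simps)
  assume z: "z \<in> XX"
  show "inner_X \<beta> (\<lambda>t. x t + y t) z = inner_X \<beta> x z + inner_X \<beta> y z"
    using x y z T0 dt_riesz(1)[OF z]
    by (simp add: inner_X_def Y.form_simps Xspace_L2 dt_add trace_add inner_add_left algebra_simps)
qed

text \<open>The traces are absorbed by \<open>trace_bound\<close>. Together with
  \<open>time_deriv_le_dual_norm\<close> this reduces completeness of X to that of L2.\<close>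

lemma Xnorm_le_L2:
  assumes \<beta>: "\<beta> \<ge> 1"
  shows "\<exists>C. \<forall>w z. has_time_deriv \<iota> T w z \<longrightarrow> (Xnorm \<iota> T a \<beta> w)\<^sup>2
    \<le> C * ((sqint T w) + (sqint T z))"
proof -
  obtain k M where kM: "k > 0" "M > 0" "\<And>v. v \<in> L2 T \<Longrightarrow> sqrt (sqint T v) \<le> k * nY v"
    "\<And>v. v \<in> L2 T \<Longrightarrow> (nY v)\<^sup>2 \<le> M\<^sup>2 * (sqint T v)"
    using Ynorm_equiv by metis
  define D where "D = ((norm \<iota>)\<^sup>2 + T) / T"
  have "(Xnorm \<iota> T a \<beta> w)\<^sup>2 \<le> (M\<^sup>2 + k\<^sup>2 + D + (\<beta> - 1) * D) * ((sqint T w) + (sqint T z))"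
    if wz: "has_time_deriv \<iota> T w z" for w z
  proof -
    define U where "U = (sqint T w)"
    define V where "V = (sqint T z)"
    have UV: "0 \<le> U" "0 \<le> V" by (auto simp: U_def V_def)
    have w: "w \<in> XX" by (rule has_time_deriv_Xspace[OF wz])
    have 1: "(nY w)\<^sup>2 \<le> M\<^sup>2 * (U + V)"
    proof -
      have "(nY w)\<^sup>2 \<le> M\<^sup>2 * U" using kM(4)[OF Xspace_L2[OF w]] by (simp add: U_def)
      also have "\<dots> \<le> M\<^sup>2 * (U + V)" using UV by (intro mult_left_mono) auto
      finally show ?thesis .
    qed
    have 2: "(dY (dt w))\<^sup>2 \<le> k\<^sup>2 * (U + V)"
    proof -
      have "dY (dt w) \<le> sqrt V * k"
      proof (rule dual_norm_le[OF subspace_Y_L2])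
        fix v :: "real \<Rightarrow> 'v" assume v: "v \<in> L2 T"
        show "\<bar>dt w v\<bar> \<le> sqrt V * k * nY v"
          using dt_le[OF wz v] mult_left_mono[OF kM(3)[OF v], of "sqrt V"] UV by (simp add: V_def mult.assoc)
      qed (use UV kM in auto)
      then have "(dY (dt w))\<^sup>2 \<le> (sqrt V * k)\<^sup>2"
        by (rule power_mono) (rule dual_norm_nonneg[OF subspace_Y_L2 dt_dual[OF w]])
      also have "\<dots> = k\<^sup>2 * V" using UV by (simp add: power_mult_distrib)
      also have "\<dots> \<le> k\<^sup>2 * (U + V)" using UV by (intro mult_left_mono) auto
      finally show ?thesis .
    qed
    have 3: "(norm (tr t w))\<^sup>2 \<le> D * (U + V)" if "t \<in> {0..T}" for t
      using trace_bound[OF T_pos wz that] T_pos by (simp add: D_def U_def V_def field_simps)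
    have "(Xnorm \<iota> T a \<beta> w)\<^sup>2 = (nY w)\<^sup>2 + (dY (dt w))\<^sup>2 + (norm (tr T w))\<^sup>2 + (\<beta> - 1) * (norm (tr 0 w))\<^sup>2"
      using inner_X_self[OF w] \<beta> by (simp add: Xnorm_eq[OF w])
    also have "\<dots> \<le> M\<^sup>2 * (U + V) + k\<^sup>2 * (U + V) + D * (U + V) + (\<beta> - 1) * (D * (U + V))"
      using 3[of T] 3[of 0] T_pos \<beta> by (intro add_mono 1 2 mult_left_mono) auto
    also have "\<dots> = (M\<^sup>2 + k\<^sup>2 + D + (\<beta> - 1) * D) * (U + V)" by (simp add: algebra_simps)
    finally show ?thesis by (simp add: U_def V_def)
  qed
  then show ?thesis by blast
qed

text \<open>The representative z of the derivative is itself an admissible test function; testing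
  with it produces the squared norm of z, of which one factor cancels.\<close>

lemma time_deriv_le_dual_norm:
  "\<exists>M. \<forall>w z. has_time_deriv \<iota> T w z \<longrightarrow> (sqint T z) \<le> M\<^sup>2 * (dY (dt w))\<^sup>2"
proof -
  obtain M where M: "M > 0" "\<And>v. v \<in> L2 T \<Longrightarrow> nY v \<le> M * sqrt (sqint T v)"
    using Ynorm_equiv by metis
  have "(sqint T z) \<le> M\<^sup>2 * (dY (dt w))\<^sup>2" if wz: "has_time_deriv \<iota> T w z" for w z
  proof -
    note z = has_time_derivD(2)[OF wz]
    define V where "V = sqrt (sqint T z)"
    have V: "0 \<le> V" "V\<^sup>2 = (sqint T z)" by (auto simp: V_def)
    note dn = dual_norm_nonneg[OF subspace_Y_L2 dt_dual[OF has_time_deriv_Xspace[OF wz]]]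
    have "V\<^sup>2 = dt w z" unfolding V(2) dt_op_eq[OF wz z] by (simp add: power2_norm_eq_inner)
    also have "\<dots> \<le> dY (dt w) * nY z"
      using dual_norm_ge[OF subspace_Y_L2 dt_dual[OF has_time_deriv_Xspace[OF wz]] z] by simp
    also have "\<dots> \<le> dY (dt w) * (M * V)" using M(2)[OF z] dn by (auto simp: V_def intro: mult_left_mono)
    finally have le: "V * V \<le> (M * dY (dt w)) * V" by (simp add: power2_eq_square mult_ac)
    have "V \<le> M * dY (dt w)"
    proof (cases "V = 0")
      case True
      then show ?thesis using M(1) dn by simp
    next
      case False
      then show ?thesis using le V(1) by simp
    qed
    then have "V\<^sup>2 \<le> (M * dY (dt w))\<^sup>2" using V(1) by (rule power_mono)
    then show ?thesis by (simp add: V power_mult_distrib)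
  qed
  then show ?thesis by blast
qed

lemma has_time_deriv_limit:
  assumes wz: "\<And>n. has_time_deriv \<iota> T (s n) (d n)" and w: "w \<in> L2 T" and z: "z \<in> L2 T"
    and slim: "(\<lambda>n. LINT t|leb_on T. (norm (s n t - w t))\<^sup>2) \<longlonglongrightarrow> 0"
    and dlim: "(\<lambda>n. LINT t|leb_on T. (norm (d n t - z t))\<^sup>2) \<longlonglongrightarrow> 0"
  shows "has_time_deriv \<iota> T w z"
  unfolding has_time_deriv_def
proof (intro conjI allI impI w z)
  fix \<phi> \<eta> assume \<phi>: "test_function T \<phi>"
  note cont = test_function_continuous[OF \<phi>]
  \<comment> \<open>The adjoint of \<iota> applied to \<iota> \<eta>: it rewrites a product in H as
    one in V, so that convergence in L2(I;V) is enough.\<close>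
  define c where "c = riesz (H_to_dual \<iota> (\<iota> \<eta>))"
  have c: "inner (\<iota> x) (\<iota> \<eta>) = inner x c" for x
    unfolding c_def by (metis H_to_dual_apply inner_commute inner_riesz)
  have L2c: "(\<lambda>t. deriv \<phi> t *\<^sub>R c) \<in> L2 T" "(\<lambda>t. \<phi> t *\<^sub>R \<eta>) \<in> L2 T"
    by (intro L2_continuous continuous_intros cont)+
  have lim_s: "(\<lambda>n. LINT t|leb_on T. inner (s n t) (deriv \<phi> t *\<^sub>R c)) \<longlonglongrightarrow> (LINT t|leb_on T. inner (w t) (deriv \<phi> t *\<^sub>R c))"
    by (rule L2_limit_inner[OF has_time_derivD(1)[OF wz] w slim L2c(1)])
  have lim_d: "(\<lambda>n. LINT t|leb_on T. inner (d n t) (\<phi> t *\<^sub>R \<eta>)) \<longlonglongrightarrow> (LINT t|leb_on T. inner (z t) (\<phi> t *\<^sub>R \<eta>))"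
    by (rule L2_limit_inner[OF has_time_derivD(2)[OF wz] z dlim L2c(2)])
  have "(LINT t|leb_on T. inner (s n t) (deriv \<phi> t *\<^sub>R c)) = - (LINT t|leb_on T. inner (d n t) (\<phi> t *\<^sub>R \<eta>))" for n
  proof -
    have "(LINT t|leb_on T. deriv \<phi> t * inner (\<iota> (s n t)) (\<iota> \<eta>)) = - (LINT t|leb_on T. \<phi> t * inner (d n t) \<eta>)"
      using wz[of n] \<phi> unfolding has_time_deriv_def by blast
    then show ?thesis by (simp add: c)
  qed
  with lim_s have "(\<lambda>n. - (LINT t|leb_on T. inner (d n t) (\<phi> t *\<^sub>R \<eta>))) \<longlonglongrightarrow> (LINT t|leb_on T. inner (w t) (deriv \<phi> t *\<^sub>R c))"
    by (simp only:)
  from LIMSEQ_unique[OF this tendsto_minus[OF lim_d]]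
  have "(LINT t|leb_on T. inner (w t) (deriv \<phi> t *\<^sub>R c)) = - (LINT t|leb_on T. inner (z t) (\<phi> t *\<^sub>R \<eta>))" .
  then show "(LINT t|leb_on T. deriv \<phi> t * inner (\<iota> (w t)) (\<iota> \<eta>)) = - (LINT t|leb_on T. \<phi> t * inner (z t) \<eta>)"
    by (simp add: c)
qed

text \<open>Functions and derivatives converge separately in L2, and the weak identity survives the
  limit. The traces need no limit of their own: \<open>Xnorm_le_L2\<close> applies to the
  differences from w.\<close>

lemma X_complete:
  assumes \<beta>: "\<beta> \<ge> 1" and s: "\<And>n. s n \<in> XX"
    and C: "\<forall>e>0. \<exists>N. \<forall>m\<ge>N. \<forall>n\<ge>N. (Xnorm \<iota> T a \<beta> (\<lambda>t. s m t - s n t))\<^sup>2 < e"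
  shows "\<exists>w\<in>XX. (\<lambda>n. Xnorm \<iota> T a \<beta> (\<lambda>t. s n t - w t)) \<longlonglongrightarrow> 0"
proof -
  define d where "d n t = riesz (time_deriv \<iota> T (s n) t)" for n t
  have sd: "has_time_deriv \<iota> T (s n) (d n)" for n unfolding d_def[abs_def] by (rule Xspace_has_time_deriv[OF s])
  have sd_diff: "has_time_deriv \<iota> T (\<lambda>t. s m t - s n t) (\<lambda>t. d m t - d n t)" for m n
    using has_time_deriv_combination[OF sd[of m] sd[of n], of 1 "-1"] by simp
  have X2: "(Xnorm \<iota> T a \<beta> w)\<^sup>2 = (nY w)\<^sup>2 + (dY (dt w))\<^sup>2 + (norm (tr T w))\<^sup>2 + (\<beta> - 1) * (norm (tr 0 w))\<^sup>2" if "w \<in> XX" for w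
    using inner_X_self[OF that] \<beta> by (simp add: Xnorm_eq[OF that])
  have nY_le: "(nY w)\<^sup>2 \<le> (Xnorm \<iota> T a \<beta> w)\<^sup>2" and dY_le: "(dY (dt w))\<^sup>2 \<le> (Xnorm \<iota> T a \<beta> w)\<^sup>2" if "w \<in> XX" for w
    unfolding X2[OF that] using \<beta> by auto
  have "\<forall>e>0. \<exists>N. \<forall>m\<ge>N. \<forall>n\<ge>N. (nY (\<lambda>t. s m t - s n t))\<^sup>2 < e"
    using C nY_le[OF Xspace_diff[OF s s]] by (meson le_less_trans)
  from Y_complete[OF Xspace_L2[OF s] this] obtain w where w: "w \<in> L2 T"
    and slim: "(\<lambda>n. LINT t|leb_on T. (norm (s n t - w t))\<^sup>2) \<longlonglongrightarrow> 0" by blast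
  obtain M where M: "\<And>w z. has_time_deriv \<iota> T w z \<Longrightarrow> (sqint T z) \<le> M\<^sup>2 * (dY (dt w))\<^sup>2"
    using time_deriv_le_dual_norm by blast
  have "\<forall>e>0. \<exists>N. \<forall>m\<ge>N. \<forall>n\<ge>N. (sqint T (\<lambda>t. d m t - d n t)) < e"
  proof (intro allI impI)
    fix e :: real assume "e > 0"
    then have "e / (M\<^sup>2 + 1) > 0" by (simp add: add_nonneg_pos)
    with C obtain N where N: "\<forall>m\<ge>N. \<forall>n\<ge>N. (Xnorm \<iota> T a \<beta> (\<lambda>t. s m t - s n t))\<^sup>2 < e / (M\<^sup>2 + 1)" by blast
    have "(sqint T (\<lambda>t. d m t - d n t)) < e" if "m \<ge> N" "n \<ge> N" for m n
    proof -
      have "(sqint T (\<lambda>t. d m t - d n t)) \<le> M\<^sup>2 * (dY (dt (\<lambda>t. s m t - s n t)))\<^sup>2" by (rule M[OF sd_diff])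
      also have "\<dots> \<le> M\<^sup>2 * (Xnorm \<iota> T a \<beta> (\<lambda>t. s m t - s n t))\<^sup>2" by (intro mult_left_mono dY_le Xspace_diff s) simp
      also have "\<dots> \<le> (M\<^sup>2 + 1) * (Xnorm \<iota> T a \<beta> (\<lambda>t. s m t - s n t))\<^sup>2" by (intro mult_right_mono) auto
      also have "\<dots> < e" using N that by (simp add: pos_less_divide_eq add_nonneg_pos mult.commute)
      finally show ?thesis .
    qed
    then show "\<exists>N. \<forall>m\<ge>N. \<forall>n\<ge>N. (sqint T (\<lambda>t. d m t - d n t)) < e" by blast
  qed
  from L2_complete[OF has_time_derivD(2)[OF sd] this] obtain z where z: "z \<in> L2 T"
    and dlim: "(\<lambda>n. LINT t|leb_on T. (norm (d n t - z t))\<^sup>2) \<longlonglongrightarrow> 0" by blast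
  have wz: "has_time_deriv \<iota> T w z" by (rule has_time_deriv_limit[OF sd w z slim dlim])
  have wX: "w \<in> XX" by (rule has_time_deriv_Xspace[OF wz])
  obtain D where D: "\<And>w z. has_time_deriv \<iota> T w z \<Longrightarrow> (Xnorm \<iota> T a \<beta> w)\<^sup>2
    \<le> D * ((sqint T w) + (sqint T z))"
    using Xnorm_le_L2[OF \<beta>] by blast
  have "(\<lambda>n. (Xnorm \<iota> T a \<beta> (\<lambda>t. s n t - w t))\<^sup>2) \<longlonglongrightarrow> 0"
  proof (rule Lim_null_comparison)
    let ?b = "\<lambda>n. D * ((sqint T (\<lambda>t. s n t - w t)) + (sqint T (\<lambda>t. d n t - z t)))"
    have "has_time_deriv \<iota> T (\<lambda>t. s n t - w t) (\<lambda>t. d n t - z t)" for n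
      using has_time_deriv_combination[OF sd[of n] wz, of 1 "-1"] by simp
    then show "\<forall>\<^sub>F n in sequentially. norm ((Xnorm \<iota> T a \<beta> (\<lambda>t. s n t - w t))\<^sup>2) \<le> ?b n"
      using D by simp
    show "?b \<longlonglongrightarrow> 0" using tendsto_mult[OF tendsto_const tendsto_add[OF slim dlim], of D] by simp
  qed
  from tendsto_real_sqrt[OF this] have "(\<lambda>n. Xnorm \<iota> T a \<beta> (\<lambda>t. s n t - w t)) \<longlonglongrightarrow> 0"
    using X2 by (simp add: tendsto_rabs_zero_iff)
  with wX show ?thesis by blast
qed

section \<open>Two-sided bounds for the residual in dual norms\<close>

lemma residual_upper:
  assumes \<beta>: "\<beta> \<ge> 1" and w: "w \<in> XX"
  shows "(dY (B w))\<^sup>2 + \<beta> * (norm (tr 0 w))\<^sup>2 \<le> upper_const (Aa_norm T a) * inner_X \<beta> w w"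
proof -
  let ?\<alpha> = "Aa_norm T a" and ?f = "\<lambda>v. dt w v + Aa_op T a w v"
  note w2 = Xspace_L2[OF w] and S = subspace_Y_L2
  have f: "?f \<in> dual_space T a (L2 T)" by (intro dual_space_add S dt_dual w Aa_op_dual w2)
  have Aa: "dY (Aa_op T a w) \<le> ?\<alpha> * nY w"
    by (rule dual_norm_le[OF S]) (use Aa_op_le[OF w2] Aa_norm_nonneg Ynorm_nonneg[OF w2] in auto)
  have "dY ?f \<le> dY (dt w) + ?\<alpha> * nY w"
    using dual_norm_triangle[OF S dt_dual[OF w] Aa_op_dual[OF w2]] Aa by simp
  then have "(dY ?f)\<^sup>2 + (nY w)\<^sup>2 \<le> (dY (dt w) + ?\<alpha> * nY w)\<^sup>2 + (nY w)\<^sup>2"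
    using dual_norm_nonneg[OF S f] by (intro add_right_mono power_mono) auto
  also have "\<dots> \<le> upper_const ?\<alpha> * ((dY (dt w))\<^sup>2 + (nY w)\<^sup>2)"
    by (intro upper_const_bound Aa_norm_nonneg dual_norm_nonneg[OF S dt_dual[OF w]] Ynorm_nonneg w2)
  finally have main: "(dY ?f)\<^sup>2 + (nY w)\<^sup>2 \<le> upper_const ?\<alpha> * ((dY (dt w))\<^sup>2 + (nY w)\<^sup>2)" .
  \<comment> \<open>The cross term of the shift is 2 (dt w)(w), since \<open>Aa_op\<close> vanishes
    on the diagonal. The energy identity turns it into traces, and \<beta> becomes \<beta> -
    1.\<close>
  have "(dY (B w))\<^sup>2 + \<beta> * (norm (tr 0 w))\<^sup>2 = ((dY ?f)\<^sup>2 + (nY w)\<^sup>2) + ((norm (tr T w))\<^sup>2 + (\<beta> - 1) * (norm (tr 0 w))\<^sup>2)"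
    unfolding B_op_split dual_norm_shift[OF S f w2] using dt_energy[OF w] by (simp add: algebra_simps)
  also have "\<dots> \<le> upper_const ?\<alpha> * ((dY (dt w))\<^sup>2 + (nY w)\<^sup>2) + upper_const ?\<alpha> * ((norm (tr T w))\<^sup>2 + (\<beta> - 1) * (norm (tr 0 w))\<^sup>2)"
  proof (rule add_mono[OF main])
    have "0 \<le> (norm (tr T w))\<^sup>2 + (\<beta> - 1) * (norm (tr 0 w))\<^sup>2" using \<beta> by simp
    from mult_right_mono[OF upper_const_ge_1[OF Aa_norm_nonneg] this]
    show "(norm (tr T w))\<^sup>2 + (\<beta> - 1) * (norm (tr 0 w))\<^sup>2 \<le> upper_const ?\<alpha> * ((norm (tr T w))\<^sup>2 + (\<beta> - 1) * (norm (tr 0 w))\<^sup>2)"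
      by simp
  qed
  also have "\<dots> = upper_const ?\<alpha> * inner_X \<beta> w w" unfolding inner_X_self[OF w] by (simp add: algebra_simps)
  finally show ?thesis .
qed

lemma residual_lower:
  assumes \<beta>: "\<beta> \<ge> 1" and w: "w \<in> XX" and S: "subspace_Y S" and wS: "w \<in> S"
    and \<gamma>: "0 < \<gamma>" "\<gamma> \<le> 1" "\<gamma> * dY (dt w) \<le> dual_norm T a S (dt w)"
  shows "lower_const (Aa_norm T a) \<gamma> * inner_X \<beta> w w \<le> (dual_norm T a S (B w))\<^sup>2 + \<beta> * (norm (tr 0 w))\<^sup>2"
proof -
  let ?\<alpha> = "Aa_norm T a" and ?f = "\<lambda>v. dt w v + Aa_op T a w v" and ?dS = "dual_norm T a S"
  note w2 = Xspace_L2[OF w]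
  have dtS: "dt w \<in> dual_space T a S" and AaS: "Aa_op T a w \<in> dual_space T a S"
    by (intro dual_space_restrict[OF S] dt_dual w Aa_op_dual w2)+
  have f: "?f \<in> dual_space T a S" by (rule dual_space_add[OF S dtS AaS])
  have Aa: "?dS (\<lambda>v. - 1 * Aa_op T a w v) \<le> ?\<alpha> * nY w"
    by (rule dual_norm_le[OF S]) (use Aa_op_le[OF w2] subspace_YD(1)[OF S] Aa_norm_nonneg Ynorm_nonneg[OF w2] in auto)
  \<comment> \<open>Here \<open>dt w\<close> is \<open>?f\<close> minus the skew part, which bounds
    the norm of \<open>?f\<close> from below. The bound may be negative, a case that
    \<open>lower_const_bound\<close> covers.\<close>
  have "?dS (dt w) \<le> ?dS ?f + ?dS (\<lambda>v. - 1 * Aa_op T a w v)"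
    using dual_norm_triangle[OF S f dual_space_scale[OF S AaS, of "-1"]] by simp
  then have "\<gamma> * dY (dt w) - ?\<alpha> * nY w \<le> ?dS ?f" using \<gamma>(3) Aa by linarith
  then have main: "lower_const ?\<alpha> \<gamma> * ((dY (dt w))\<^sup>2 + (nY w)\<^sup>2) \<le> (?dS ?f)\<^sup>2 + (nY w)\<^sup>2"
    by (intro lower_const_bound \<gamma> Aa_norm_nonneg dual_norm_nonneg[OF subspace_Y_L2 dt_dual[OF w]] Ynorm_nonneg w2
        dual_norm_nonneg[OF S f])
  have "lower_const ?\<alpha> \<gamma> * inner_X \<beta> w w = lower_const ?\<alpha> \<gamma> * ((dY (dt w))\<^sup>2 + (nY w)\<^sup>2)
      + lower_const ?\<alpha> \<gamma> * ((norm (tr T w))\<^sup>2 + (\<beta> - 1) * (norm (tr 0 w))\<^sup>2)"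
    unfolding inner_X_self[OF w] by (simp add: algebra_simps)
  also have "\<dots> \<le> ((?dS ?f)\<^sup>2 + (nY w)\<^sup>2) + ((norm (tr T w))\<^sup>2 + (\<beta> - 1) * (norm (tr 0 w))\<^sup>2)"
  proof (rule add_mono[OF main])
    have "0 \<le> (norm (tr T w))\<^sup>2 + (\<beta> - 1) * (norm (tr 0 w))\<^sup>2" using \<beta> by simp
    from mult_right_mono[OF lower_const_props(3)[OF Aa_norm_nonneg \<gamma>(1,2)] this]
    show "lower_const ?\<alpha> \<gamma> * ((norm (tr T w))\<^sup>2 + (\<beta> - 1) * (norm (tr 0 w))\<^sup>2) \<le> (norm (tr T w))\<^sup>2 + (\<beta> - 1) * (norm (tr 0 w))\<^sup>2"
      by simp
  qed
  also have "\<dots> = (?dS (B w))\<^sup>2 + \<beta> * (norm (tr 0 w))\<^sup>2"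
    unfolding B_op_split dual_norm_shift[OF S f wS] using dt_energy[OF w] by (simp add: algebra_simps)
  finally show ?thesis .
qed

lemma dual_norm_eq_0:
  assumes S: "subspace_Y S" and "\<And>v. v \<in> S \<Longrightarrow> f v = 0" shows "dual_norm T a S f = 0"
proof (rule antisym)
  show "dual_norm T a S f \<le> 0" by (rule dual_norm_le[OF S]) (use assms in auto)
  have "\<forall>v\<in>S. \<bar>f v\<bar> \<le> 0 * nY v" using assms by simp
  then have "f \<in> dual_space T a S" unfolding dual_space_def using assms subspace_YD[OF S] by (simp add: exI[of _ 0])
  then show "0 \<le> dual_norm T a S f" by (rule dual_norm_nonneg[OF S])
qed

section \<open>The preconditioned residual form\<close>

definition resid :: "(((real \<Rightarrow> 'v) \<Rightarrow> real) \<Rightarrow> (real \<Rightarrow> 'v)) \<Rightarrow> real \<Rightarrow> (real \<Rightarrow> 'v) \<Rightarrow> (real \<Rightarrow> 'v) \<Rightarrow> real" where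
  "resid K \<beta> z w = B w (K (B z)) + \<beta> * inner (tr 0 z) (tr 0 w)"

context
  fixes S :: "(real \<Rightarrow> 'v) set" and K r R
  assumes S: "subspace_Y S" and K: "boundedly_invertible_map T a S K" and sym: "symmetric_map T a S K"
    and r: "0 < r" "r \<le> R"
    and spectral: "\<And>v. v \<in> S \<Longrightarrow> r * As_op T a v v \<le> inverse_map T a S K v v \<and> inverse_map T a S K v v \<le> R * As_op T a v v"
begin

lemma K_in: "f \<in> dual_space T a S \<Longrightarrow> K f \<in> S"
  using K by (simp add: boundedly_invertible_map_def)

text \<open>K is linear up to null sets only. A bounded functional does not see them, so the
  identity becomes exact once f is applied.\<close>

lemma K_combination:
  assumes f: "f \<in> dual_space T a S" and h: "h \<in> dual_space T a S" and k: "k \<in> dual_space T a S"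
  shows "f (K (\<lambda>v. c * h v + d * k v)) = c * f (K h) + d * f (K k)"
proof -
  have "ae_eq T (K (\<lambda>v. f v + h v)) (\<lambda>t. K f t + K h t)" if "f \<in> dual_space T a S" "h \<in> dual_space T a S" for f h
    using K that unfolding boundedly_invertible_map_def by simp
  note ae_add = this[OF dual_space_scale[OF S h, of c] dual_space_scale[OF S k, of d]]
  have ae_scale: "ae_eq T (K (\<lambda>v. c * f v)) (\<lambda>t. c *\<^sub>R K f t)" if "f \<in> dual_space T a S" for f c
    using K that unfolding boundedly_invertible_map_def by simp
  note ae = ae_add ae_scale[OF h, of c] ae_scale[OF k, of d]
  have "ae_eq T (K (\<lambda>v. c * h v + d * k v)) (\<lambda>t. c *\<^sub>R K h t + d *\<^sub>R K k t)"
    using ae unfolding ae_eq_def by eventually_elim simp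
  moreover have in1: "(\<lambda>t. c *\<^sub>R K h t) \<in> S" "(\<lambda>t. d *\<^sub>R K k t) \<in> S"
    using subspace_YD(4)[OF S K_in] h k by auto
  ultimately have "f (K (\<lambda>v. c * h v + d * k v)) = f (\<lambda>t. c *\<^sub>R K h t + d *\<^sub>R K k t)"
    by (intro dual_space_cong_AE[OF S f] K_in dual_space_combination[OF S] subspace_YD(3)[OF S] h k)
  also have "\<dots> = c * f (K h) + d * f (K k)"
    using dual_spaceD(1)[OF S f in1] dual_spaceD(2)[OF S f K_in] h k by simp
  finally show ?thesis .
qed

text \<open>Different functionals may represent the same element of S'. Their difference has dual
  norm 0, so boundedness of K makes its image null.\<close>

lemma K_cong:
  assumes f: "f \<in> dual_space T a S" and h: "h \<in> dual_space T a S" and k: "k \<in> dual_space T a S"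
    and eq: "\<And>v. v \<in> S \<Longrightarrow> h v = k v"
  shows "f (K h) = f (K k)"
proof -
  let ?d = "\<lambda>v. 1 * h v + (- 1) * k v"
  have d: "?d \<in> dual_space T a S" by (rule dual_space_combination[OF S h k])
  obtain C where C: "\<forall>f\<in>dual_space T a S. nY (K f) \<le> C * dual_norm T a S f"
    using K unfolding boundedly_invertible_map_def by blast
  have "dual_norm T a S ?d = 0" by (rule dual_norm_eq_0[OF S]) (use eq in simp)
  then have "nY (K ?d) \<le> 0" using C[rule_format, OF d] by simp
  then have "nY (K ?d) = 0" using Ynorm_nonneg[OF subspace_YD(1)[OF S K_in[OF d]]] by simp
  then have "f (K ?d) = 0" using dual_norm_ge[OF S f K_in[OF d]] by simp
  then show ?thesis using K_combination[OF f h k, of 1 "-1"] by simp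
qed

text \<open>The choice in \<open>inverse_map\<close> is harmless by the last inequality in
  \<open>boundedly_invertible_map\<close>: the chosen preimage and f differ by a functional with
  null image, hence with dual norm 0.\<close>

lemma inverse_map_K:
  assumes f: "f \<in> dual_space T a S" and v: "v \<in> S"
  shows "inverse_map T a S K (K f) v = f v"
proof -
  define h where "h = inverse_map T a S K (K f)"
  have "\<exists>h. h \<in> dual_space T a S \<and> ae_eq T (K h) (K f)" using f by (auto simp: ae_eq_def)
  from someI_ex[OF this] have h: "h \<in> dual_space T a S" "ae_eq T (K h) (K f)"
    unfolding h_def inverse_map_def by auto
  let ?d = "\<lambda>v. 1 * h v + (- 1) * f v"
  have d: "?d \<in> dual_space T a S" by (rule dual_space_combination[OF S h(1) f])
  obtain C where C: "\<forall>f\<in>dual_space T a S. dual_norm T a S f \<le> C * nY (K f)"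
    using K unfolding boundedly_invertible_map_def by blast
  have "(nY (K ?d))\<^sup>2 = As_op T a (K ?d) (K ?d)" by (rule Ynorm_power2[OF subspace_YD(1)[OF S K_in[OF d]]])
  also have "\<dots> = 1 * As_op T a (K ?d) (K h) + (- 1) * As_op T a (K ?d) (K f)"
    by (rule K_combination[OF dual_space_As_op[OF S subspace_YD(1)[OF S K_in[OF d]]] h(1) f])
  also have "As_op T a (K ?d) (K h) = As_op T a (K ?d) (K f)"
    by (rule dual_space_cong_AE[OF S dual_space_As_op[OF S subspace_YD(1)[OF S K_in[OF d]]] K_in[OF h(1)] K_in[OF f] h(2)])
  finally have "nY (K ?d) = 0" by simp
  then have "dual_norm T a S ?d \<le> 0" using C[rule_format, OF d] by simp
  then have "dual_norm T a S ?d * nY v \<le> 0" using Ynorm_nonneg[OF subspace_YD(1)[OF S v]] by (simp add: mult_nonpos_nonneg)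
  with dual_norm_ge[OF S d v] show ?thesis by (simp add: h_def)
qed

lemma K_spectral:
  assumes f: "f \<in> dual_space T a S"
  shows "r * (nY (K f))\<^sup>2 \<le> f (K f)" "f (K f) \<le> R * (nY (K f))\<^sup>2"
  using spectral[OF K_in[OF f]] inverse_map_K[OF f K_in[OF f]] Ynorm_power2[OF subspace_YD(1)[OF S K_in[OF f]]] by auto

lemma K_nonneg: "f \<in> dual_space T a S \<Longrightarrow> 0 \<le> f (K f)"
  using K_spectral(1)[of f] r(1) by (smt (verit) mult_nonneg_nonneg zero_le_power2)

text \<open>With n the norm of K f, the pairing is at most n times the dual norm and at least r n^2.
  Young's inequality, the square of the dual norm minus r n, eliminates n.\<close>

lemma K_upper:
  assumes f: "f \<in> dual_space T a S" shows "r * f (K f) \<le> (dual_norm T a S f)\<^sup>2"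
proof -
  let ?q = "f (K f)" and ?d = "dual_norm T a S f" and ?n = "nY (K f)"
  have "?q \<le> ?d * ?n" using dual_norm_ge[OF S f K_in[OF f]] by simp
  then have "2 * r * ?q \<le> 2 * r * (?d * ?n)" using r(1) by simp
  moreover have "r * (r * ?n\<^sup>2) \<le> r * ?q" using K_spectral(1)[OF f] r(1) by simp
  moreover have "0 \<le> (?d - r * ?n)\<^sup>2" by simp
  ultimately show ?thesis by (simp add: power2_eq_square algebra_simps)
qed

text \<open>Surjectivity writes a test function as K h. Cauchy-Schwarz for the symmetric form f(K h)
  then leaves h(K h), which is bounded by R times the squared norm of the test function.\<close>

lemma K_lower:
  assumes f: "f \<in> dual_space T a S" shows "(dual_norm T a S f)\<^sup>2 \<le> R * f (K f)"
proof -
  have R: "R > 0" using r by simp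
  have "dual_norm T a S f \<le> sqrt (R * f (K f))"
  proof (rule dual_norm_le[OF S])
    fix v assume v: "v \<in> S"
    obtain h where h: "h \<in> dual_space T a S" "ae_eq T (K h) v" using K v unfolding boundedly_invertible_map_def by blast
    have fv: "f v = f (K h)" using dual_space_cong_AE[OF S f K_in[OF h(1)] v h(2)] by simp
    have nY_eq: "(nY (K h))\<^sup>2 = (nY v)\<^sup>2"
    proof -
      note L = subspace_YD(1)[OF S K_in[OF h(1)]] subspace_YD(1)[OF S v]
      have "As_op T a (K h) (K h) = As_op T a (K h) v"
        by (rule dual_space_cong_AE[OF S dual_space_As_op[OF S L(1)] K_in[OF h(1)] v h(2)])
      also have "\<dots> = As_op T a v (K h)" by (rule Y.form_sym[OF L])
      also have "\<dots> = As_op T a v v"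
        by (rule dual_space_cong_AE[OF S dual_space_As_op[OF S L(2)] K_in[OF h(1)] v h(2)])
      finally show ?thesis by (simp add: Ynorm_power2 L)
    qed
    have "(f (K h))\<^sup>2 \<le> f (K f) * h (K h)"
    proof (rule quadratic_nonneg_imp_Cauchy_Schwarz)
      fix t :: real
      let ?k = "\<lambda>v. 1 * f v + t * h v"
      have k: "?k \<in> dual_space T a S" by (rule dual_space_combination[OF S f h(1)])
      have "0 \<le> ?k (K ?k)" by (rule K_nonneg[OF k])
      also have "\<dots> = f (K f) + 2 * f (K h) * t + h (K h) * t\<^sup>2"
        using K_combination[OF f f h(1), of 1 t] K_combination[OF h(1) f h(1), of 1 t] sym f h(1)
        by (simp add: symmetric_map_def power2_eq_square algebra_simps)
      finally show "0 \<le> f (K f) + 2 * f (K h) * t + h (K h) * t\<^sup>2" .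
    qed
    also have "\<dots> \<le> f (K f) * (R * (nY v)\<^sup>2)"
      using K_spectral(2)[OF h(1)] K_nonneg[OF f] nY_eq by (intro mult_left_mono) auto
    finally have "(f v)\<^sup>2 \<le> R * f (K f) * (nY v)\<^sup>2" by (simp add: fv mult_ac)
    then have "\<bar>f v\<bar> \<le> sqrt (R * f (K f) * (nY v)\<^sup>2)" by (simp add: real_le_rsqrt)
    then show "\<bar>f v\<bar> \<le> sqrt (R * f (K f)) * nY v"
      using Ynorm_nonneg[OF subspace_YD(1)[OF S v]] by (simp add: real_sqrt_mult)
  qed (use R K_nonneg[OF f] in auto)
  then have "(dual_norm T a S f)\<^sup>2 \<le> (sqrt (R * f (K f)))\<^sup>2"
    by (rule power_mono) (rule dual_norm_nonneg[OF S f])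
  then show ?thesis using R K_nonneg[OF f] by simp
qed

lemma B_dual_S: "w \<in> XX \<Longrightarrow> B w \<in> dual_space T a S"
  by (intro dual_space_restrict[OF S] B_dual)

lemma resid_semi_inner_product:
  assumes \<beta>: "\<beta> \<ge> 1"
  shows "semi_inner_product XX (\<lambda>v w t. v t + w t) (\<lambda>c v t. c *\<^sub>R v t) (resid K \<beta>)"
proof
  have T0: "0 \<in> {0..T}" using T_pos by simp
  fix x y z c
  assume x: "x \<in> XX"
  note Bx = B_dual_S[OF x]
  show "(\<lambda>t. c *\<^sub>R x t) \<in> XX" using x by (rule Xspace_scale)
  show "0 \<le> resid K \<beta> x x" using \<beta> K_nonneg[OF Bx] by (simp add: resid_def)
  assume y: "y \<in> XX"
  note By = B_dual_S[OF y]
  show sym_xy: "resid K \<beta> x y = resid K \<beta> y x"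
    using sym Bx By by (simp add: resid_def symmetric_map_def inner_commute)
  show "(\<lambda>t. x t + y t) \<in> XX" using x y by (rule Xspace_add)
  \<comment> \<open>B is linear only when tested with functions in \<open>L2 T\<close>, so the two
    arguments of K agree on S but need not be equal functionals.\<close>
  have "B y (K (B (\<lambda>t. c *\<^sub>R x t))) = B y (K (\<lambda>v. c * B x v + 0 * B x v))"
    by (rule K_cong[OF By B_dual_S[OF Xspace_scale[OF x]] dual_space_combination[OF S Bx Bx]])
       (use x subspace_YD(1)[OF S] in \<open>simp add: B_scale\<close>)
  then show "resid K \<beta> (\<lambda>t. c *\<^sub>R x t) y = c * resid K \<beta> x y"
    using K_combination[OF By Bx Bx, of c 0] x T0 by (simp add: resid_def trace_scale algebra_simps)
  assume z: "z \<in> XX"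
  note Bz = B_dual_S[OF z]
  have "B z (K (B (\<lambda>t. x t + y t))) = B z (K (\<lambda>v. 1 * B x v + 1 * B y v))"
    by (rule K_cong[OF Bz B_dual_S[OF Xspace_add[OF x y]] dual_space_combination[OF S Bx By]])
       (use x y subspace_YD(1)[OF S] in \<open>simp add: B_add\<close>)
  then show "resid K \<beta> (\<lambda>t. x t + y t) z = resid K \<beta> x z + resid K \<beta> y z"
    using K_combination[OF Bz Bx By, of 1 1] x y T0 by (simp add: resid_def trace_add inner_add_left algebra_simps)
qed

lemma resid_upper:
  assumes \<beta>: "\<beta> \<ge> 1" and w: "w \<in> XX"
  shows "resid K \<beta> w w \<le> upper_const (Aa_norm T a) / min r 1 * inner_X \<beta> w w"
proof -
  note Bw = B_dual_S[OF w]
  have m: "0 < min r 1" using r by simp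
  have dS: "dual_norm T a S (B w) \<le> dY (B w)"
    by (rule dual_norm_le[OF S dual_norm_nonneg[OF subspace_Y_L2 B_dual[OF w]]])
       (use dual_norm_ge[OF subspace_Y_L2 B_dual[OF w]] subspace_YD(1)[OF S] in blast)
  \<comment> \<open>\<open>K_upper\<close> costs a factor r on the residual and none on the trace
    term; \<open>min r 1\<close> is a common factor for both.\<close>
  have "min r 1 * resid K \<beta> w w \<le> r * B w (K (B w)) + \<beta> * (norm (tr 0 w))\<^sup>2"
  proof -
    have "min r 1 * B w (K (B w)) \<le> r * B w (K (B w))" using K_nonneg[OF Bw] by (intro mult_right_mono) auto
    moreover have "min r 1 * (\<beta> * (norm (tr 0 w))\<^sup>2) \<le> 1 * (\<beta> * (norm (tr 0 w))\<^sup>2)" using \<beta> by (intro mult_right_mono) auto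
    ultimately show ?thesis by (simp add: resid_def power2_norm_eq_inner distrib_left)
  qed
  also have "\<dots> \<le> (dY (B w))\<^sup>2 + \<beta> * (norm (tr 0 w))\<^sup>2"
    using K_upper[OF Bw] power_mono[OF dS dual_norm_nonneg[OF S Bw], of 2] by simp
  also have "\<dots> \<le> upper_const (Aa_norm T a) * inner_X \<beta> w w" by (rule residual_upper[OF \<beta> w])
  finally show ?thesis using m by (simp add: pos_le_divide_eq mult.commute)
qed

lemma resid_lower:
  assumes \<beta>: "\<beta> \<ge> 1" and w: "w \<in> XX" "w \<in> S" and \<gamma>: "0 < \<gamma>" "\<gamma> \<le> 1" "\<gamma> * dY (dt w) \<le> dual_norm T a S (dt w)"
  shows "lower_const (Aa_norm T a) \<gamma> / max R 1 * inner_X \<beta> w w \<le> resid K \<beta> w w"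
proof -
  note Bw = B_dual_S[OF w(1)]
  have m: "0 < max R 1" by simp
  have "lower_const (Aa_norm T a) \<gamma> * inner_X \<beta> w w \<le> (dual_norm T a S (B w))\<^sup>2 + \<beta> * (norm (tr 0 w))\<^sup>2"
    by (rule residual_lower[OF \<beta> w(1) S w(2) \<gamma>])
  also have "\<dots> \<le> R * B w (K (B w)) + \<beta> * (norm (tr 0 w))\<^sup>2" using K_lower[OF Bw] by simp
  also have "\<dots> \<le> max R 1 * resid K \<beta> w w"
  proof -
    have "R * B w (K (B w)) \<le> max R 1 * B w (K (B w))" using K_nonneg[OF Bw] by (intro mult_right_mono) auto
    moreover have "1 * (\<beta> * (norm (tr 0 w))\<^sup>2) \<le> max R 1 * (\<beta> * (norm (tr 0 w))\<^sup>2)" using \<beta> by (intro mult_right_mono) auto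
    ultimately show ?thesis by (simp add: resid_def power2_norm_eq_inner distrib_left)
  qed
  finally show ?thesis using m by (simp add: pos_divide_le_eq mult.commute)
qed

text \<open>The solution represents the functional \<open>resid K \<beta> u\<close> on W. The lower
  bound makes Cauchy sequences of the residual form Cauchy in X, closedness keeps their limits in W,
  and the upper bound returns convergence in the form.\<close>

lemma discrete_solution:
  assumes \<beta>: "\<beta> \<ge> 1" and W: "closed_subspace_in (Xnorm \<iota> T a \<beta>) XX W" and WS: "W \<subseteq> S"
    and \<gamma>: "0 < \<gamma>" "\<gamma> \<le> 1" "\<And>w. w \<in> W \<Longrightarrow> \<gamma> * dY (dt w) \<le> dual_norm T a S (dt w)"
    and u: "u \<in> XX"
  shows "\<exists>m\<in>W. (\<forall>w\<in>W. resid K \<beta> m w = resid K \<beta> u w) \<and>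
    (\<forall>z\<in>W. (\<forall>w\<in>W. resid K \<beta> z w = resid K \<beta> u w) \<longrightarrow> ae_eq T z m) \<and>
    Xnorm \<iota> T a \<beta> (\<lambda>t. u t - m t)
      \<le> sqrt ((max R 1 * upper_const (Aa_norm T a)) / (min r 1 * lower_const (Aa_norm T a) \<gamma>))
        * (INF w\<in>W. Xnorm \<iota> T a \<beta> (\<lambda>t. u t - w t))"
proof -
  let ?X = "Xnorm \<iota> T a \<beta>"
  define lo where "lo = lower_const (Aa_norm T a) \<gamma> / max R 1"
  define up where "up = upper_const (Aa_norm T a) / min r 1"
  interpret E: semi_inner_product XX "\<lambda>v w t. v t + w t" "\<lambda>c v t. c *\<^sub>R v t" "resid K \<beta>"
    by (rule resid_semi_inner_product[OF \<beta>])
  interpret G: semi_inner_product XX "\<lambda>v w t. v t + w t" "\<lambda>c v t. c *\<^sub>R v t" "inner_X \<beta>"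
    by (rule inner_X_semi_inner_product[OF \<beta>])
  have W1: "W \<subseteq> XX" "(\<lambda>t. 0) \<in> W" and W_add: "\<And>v w. v \<in> W \<Longrightarrow> w \<in> W \<Longrightarrow> (\<lambda>t. v t + w t) \<in> W"
    and W_scale: "\<And>c v. v \<in> W \<Longrightarrow> (\<lambda>t. c *\<^sub>R v t) \<in> W"
    and W_closed: "\<And>s w. (\<And>k. s k \<in> W) \<Longrightarrow> w \<in> XX \<Longrightarrow> (\<lambda>k::nat. ?X (\<lambda>t. s k t - w t)) \<longlonglongrightarrow> 0 \<Longrightarrow> w \<in> W"
    using W unfolding closed_subspace_in_def by blast+
  have W_diff: "(\<lambda>t. v t - w t) \<in> W" if "v \<in> W" "w \<in> W" for v w
    using W_add[OF that(1) W_scale[OF that(2), of "-1"]] by simp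
  have X2: "(?X w)\<^sup>2 = inner_X \<beta> w w" if "w \<in> XX" for w
    using G.form_nonneg[OF that] by (simp add: Xnorm_eq[OF that])
  have X0: "0 \<le> ?X w" if "w \<in> XX" for w
    using G.form_nonneg[OF that] by (simp add: Xnorm_eq[OF that])
  note lp = lower_const_props[OF Aa_norm_nonneg \<gamma>(1,2)]
  have l0: "0 < lo" unfolding lo_def using lp(1) by simp
  have lc: "lo \<le> up"
  proof -
    have "lo \<le> 1 / 1" unfolding lo_def using lp(1,3) by (intro frac_le) auto
    also have "\<dots> \<le> up" unfolding up_def using upper_const_ge_1[OF Aa_norm_nonneg] r(1) by (intro frac_le) auto
    finally show ?thesis .
  qed
  have lower: "lo * inner_X \<beta> w w \<le> resid K \<beta> w w" if "w \<in> W" for w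
    unfolding lo_def using resid_lower[OF \<beta> _ _ \<gamma>(1,2) \<gamma>(3)[OF that]] that W1 WS by blast
  have upper: "resid K \<beta> w w \<le> up * inner_X \<beta> w w" if "w \<in> XX" for w unfolding up_def by (rule resid_upper[OF \<beta> that])
  have "\<exists>m\<in>W. \<forall>w\<in>W. resid K \<beta> m w = resid K \<beta> u w"
  proof (rule E.Riesz)
    show "\<bar>resid K \<beta> u x\<bar> \<le> sqrt (resid K \<beta> u u) * sqrt (resid K \<beta> x x)" if "x \<in> W" for x
      using E.form_le_sqrt[OF u] that W1 by blast
    fix s :: "nat \<Rightarrow> real \<Rightarrow> 'v"
    assume s: "\<And>n. s n \<in> W"
      and C: "\<forall>e>0. \<exists>N. \<forall>m\<ge>N. \<forall>n\<ge>N. resid K \<beta> (\<lambda>t. s m t + - 1 *\<^sub>R s n t) (\<lambda>t. s m t + - 1 *\<^sub>R s n t) < e"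
    have sX: "s n \<in> XX" for n using s W1 by blast
    have "\<forall>e>0. \<exists>N. \<forall>m\<ge>N. \<forall>n\<ge>N. (?X (\<lambda>t. s m t - s n t))\<^sup>2 < e"
    proof (intro allI impI)
      fix e :: real assume "e > 0"
      \<comment> \<open>Passing to the norm of X by the lower bound divides by
        \<open>lo\<close>.\<close>
      with l0 have "lo * e > 0" by (rule mult_pos_pos)
      with C obtain N where N: "\<forall>m\<ge>N. \<forall>n\<ge>N. resid K \<beta> (\<lambda>t. s m t + - 1 *\<^sub>R s n t) (\<lambda>t. s m t + - 1 *\<^sub>R s n t) < lo * e" by blast
      have "(?X (\<lambda>t. s m t - s n t))\<^sup>2 < e" if mn: "m \<ge> N" "n \<ge> N" for m n
      proof -
        have "lo * inner_X \<beta> (\<lambda>t. s m t - s n t) (\<lambda>t. s m t - s n t) \<le> resid K \<beta> (\<lambda>t. s m t - s n t) (\<lambda>t. s m t - s n t)"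
          by (rule lower[OF W_diff[OF s s]])
        also have "\<dots> < lo * e" using N mn by simp
        finally show ?thesis unfolding X2[OF Xspace_diff[OF sX sX]] using l0 by (simp only: mult_less_cancel_left_pos)
      qed
      then show "\<exists>N. \<forall>m\<ge>N. \<forall>n\<ge>N. (?X (\<lambda>t. s m t - s n t))\<^sup>2 < e" by blast
    qed
    from X_complete[OF \<beta> sX this] obtain w where w: "w \<in> XX" and lim: "(\<lambda>n. ?X (\<lambda>t. s n t - w t)) \<longlonglongrightarrow> 0" by blast
    have wW: "w \<in> W" by (rule W_closed[OF s w lim])
    have "(\<lambda>n. resid K \<beta> (\<lambda>t. s n t - w t) (\<lambda>t. s n t - w t)) \<longlonglongrightarrow> 0"
    proof (rule Lim_null_comparison)
      show "\<forall>\<^sub>F n in sequentially. norm (resid K \<beta> (\<lambda>t. s n t - w t) (\<lambda>t. s n t - w t)) \<le> up * (?X (\<lambda>t. s n t - w t))\<^sup>2"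
        using upper[OF Xspace_diff[OF sX w]] E.form_nonneg[OF Xspace_diff[OF sX w]] X2[OF Xspace_diff[OF sX w]] by simp
      show "(\<lambda>n. up * (?X (\<lambda>t. s n t - w t))\<^sup>2) \<longlonglongrightarrow> 0"
        using tendsto_mult[OF tendsto_const tendsto_power[OF lim, of 2], of up] by simp
    qed
    with wW show "\<exists>w\<in>W. (\<lambda>n. resid K \<beta> (\<lambda>t. s n t + - 1 *\<^sub>R w t) (\<lambda>t. s n t + - 1 *\<^sub>R w t)) \<longlonglongrightarrow> 0" by auto
  qed (use W1 W_add W_scale u in \<open>auto simp: E.form_add_right E.form_scale_right subset_iff\<close>)
  then obtain m where m: "m \<in> W" "\<And>w. w \<in> W \<Longrightarrow> resid K \<beta> m w = resid K \<beta> u w" by blast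
  have mX: "m \<in> XX" using m W1 by blast
  have unique: "ae_eq T z m" if z: "z \<in> W" "\<forall>w\<in>W. resid K \<beta> z w = resid K \<beta> u w" for z
  proof -
    have zX: "z \<in> XX" using z W1 by blast
    let ?d = "\<lambda>t. z t - m t"
    have d: "?d \<in> W" "?d \<in> XX" using W_diff[OF z(1) m(1)] W1 by auto
    have "resid K \<beta> ?d ?d = resid K \<beta> z ?d - resid K \<beta> m ?d"
      using E.form_add[OF zX Xspace_scale[OF mX, of "-1"] d(2)] E.form_scale[OF mX d(2), of "-1"] by simp
    also have "\<dots> = 0" using z(2) m(2) d(1) by simp
    finally have "lo * inner_X \<beta> ?d ?d \<le> 0" using lower[OF d(1)] by simp
    then have "inner_X \<beta> ?d ?d \<le> 0" using l0 by (simp only: mult_le_0_iff) linarith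
    \<comment> \<open>The norm of Y is part of the norm of X and detects equality almost
      everywhere.\<close>
    moreover have "(nY ?d)\<^sup>2 \<le> inner_X \<beta> ?d ?d" unfolding inner_X_self[OF d(2)] using \<beta> by simp
    ultimately have "(nY ?d)\<^sup>2 \<le> 0" by linarith
    then have "nY ?d = 0" by simp
    then show ?thesis using Ynorm_eq_0_iff[OF Xspace_L2[OF zX] Xspace_L2[OF mX]] by blast
  qed
  let ?q = "sqrt ((max R 1 * upper_const (Aa_norm T a)) / (min r 1 * lower_const (Aa_norm T a) \<gamma>))"
  have q_eq: "(max R 1 * upper_const (Aa_norm T a)) / (min r 1 * lower_const (Aa_norm T a) \<gamma>) = up / lo"
    by (simp add: up_def lo_def)
  have q0: "0 < ?q"
    unfolding q_eq by (rule real_sqrt_gt_zero[OF divide_pos_pos[OF less_le_trans[OF l0 lc] l0]])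
  have err: "?X (\<lambda>t. u t - m t) \<le> ?q * ?X (\<lambda>t. u t - w t)" if w: "w \<in> W" for w
  proof -
    have wX: "w \<in> XX" using w W1 by blast
    have um: "(\<lambda>t. u t - m t) \<in> XX" and uw: "(\<lambda>t. u t - w t) \<in> XX" using Xspace_diff u mX wX by auto
    have "lo * inner_X \<beta> (\<lambda>t. u t + - 1 *\<^sub>R m t) (\<lambda>t. u t + - 1 *\<^sub>R m t)
        \<le> up * inner_X \<beta> (\<lambda>t. u t + - 1 *\<^sub>R w t) (\<lambda>t. u t + - 1 *\<^sub>R w t)"
      by (rule projection_quasi_optimal[OF resid_semi_inner_product[OF \<beta>] inner_X_semi_inner_product[OF \<beta>] W1(1)])
         (fact W_add W_scale lower upper l0 lc u m w)+
    then have "lo * inner_X \<beta> (\<lambda>t. u t - m t) (\<lambda>t. u t - m t) \<le> up * inner_X \<beta> (\<lambda>t. u t - w t) (\<lambda>t. u t - w t)"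
      by simp
    moreover have "x \<le> c / l * y" if "l * x \<le> c * y" "0 < l" for x y c l :: real
      using that by (simp add: pos_le_divide_eq mult.commute)
    ultimately have "(?X (\<lambda>t. u t - m t))\<^sup>2 \<le> up / lo * (?X (\<lambda>t. u t - w t))\<^sup>2"
      unfolding X2[OF um] X2[OF uw] using l0 by blast
    then have "?X (\<lambda>t. u t - m t) \<le> sqrt (up / lo * (?X (\<lambda>t. u t - w t))\<^sup>2)" by (rule real_le_rsqrt)
    also have "\<dots> = ?q * ?X (\<lambda>t. u t - w t)" unfolding q_eq real_sqrt_mult using X0[OF uw] by simp
    finally show ?thesis .
  qed
  \<comment> \<open>After division by the positive \<open>?q\<close> the left-hand side is a lower
    bound of the set whose infimum is taken.\<close>
  have "?X (\<lambda>t. u t - m t) / ?q \<le> (INF w\<in>W. ?X (\<lambda>t. u t - w t))"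
    by (rule cINF_greatest) (use W1(2) err q0 in \<open>auto simp: pos_divide_le_eq mult.commute simp del: real_sqrt_gt_0_iff\<close>)
  then have "?X (\<lambda>t. u t - m t) \<le> ?q * (INF w\<in>W. ?X (\<lambda>t. u t - w t))"
    using q0 by (simp only: pos_divide_le_eq mult.commute)
  with m unique show ?thesis by blast
qed

end

text \<open>If the derivative of w does not vanish, w competes in the infimum and the quotient can
  be cleared; otherwise the left-hand side is 0.\<close>

lemma gamma_dt_le:
  assumes \<gamma>: "\<gamma> = gamma_dt \<iota> T a \<Delta> X Y" "\<gamma> > 0" and \<delta>: "\<delta> \<in> \<Delta>" and w: "w \<in> X \<delta>" "w \<in> XX" and S: "subspace_Y (Y \<delta>)"
  shows "\<gamma> * dY (dt w) \<le> dual_norm T a (Y \<delta>) (dt w)"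
proof (cases "\<exists>v\<in>L2 T. dt w v \<noteq> 0")
  case False
  then have "dY (dt w) = 0" by (intro dual_norm_eq_0 subspace_Y_L2) auto
  then show ?thesis using dual_norm_nonneg[OF S dual_space_restrict[OF S dt_dual[OF w(2)]]] by simp
next
  case True
  then obtain v where v: "v \<in> L2 T" "dt w v \<noteq> 0" by blast
  note dn = dual_norm_nonneg[OF subspace_Y_L2 dt_dual[OF w(2)]]
  have "dY (dt w) \<noteq> 0" using dual_norm_ge[OF subspace_Y_L2 dt_dual[OF w(2)] v(1)] v(2) by auto
  with dn have pos: "dY (dt w) > 0" by simp
  define I where "I = (INF \<delta>\<in>\<Delta>. INF w\<in>{w \<in> X \<delta>. \<exists>v\<in>Yspace T. dt w v \<noteq> 0}.
          ereal (dual_norm T a (Y \<delta>) (dt w) / dual_norm T a (Yspace T) (dt w)))"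
  have \<gamma>I: "\<gamma> = real_of_ereal (min 1 I)" using \<gamma>(1) by (simp add: gamma_dt_def I_def)
  \<comment> \<open>An infimum of minus infinity would be converted to 0, against \<gamma> > 0; for
    plus infinity \<gamma> is 1.\<close>
  have "ereal \<gamma> \<le> I"
    using \<gamma>(2) unfolding \<gamma>I by (cases I) (auto simp: min_def one_ereal_def split: if_splits)
  also have "I \<le> ereal (dual_norm T a (Y \<delta>) (dt w) / dY (dt w))"
    unfolding I_def using \<delta> w v by (intro INF_lower2[OF \<delta>] INF_lower2[of w]) (auto simp: Yspace_def)
  finally show ?thesis using pos by (simp add: pos_le_divide_eq)
qed

end

lemma gamma_dt_le_1: "gamma_dt \<iota> T a \<Delta> X Y \<le> 1"
proof -
  have "real_of_ereal (min 1 I) \<le> 1" for I :: ereal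
    by (cases I) (auto simp: min_def one_ereal_def split: if_splits)
  then show ?thesis by (simp add: gamma_dt_def)
qed

theorem theorem3p1:
  fixes \<iota> :: "'v::{real_inner, banach, second_countable_topology} \<Rightarrow>\<^sub>L
                'h::{real_inner, banach, second_countable_topology}"
    and T :: real
    and a :: "real \<Rightarrow> 'v \<Rightarrow> 'v \<Rightarrow> real"
    and \<Delta> :: "'d set"
    and X Y :: "'d \<Rightarrow> (real \<Rightarrow> 'v) set"
    and K :: "'d \<Rightarrow> ((real \<Rightarrow> 'v) \<Rightarrow> real) \<Rightarrow> (real \<Rightarrow> 'v)"
    and r R \<beta> \<alpha> \<gamma> :: real
    and g :: "(real \<Rightarrow> 'v) \<Rightarrow> real"
    and u\<^sub>0 :: 'h
    and u :: "real \<Rightarrow> 'v"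
  assumes "inj (blinfun_apply \<iota>)" and "closure (range (blinfun_apply \<iota>)) = UNIV"
    and "T > 0"
    and "AE t in leb_on T. bilinear (a t)"
    and "\<And>\<eta> \<zeta>. (\<lambda>t. a t \<eta> \<zeta>) \<in> borel_measurable (leb_on T)"
    and "\<exists>M. AE t in leb_on T. \<forall>\<eta> \<zeta>. \<bar>a t \<eta> \<zeta>\<bar> \<le> M * norm \<eta> * norm \<zeta>"
    and "\<exists>m>0. AE t in leb_on T. \<forall>\<eta>. a t \<eta> \<eta> \<ge> m * (norm \<eta>)\<^sup>2"
    and "\<beta> \<ge> 1"
    and "\<And>\<delta>. \<delta> \<in> \<Delta> \<Longrightarrow> closed_subspace_in (Xnorm \<iota> T a \<beta>) (Xspace \<iota> T) (X \<delta>)"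
    and "\<And>\<delta>. \<delta> \<in> \<Delta> \<Longrightarrow> closed_subspace_in (Ynorm T a) (Yspace T) (Y \<delta>)"
    and "\<And>\<delta>. \<delta> \<in> \<Delta> \<Longrightarrow> \<exists>w\<in>X \<delta>. \<not> ae_eq T w (\<lambda>t. 0)"
    and "\<And>\<delta>. \<delta> \<in> \<Delta> \<Longrightarrow> \<exists>v\<in>Y \<delta>. \<not> ae_eq T v (\<lambda>t. 0)"
    and "\<And>\<delta>. \<delta> \<in> \<Delta> \<Longrightarrow> X \<delta> \<subseteq> Y \<delta>"
    and "\<gamma> = gamma_dt \<iota> T a \<Delta> X Y" and "\<gamma> > 0"
    and "\<And>\<delta>. \<delta> \<in> \<Delta> \<Longrightarrow> boundedly_invertible_map T a (Y \<delta>) (K \<delta>)"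
    and "\<And>\<delta>. \<delta> \<in> \<Delta> \<Longrightarrow> symmetric_map T a (Y \<delta>) (K \<delta>)"
    and "0 < r" and "r \<le> R"
    and "\<And>\<delta> v. \<delta> \<in> \<Delta> \<Longrightarrow> v \<in> Y \<delta> \<Longrightarrow>
           r * As_op T a v v \<le> inverse_map T a (Y \<delta>) (K \<delta>) v v \<and>
           inverse_map T a (Y \<delta>) (K \<delta>) v v \<le> R * As_op T a v v"
    and "g \<in> dual_space T a (Yspace T)"
    and "u \<in> Xspace \<iota> T"
    and "\<forall>v\<in>Yspace T. B_op \<iota> T a u v = g v" and "trace_at \<iota> T 0 u = u\<^sub>0"
    and "\<alpha> = Aa_norm T a"
  shows "\<forall>\<delta>\<in>\<Delta>.
    let solves = (\<lambda>z. \<forall>w\<in>X \<delta>.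
          B_op \<iota> T a w (K \<delta> (B_op \<iota> T a z)) + \<beta> * inner (trace_at \<iota> T 0 z) (trace_at \<iota> T 0 w)
          = B_op \<iota> T a w (K \<delta> g) + \<beta> * inner u\<^sub>0 (trace_at \<iota> T 0 w))
    in \<exists>u\<delta>\<in>X \<delta>. solves u\<delta> \<and> (\<forall>z\<in>X \<delta>. solves z \<longrightarrow> ae_eq T z u\<delta>) \<and>
         Xnorm \<iota> T a \<beta> (\<lambda>t. u t - u\<delta> t)
         \<le> sqrt ((max R 1 * (1 + (\<alpha>\<^sup>2 + \<alpha> * sqrt (\<alpha>\<^sup>2 + 4)) / 2)) /
                  (min r 1 * ((\<gamma>\<^sup>2 + \<alpha>\<^sup>2 + 1 - sqrt ((\<gamma>\<^sup>2 + \<alpha>\<^sup>2 + 1)\<^sup>2 - 4 * \<gamma>\<^sup>2)) / 2)))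
            * (INF w\<in>X \<delta>. Xnorm \<iota> T a \<beta> (\<lambda>t. u t - w t))"
proof (rule ballI, goal_cases)
  case \<delta>: (1 \<delta>)
  interpret parabolic \<iota> T a
    by standard (fact assms(3) assms(4) assms(5) assms(6) assms(7))+
  note S = closed_subspace_imp_subspace_Y[OF assms(10)[OF \<delta>]]
  note K_ctxt = S assms(16)[OF \<delta>] assms(17)[OF \<delta>] assms(18,19) assms(20)[OF \<delta>]
  have \<gamma>1: "\<gamma> \<le> 1" unfolding assms(14) by (rule gamma_dt_le_1)
  have XX: "X \<delta> \<subseteq> XX" using assms(9)[OF \<delta>] by (simp add: closed_subspace_in_def)
  have \<gamma>_le: "\<gamma> * dY (dt w) \<le> dual_norm T a (Y \<delta>) (dt w)" if "w \<in> X \<delta>" for w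
    by (rule gamma_dt_le[OF assms(14,15) \<delta> that _ S]) (use that XX in blast)
  \<comment> \<open>The data g and \<open>u\<^sub>0\<close> are those of u, so the right-hand side
    is the residual form at u and the discrete equation is orthogonality of the error. As g and
    \<open>B u\<close> agree only on Y, this goes through \<open>K_cong\<close>.\<close>
  have rhs: "B w (K \<delta> g) + \<beta> * inner u\<^sub>0 (tr 0 w) = resid (K \<delta>) \<beta> u w" if "w \<in> X \<delta>" for w
  proof -
    have "B w (K \<delta> g) = B w (K \<delta> (B u))"
    proof (rule K_cong[OF K_ctxt])
      show "B w \<in> dual_space T a (Y \<delta>)" "B u \<in> dual_space T a (Y \<delta>)" "g \<in> dual_space T a (Y \<delta>)"
        using that XX assms(21,22) by (auto intro!: dual_space_restrict[OF S] B_dual simp: Yspace_def)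
      show "g v = B u v" if "v \<in> Y \<delta>" for v
        using assms(23) subspace_YD(1)[OF S that] by (simp add: Yspace_def)
    qed
    then show ?thesis by (simp add: resid_def assms(24))
  qed
  from discrete_solution[OF K_ctxt assms(8) assms(9)[OF \<delta>] assms(13)[OF \<delta>] assms(15) \<gamma>1 \<gamma>_le assms(22)]
  show ?case
    unfolding Let_def upper_const_def lower_const_def assms(25)[symmetric]
    using rhs by (simp add: resid_def)
qed

end
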